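(* Let $\mathscr{P}$ be a $C^*$-planar algebra and let $x\in\mathscr{P}_{2,\pm}$ be $\mathfrak{F}$-positive and irreducible on $\mathscr{P}_{1,\pm}$. Let $r$ be the spectral radius of $x$. Then there exists a unique (up to a scalar) strictly positive element $y\in\mathscr{P}_{1,\pm}$ such that $y*\widehat{x}=r\,y$. Moreover, if $y'\in\mathscr{P}_{1,\pm}$ is any (not necessarily positive) element with $y'*\widehat{x}=r\,y'$, then $y'$ is a scalar multiple of $y$.
   Context: $C^*$-planar algebra: a (shaded) planar algebra in the sense of Jones is a family $\mathscr{P}=\{\mathscr{P}_{n,\pm}\}_{n\ge 0}$ of complex vector spaces on which shaded planar tangles act multilinearly, compatibly with isotopy and composition of tangles. Elements of $\mathscr{P}_{n,\pm}$ are boxes with $n$ strings attached on top and $n$ on the bottom; the region at the left (marked) side is unshaded for $+$ and shaded for $-$. It is a $C^*$-planar algebra if each $\mathscr{P}_{n,\pm}$ is a finite-dimensional unital $C^*$-algebra (unit $I$) for the vertical stacking product ($xy$ is drawn with $y$ above $x$), the involution $*$ is compatible with reflection of tangles in a horizontal line, and there are positive faithful traces $tr_{n,\pm}$ with $tr_{n,\pm}(x)=tr_{0,\pm}$(closure of $x$), the closure joining each top string to the corresponding bottom string. Fourier transform: $\mathfrak{F}:\mathscr{P}_{2,\pm}\to\mathscr{P}_{2,\mp}$, $\widehat{x}=\mathfrak{F}(x)$, is the $90^\circ$ rotation: the top-left, top-right, bottom-left, bottom-right boundary points of $\widehat{x}$ are connected respectively to the bottom-left, top-left, bottom-right, top-right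 points of $x$. Convolution: for $y\in\mathscr{P}_{1,\pm}$ and $u\in\mathscr{P}_{2,\mp}$, $y*u\in\mathscr{P}_{1,\pm}$ is obtained by placing $y$ to the left of $u$ and joining the top (bottom) end of $y$ to the top-left (bottom-left) point of $u$. An element of a $C^*$-algebra is positive if it is of the form $aa^*$, and strictly positive if it is positive and invertible. $x\in\mathscr{P}_{2,\pm}$ is $\mathfrak{F}$-positive if $\widehat{x}$ is positive in $\mathscr{P}_{2,\mp}$. An $\mathfrak{F}$-positive $x\in\mathscr{P}_{2,\pm}$ is irreducible on $\mathscr{P}_{1,\pm}$ if for any projection $p\in\mathscr{P}_{1,\pm}$, the inequality $p*\widehat{x}\le\lambda p$ for some $\lambda>0$ implies $p=0$ or $p=I$. *)

theory Defs
  imports "HOL-Analysis.Analysis"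
begin

section \<open>Shaded planar tangles\<close>

text \<open>
  Planar tangles are represented up to isotopy by finite combinatorial data.

  A colour \<open>(n, s)\<close> describes a disc with \<open>2 * n\<close> boundary points whose marked boundary segment
  lies in a shaded region iff \<open>s\<close>; so \<open>(n, False)\<close> is $(n,+)$ and \<open>(n, True)\<close> is $(n,-)$.
  The points of a disc are numbered \<open>0, ..., 2 * n - 1\<close> clockwise from the marked segment, and
  segment \<open>k\<close> ends (clockwise) at point \<open>k\<close>; thus segment 0 is the marked one.  A disc without points
  has a single segment 0.  For a box with its marked segment on the left, the \<open>i\<close>-th point from the
  left is point \<open>i\<close> on the top and point \<open>2 * n - 1 - i\<close> on the bottom (\<open>0 \<le> i < n\<close>).
\<close>

type_synonym colour = "nat \<times> bool"

definition num_points :: "colour list \<Rightarrow> nat \<Rightarrow> nat" where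
  "num_points ds d = 2 * fst (ds ! d)"

definition num_segments :: "colour list \<Rightarrow> nat \<Rightarrow> nat" where
  "num_segments ds d = max 1 (num_points ds d)"

definition points :: "colour list \<Rightarrow> (nat \<times> nat) set" where
  "points ds = {(d, j). d < length ds \<and> j < num_points ds d}"

definition segments :: "colour list \<Rightarrow> (nat \<times> nat) set" where
  "segments ds = {(d, k). d < length ds \<and> k < num_segments ds d}"

definition seg_shaded :: "colour list \<Rightarrow> nat \<Rightarrow> nat \<Rightarrow> bool" where
  "seg_shaded ds d k \<longleftrightarrow> (snd (ds ! d) \<noteq> odd k)"

definition adjacent_segments :: "colour list \<Rightarrow> nat \<Rightarrow> nat \<Rightarrow> nat set" where
  "adjacent_segments ds d j = {j, Suc j mod num_points ds d}"

text \<open>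
  Every string is oriented with its unshaded side on its left.  The predicate says that the string
  at point \<open>j\<close> of disc \<open>d\<close> starts (rather than ends) there.  Disc 0 is the output disc, which is seen
  from its inside.
\<close>

definition outgoing :: "colour list \<Rightarrow> nat \<Rightarrow> nat \<Rightarrow> bool" where
  "outgoing ds d j \<longleftrightarrow> ((d = 0) = seg_shaded ds d j)"

text \<open>
  \<open>discs\<close> lists the output disc followed by the input discs.  \<open>strings\<close> are the connected components
  of the one-manifold, including closed loops; \<open>regions\<close> are the connected components of the
  complement of discs and strings.  \<open>string_at d j\<close> is the string at point \<open>j\<close> of disc \<open>d\<close>,
  \<open>region_at d k\<close> the region at segment \<open>k\<close> of disc \<open>d\<close>, and \<open>side e b\<close> is the region on the
  shaded (\<open>b = True\<close>) or unshaded (\<open>b = False\<close>) side of the string \<open>e\<close>.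
\<close>

record tangle =
  discs :: "colour list"
  strings :: "nat set"
  regions :: "nat set"
  string_at :: "nat \<Rightarrow> nat \<Rightarrow> nat"
  region_at :: "nat \<Rightarrow> nat \<Rightarrow> nat"
  side :: "nat \<Rightarrow> bool \<Rightarrow> nat"

definition gen_equiv :: "('v \<times> 'v) set \<Rightarrow> ('v \<times> 'v) set" where
  "gen_equiv r = (r \<union> r\<inverse>)\<^sup>*"

text \<open>
  The boundary of a region is a union of closed curves, each passing along disc segments and sides
  of strings.  These curves are the components of the following graph; each side of a closed loop
  is a component of its own, and so is the boundary of a disc without points.
\<close>

definition boundary_links :: "tangle \<Rightarrow> ((nat \<times> nat + nat \<times> bool) \<times> (nat \<times> nat + nat \<times> bool)) set" where
  "boundary_links T =
     {(Inl (d, k), Inr (string_at T d j, seg_shaded (discs T) d k)) | d j k.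
        (d, j) \<in> points (discs T) \<and> k \<in> adjacent_segments (discs T) d j}"

definition boundary_curves :: "tangle \<Rightarrow> (nat \<times> nat + nat \<times> bool) set set" where
  "boundary_curves T =
     (segments (discs T) <+> strings T \<times> UNIV) // gen_equiv (boundary_links T)"

definition connection_links :: "tangle \<Rightarrow> ((nat + nat) \<times> (nat + nat)) set" where
  "connection_links T =
     {(Inl d, Inr (region_at T d k)) | d k. (d, k) \<in> segments (discs T)} \<union>
     {(Inr (side T e True), Inr (side T e False)) | e. e \<in> strings T}"

text \<open>
  Filling the boundary curves of each region by a sphere with holes, and attaching discs and strings,
  gives a closed oriented surface with Euler characteristic
  $\#\mathrm{discs} - \#\mathrm{arcs} + \sum_R (2 - \#\mathrm{curves}(R))$.  The data describe a
  tangle in the plane iff this surface is a sphere, i.e. connected of Euler characteristic 2.  They then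
  determine the tangle up to isotopy, because orientation preserving homeomorphisms
  of a disc fixing its boundary are isotopic to the identity.
\<close>

definition planar_tangle :: "tangle \<Rightarrow> bool" where
  "planar_tangle T \<longleftrightarrow>
     discs T \<noteq> [] \<and> finite (strings T) \<and> finite (regions T) \<and>
     (\<forall>(d, j) \<in> points (discs T). string_at T d j \<in> strings T) \<and>
     (\<forall>(d, k) \<in> segments (discs T). region_at T d k \<in> regions T) \<and>
     (\<forall>e \<in> strings T. \<forall>b. side T e b \<in> regions T) \<and>
     (\<forall>(d, j) \<in> points (discs T). \<forall>k \<in> adjacent_segments (discs T) d j.
        side T (string_at T d j) (seg_shaded (discs T) d k) = region_at T d k) \<and>
     (\<exists>shaded :: nat \<Rightarrow> bool.
        (\<forall>(d, k) \<in> segments (discs T). shaded (region_at T d k) = seg_shaded (discs T) d k) \<and>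
        (\<forall>e \<in> strings T. \<forall>b. shaded (side T e b) = b)) \<and>
     (\<forall>e \<in> strings T.
        {(d, j) \<in> points (discs T). string_at T d j = e} = {} \<or>
        (\<exists>d j d' j'. {(d, j) \<in> points (discs T). string_at T d j = e} = {(d, j), (d', j')} \<and>
           outgoing (discs T) d j \<and> \<not> outgoing (discs T) d' j')) \<and>
     (\<forall>v \<in> {..<length (discs T)} <+> regions T. (Inl 0, v) \<in> gen_equiv (connection_links T)) \<and>
     int (length (discs T)) - int (card (points (discs T)) div 2)
       + (2 * int (card (regions T)) - int (card (boundary_curves T))) = 2"

text \<open>Equality of tangles up to isotopy, where input disc \<open>d\<close> of \<open>T\<close> is called \<open>\<sigma> d\<close> in \<open>T'\<close>.\<close>

definition tangle_iso :: "(nat \<Rightarrow> nat) \<Rightarrow> tangle \<Rightarrow> tangle \<Rightarrow> bool" where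
  "tangle_iso \<sigma> T T' \<longleftrightarrow>
     length (discs T') = length (discs T) \<and>
     bij_betw \<sigma> {..<length (discs T)} {..<length (discs T)} \<and> \<sigma> 0 = 0 \<and>
     (\<forall>d < length (discs T). discs T' ! \<sigma> d = discs T ! d) \<and>
     (\<exists>f g. bij_betw f (strings T) (strings T') \<and> bij_betw g (regions T) (regions T') \<and>
        (\<forall>(d, j) \<in> points (discs T). string_at T' (\<sigma> d) j = f (string_at T d j)) \<and>
        (\<forall>(d, k) \<in> segments (discs T). region_at T' (\<sigma> d) k = g (region_at T d k)) \<and>
        (\<forall>e \<in> strings T. \<forall>b. side T' (f e) b = g (side T e b)))"

text \<open>
  \<open>R\<close> is the tangle obtained from \<open>T\<close> by gluing \<open>S\<close> into the input disc \<open>i\<close>.  Its strings and regions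
  are those of \<open>T\<close> and \<open>S\<close>, merged along the boundary of that disc (which may create closed loops);
  the input discs of \<open>S\<close> take the place of disc \<open>i\<close>.
\<close>

definition tangle_comp :: "tangle \<Rightarrow> nat \<Rightarrow> tangle \<Rightarrow> tangle \<Rightarrow> bool" where
  "tangle_comp T i S R \<longleftrightarrow>
     0 < i \<and> i < length (discs T) \<and> hd (discs S) = discs T ! i \<and>
     discs R = take i (discs T) @ tl (discs S) @ drop (Suc i) (discs T) \<and>
     (let dT = (\<lambda>d. if d < i then d else d + length (discs S) - 2);
          dS = (\<lambda>d. i + d - 1)
      in \<exists>f g.
        f ` (strings T <+> strings S) = strings R \<and>
        (\<forall>a \<in> strings T <+> strings S. \<forall>b \<in> strings T <+> strings S. f a = f b \<longleftrightarrow>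
           (a, b) \<in> gen_equiv {(Inl (string_at T i j), Inr (string_at S 0 j)) | j.
                                 j < num_points (discs T) i}) \<and>
        g ` (regions T <+> regions S) = regions R \<and>
        (\<forall>a \<in> regions T <+> regions S. \<forall>b \<in> regions T <+> regions S. g a = g b \<longleftrightarrow>
           (a, b) \<in> gen_equiv {(Inl (region_at T i k), Inr (region_at S 0 k)) | k.
                                 k < num_segments (discs T) i}) \<and>
        (\<forall>(d, j) \<in> points (discs T). d \<noteq> i \<longrightarrow> string_at R (dT d) j = f (Inl (string_at T d j))) \<and>
        (\<forall>(d, j) \<in> points (discs S). d \<noteq> 0 \<longrightarrow> string_at R (dS d) j = f (Inr (string_at S d j))) \<and>
        (\<forall>(d, k) \<in> segments (discs T). d \<noteq> i \<longrightarrow> region_at R (dT d) k = g (Inl (region_at T d k))) \<and>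
        (\<forall>(d, k) \<in> segments (discs S). d \<noteq> 0 \<longrightarrow> region_at R (dS d) k = g (Inr (region_at S d k))) \<and>
        (\<forall>e \<in> strings T. \<forall>b. side R (f (Inl e)) b = g (Inl (side T e b))) \<and>
        (\<forall>e \<in> strings S. \<forall>b. side R (f (Inr e)) b = g (Inr (side S e b))))"

text \<open>Reflection in a horizontal line keeps the marked segments on the left.\<close>

definition reflect_tangle :: "tangle \<Rightarrow> tangle" where
  "reflect_tangle T = T\<lparr>
     string_at := (\<lambda>d j. string_at T d (num_points (discs T) d - 1 - j)),
     region_at := (\<lambda>d k. region_at T d ((num_points (discs T) d - k) mod num_segments (discs T) d))\<rparr>"

subsection \<open>The tangles used below\<close>

text \<open>
  A tangle in which every string ends on a disc and every region touches a disc is given by labels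
  for the strings at the points and for the regions at the segments.
\<close>

definition simple_tangle :: "colour list \<Rightarrow> (nat \<Rightarrow> nat \<Rightarrow> nat) \<Rightarrow> (nat \<Rightarrow> nat \<Rightarrow> nat) \<Rightarrow> tangle" where
  "simple_tangle ds st rg = \<lparr>
     discs = ds,
     strings = {st d j | d j. (d, j) \<in> points ds},
     regions = {rg d k | d k. (d, k) \<in> segments ds},
     string_at = st,
     region_at = rg,
     side = (\<lambda>e b. THE r. \<exists>d j k. (d, j) \<in> points ds \<and> k \<in> adjacent_segments ds d j \<and>
               st d j = e \<and> seg_shaded ds d k = b \<and> rg d k = r)\<rparr>"

definition identity_tangle :: "nat \<Rightarrow> bool \<Rightarrow> tangle" where
  "identity_tangle n s = simple_tangle [(n, s), (n, s)] (\<lambda>d j. j) (\<lambda>d k. k)"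

text \<open>\<open>n\<close> vertical strings, without input disc.\<close>

definition unit_tangle :: "nat \<Rightarrow> bool \<Rightarrow> tangle" where
  "unit_tangle n s = simple_tangle [(n, s)] (\<lambda>d j. min j (2 * n - 1 - j)) (\<lambda>d k. min k (2 * n - k))"

text \<open>
  Disc 2 is placed above disc 1.  The strings between the two discs are labelled
  \<open>n, ..., 2 * n - 1\<close>, and the regions strictly between these strings \<open>2 * n + 1, ..., 3 * n - 1\<close>.
\<close>

definition stack_tangle :: "nat \<Rightarrow> bool \<Rightarrow> tangle" where
  "stack_tangle n s = simple_tangle [(n, s), (n, s), (n, s)]
     (\<lambda>d j. if d = 0 then (if j < n then j else n + j)
            else if d = 1 then n + j
            else (if j < n then j else 3 * n - 1 - j))
     (\<lambda>d k. if d = 0 then k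
            else if d = 1 then (if 0 < k \<and> k < n then 2 * n + k else k)
            else (if k \<le> n then k else 4 * n - k))"

text \<open>Each top point is joined to the corresponding bottom point around the right of the disc.\<close>

definition closure_tangle :: "nat \<Rightarrow> bool \<Rightarrow> tangle" where
  "closure_tangle n s =
     simple_tangle [(0, s), (n, s)] (\<lambda>d j. min j (2 * n - 1 - j)) (\<lambda>d k. min k (2 * n - k))"

text \<open>Output points 0, 1, 2, 3 are joined to the input points 3, 0, 1, 2.\<close>

definition fourier_tangle :: "bool \<Rightarrow> tangle" where
  "fourier_tangle s = simple_tangle [(2, \<not> s), (2, s)]
     (\<lambda>d j. if d = 0 then (j + 3) mod 4 else j) (\<lambda>d k. if d = 0 then (k + 3) mod 4 else k)"

text \<open>
  Disc 1 is to the left of disc 2; the top (bottom) point of disc 1 is joined to the top-left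
  (bottom-left) point of disc 2.  The tables list the labels for the discs 0, 1, 2.
\<close>

definition convolution_tangle :: "bool \<Rightarrow> tangle" where
  "convolution_tangle s = simple_tangle [(1, s), (1, s), (2, \<not> s)]
     (\<lambda>d j. [[1, 2], [0, 3], [0, 1, 2, 3]] ! d ! j)
     (\<lambda>d k. [[1, 2], [1, 0], [0, 1, 2, 1]] ! d ! k)"

section \<open>\<open>C\<^sup>*\<close>-planar algebras\<close>

text \<open>
  The spaces $\mathscr{P}_{n,\pm}$ are subspaces \<open>pspace PA n s\<close> of one ambient complex vector space
  with scalar multiplication \<open>scl PA\<close>.  This is no restriction on the
  family, which embeds in its direct sum; no relation between the subspaces is assumed.
  \<open>act PA T\<close> takes the list of arguments for the input discs \<open>1, 2, ...\<close> of \<open>T\<close>.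
\<close>

record 'a cstar_planar_data =
  scl :: "complex \<Rightarrow> 'a \<Rightarrow> 'a"
  pspace :: "nat \<Rightarrow> bool \<Rightarrow> 'a set"
  act :: "tangle \<Rightarrow> 'a list \<Rightarrow> 'a"
  invol :: "nat \<Rightarrow> bool \<Rightarrow> 'a \<Rightarrow> 'a"
  trc :: "nat \<Rightarrow> bool \<Rightarrow> 'a \<Rightarrow> complex"

definition tangle_args :: "'a cstar_planar_data \<Rightarrow> tangle \<Rightarrow> 'a list \<Rightarrow> bool" where
  "tangle_args PA T xs \<longleftrightarrow> list_all2 (\<lambda>x (n, s). x \<in> pspace PA n s) xs (tl (discs T))"

locale planar_algebra =
  fixes PA :: "'a::ab_group_add cstar_planar_data"
  assumes ambient: "vector_space (scl PA)"
    and subspace: "module.subspace (scl PA) (pspace PA n s)"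
    and act_closed:
      "planar_tangle T \<Longrightarrow> tangle_args PA T xs \<Longrightarrow> hd (discs T) = (n, s) \<Longrightarrow> act PA T xs \<in> pspace PA n s"
    and act_multilinear:
      "planar_tangle T \<Longrightarrow> i < length xs \<Longrightarrow>
       tangle_args PA T (xs[i := x]) \<Longrightarrow> tangle_args PA T (xs[i := y]) \<Longrightarrow>
       act PA T (xs[i := scl PA c x + y]) = scl PA c (act PA T (xs[i := x])) + act PA T (xs[i := y])"
    and act_isotopy:
      "planar_tangle T \<Longrightarrow> planar_tangle T' \<Longrightarrow> tangle_iso \<sigma> T T' \<Longrightarrow>
       tangle_args PA T xs \<Longrightarrow> tangle_args PA T' xs' \<Longrightarrow>
       (\<And>i. i < length xs \<Longrightarrow> xs' ! (\<sigma> (Suc i) - 1) = xs ! i) \<Longrightarrow>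
       act PA T' xs' = act PA T xs"
    and act_identity:
      "x \<in> pspace PA n s \<Longrightarrow> act PA (identity_tangle n s) [x] = x"
    and act_comp:
      "planar_tangle T \<Longrightarrow> planar_tangle S \<Longrightarrow> planar_tangle R \<Longrightarrow> tangle_comp T i S R \<Longrightarrow>
       tangle_args PA T (xs[i - 1 := act PA S ys]) \<Longrightarrow> tangle_args PA S ys \<Longrightarrow>
       act PA R (take (i - 1) xs @ ys @ drop i xs) = act PA T (xs[i - 1 := act PA S ys])"

text \<open>\<open>pmult PA n s x y\<close> is the product \<open>x y\<close>, drawn with \<open>y\<close> above \<open>x\<close>.\<close>

definition pmult :: "'a cstar_planar_data \<Rightarrow> nat \<Rightarrow> bool \<Rightarrow> 'a \<Rightarrow> 'a \<Rightarrow> 'a" where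
  "pmult PA n s x y = act PA (stack_tangle n s) [x, y]"

definition punit :: "'a cstar_planar_data \<Rightarrow> nat \<Rightarrow> bool \<Rightarrow> 'a" where
  "punit PA n s = act PA (unit_tangle n s) []"

definition pclosure :: "'a cstar_planar_data \<Rightarrow> nat \<Rightarrow> bool \<Rightarrow> 'a \<Rightarrow> 'a" where
  "pclosure PA n s x = act PA (closure_tangle n s) [x]"

definition cstar_norm :: "'a::ab_group_add cstar_planar_data \<Rightarrow> nat \<Rightarrow> bool \<Rightarrow> ('a \<Rightarrow> real) \<Rightarrow> bool" where
  "cstar_norm PA n s N \<longleftrightarrow>
     (\<forall>x \<in> pspace PA n s. 0 \<le> N x \<and> (N x = 0 \<longleftrightarrow> x = 0)) \<and>
     (\<forall>x \<in> pspace PA n s. \<forall>c. N (scl PA c x) = cmod c * N x) \<and>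
     (\<forall>x \<in> pspace PA n s. \<forall>y \<in> pspace PA n s. N (x + y) \<le> N x + N y) \<and>
     (\<forall>x \<in> pspace PA n s. \<forall>y \<in> pspace PA n s. N (pmult PA n s x y) \<le> N x * N y) \<and>
     (\<forall>x \<in> pspace PA n s. N (pmult PA n s (invol PA n s x) x) = (N x)\<^sup>2)"

text \<open>
  Completeness of the norm is automatic in finite dimension.  Associativity of \<open>pmult\<close> and the unit
  laws for \<open>punit\<close> hold in every planar algebra, by isotopy.
\<close>

locale cstar_planar_algebra = planar_algebra PA
  for PA :: "'a::ab_group_add cstar_planar_data" +
  assumes finite_dim: "\<exists>B. finite B \<and> pspace PA n s = module.span (scl PA) B"
    and invol_closed: "x \<in> pspace PA n s \<Longrightarrow> invol PA n s x \<in> pspace PA n s"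
    and invol_add: "x \<in> pspace PA n s \<Longrightarrow> y \<in> pspace PA n s \<Longrightarrow>
          invol PA n s (x + y) = invol PA n s x + invol PA n s y"
    and invol_scl: "x \<in> pspace PA n s \<Longrightarrow> invol PA n s (scl PA c x) = scl PA (cnj c) (invol PA n s x)"
    and invol_invol: "x \<in> pspace PA n s \<Longrightarrow> invol PA n s (invol PA n s x) = x"
    and invol_mult: "x \<in> pspace PA n s \<Longrightarrow> y \<in> pspace PA n s \<Longrightarrow>
          invol PA n s (pmult PA n s x y) = pmult PA n s (invol PA n s y) (invol PA n s x)"
    and cstar_norm: "\<exists>N. cstar_norm PA n s N"
    and invol_reflect: "planar_tangle T \<Longrightarrow> tangle_args PA T xs \<Longrightarrow> hd (discs T) = (n, s) \<Longrightarrow>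
          invol PA n s (act PA T xs) =
          act PA (reflect_tangle T) (map2 (\<lambda>(m, t) x. invol PA m t x) (tl (discs T)) xs)"
    and trc_linear: "x \<in> pspace PA n s \<Longrightarrow> y \<in> pspace PA n s \<Longrightarrow>
          trc PA n s (scl PA c x + y) = c * trc PA n s x + trc PA n s y"
    and trc_commute: "x \<in> pspace PA n s \<Longrightarrow> y \<in> pspace PA n s \<Longrightarrow>
          trc PA n s (pmult PA n s x y) = trc PA n s (pmult PA n s y x)"
    and trc_positive: "x \<in> pspace PA n s \<Longrightarrow> trc PA n s (pmult PA n s x (invol PA n s x)) \<in> \<real>\<^sub>\<ge>\<^sub>0"
    and trc_faithful: "x \<in> pspace PA n s \<Longrightarrow> trc PA n s (pmult PA n s x (invol PA n s x)) = 0 \<Longrightarrow> x = 0"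
    and trc_closure: "x \<in> pspace PA n s \<Longrightarrow> trc PA n s x = trc PA 0 s (pclosure PA n s x)"

definition pfourier :: "'a cstar_planar_data \<Rightarrow> bool \<Rightarrow> 'a \<Rightarrow> 'a" where
  "pfourier PA s x = act PA (fourier_tangle s) [x]"

text \<open>\<open>pconv PA s y u\<close> is \<open>y * u\<close> for \<open>y \<in> pspace PA 1 s\<close> and \<open>u \<in> pspace PA 2 (\<not> s)\<close>.\<close>

definition pconv :: "'a cstar_planar_data \<Rightarrow> bool \<Rightarrow> 'a \<Rightarrow> 'a \<Rightarrow> 'a" where
  "pconv PA s y u = act PA (convolution_tangle s) [y, u]"

definition positive_elem :: "'a cstar_planar_data \<Rightarrow> nat \<Rightarrow> bool \<Rightarrow> 'a \<Rightarrow> bool" where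
  "positive_elem PA n s x \<longleftrightarrow> (\<exists>a \<in> pspace PA n s. x = pmult PA n s a (invol PA n s a))"

definition invertible_elem :: "'a cstar_planar_data \<Rightarrow> nat \<Rightarrow> bool \<Rightarrow> 'a \<Rightarrow> bool" where
  "invertible_elem PA n s x \<longleftrightarrow>
     x \<in> pspace PA n s \<and>
     (\<exists>z \<in> pspace PA n s. pmult PA n s x z = punit PA n s \<and> pmult PA n s z x = punit PA n s)"

definition strictly_positive :: "'a cstar_planar_data \<Rightarrow> nat \<Rightarrow> bool \<Rightarrow> 'a \<Rightarrow> bool" where
  "strictly_positive PA n s x \<longleftrightarrow> positive_elem PA n s x \<and> invertible_elem PA n s x"

definition le_elem :: "'a::ab_group_add cstar_planar_data \<Rightarrow> nat \<Rightarrow> bool \<Rightarrow> 'a \<Rightarrow> 'a \<Rightarrow> bool" where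
  "le_elem PA n s x y \<longleftrightarrow> positive_elem PA n s (y - x)"

definition projection :: "'a cstar_planar_data \<Rightarrow> nat \<Rightarrow> bool \<Rightarrow> 'a \<Rightarrow> bool" where
  "projection PA n s p \<longleftrightarrow>
     p \<in> pspace PA n s \<and> pmult PA n s p p = p \<and> invol PA n s p = p"

definition alg_spectrum :: "'a::ab_group_add cstar_planar_data \<Rightarrow> nat \<Rightarrow> bool \<Rightarrow> 'a \<Rightarrow> complex set" where
  "alg_spectrum PA n s x = {z. \<not> invertible_elem PA n s (scl PA z (punit PA n s) - x)}"

text \<open>The spectrum is empty only in the zero algebra, where the value is irrelevant.\<close>

definition alg_spectral_radius :: "'a::ab_group_add cstar_planar_data \<Rightarrow> nat \<Rightarrow> bool \<Rightarrow> 'a \<Rightarrow> real" where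
  "alg_spectral_radius PA n s x = Sup (cmod ` alg_spectrum PA n s x)"

definition F_positive :: "'a cstar_planar_data \<Rightarrow> bool \<Rightarrow> 'a \<Rightarrow> bool" where
  "F_positive PA s x \<longleftrightarrow> positive_elem PA 2 (\<not> s) (pfourier PA s x)"

definition irreducible_elem :: "'a::ab_group_add cstar_planar_data \<Rightarrow> bool \<Rightarrow> 'a \<Rightarrow> bool" where
  "irreducible_elem PA s x \<longleftrightarrow>
     (\<forall>p. projection PA 1 s p \<and>
          (\<exists>c::real. c > 0 \<and> le_elem PA 1 s (pconv PA s p (pfourier PA s x)) (scl PA (complex_of_real c) p))
        \<longrightarrow> p = 0 \<or> p = punit PA 1 s)"

end

theory Submission
  imports Defs "HOL-Computational_Algebra.Fundamental_Theorem_Algebra"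
begin

text \<open>
  Let $T(y) = y * \widehat{x}$ on $\mathscr{P}_{1,\pm}$ and $\widehat{x} = aa^*$.  The closed diagram of
  $tr(T(bb^*)\,dd^*)$ is symmetric under a reflection whose axis it meets in four strings; cutting there
  shows that it equals $tr(gg^*)$ for some $g \in \mathscr{P}_{2,\pm}$, so $T$ is positive.  A similar diagram,
  cut in six strings, shows that the convolution on $\mathscr{P}_{2,\mp}$ preserves positivity, so all powers
  of $x$ are $\mathfrak{F}$-positive.

  A positive map on a finite-dimensional $C^*$-algebra has a positive eigenvector $y$ (Collatz--Wielandt and
  compactness).  Irreducibility, applied to the support projection of $y$, makes $y$ invertible, and applied to
  $m y - h$ with the extremal $m$ it shows that every hermitian eigenvector $h$ for the same eigenvalue $t$ is a
  multiple of $y$.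

  It remains to see that $t$ is the spectral radius of $x$.  As $x \mapsto T$ is an antihomomorphism,
  $t - x$ is not invertible.  Conversely $\widehat{z} \mapsto tr(1 * \widehat{z})$ is faithful on positive elements and
  therefore dominates every functional there, so for $\lambda$ in the spectrum of $x$ the numbers
  $|\lambda|^n$ are $O(tr(1 * \widehat{x^n})) = O(tr(T^n(1))) = O(t^n)$.
\<close>

section \<open>Finite-dimensional algebras with a faithful positive trace\<close>

text \<open>The equation for y lives on the 1-boxes and the spectral radius in the 2-boxes, and the
  antihomomorphism relating them may have a kernel: generic Temperley-Lieb algebras have
  one-dimensional 1-boxes and two-dimensional 2-boxes. So the spectrum of T alone cannot bound that
  of x; the gap is closed by the positivity of the Fourier transforms of all powers of x. The
  faithfulness used there comes from the same cut diagram: with both 1-boxes equal to the unit, the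
  half diagram is just a rotated a, so the trace of the unit convolved with a times its adjoint is
  the squared length of the rotated a, and rotation is injective. Order, square roots, supports and
  compactness of states all rest on the trace: left multiplication by a hermitian element is
  self-adjoint for its inner product. Isotopies are not argued geometrically: tangles are finite
  data, so each diagrammatic identity becomes an equality of tables up to relabelling, evaluated
  once for each shading.\<close>

lemma nonneg_Reals_complex: "z \<in> \<real>\<^sub>\<ge>\<^sub>0 \<longleftrightarrow> Im z = 0 \<and> 0 \<le> Re z"
  by (auto simp: complex_nonneg_Reals_iff)

section \<open>Sesquilinear forms and orthonormal bases\<close>

locale complex_space = vector_space scl for scl :: "complex \<Rightarrow> 'a::ab_group_add \<Rightarrow> 'a" (infixr "\<cdot>" 75)
begin

text \<open>Sesquilinear despite the name. Hermitian symmetry is kept apart, since the forms to be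
  bounded by an inner product come from general functionals.\<close>

definition bilinear_on :: "'a set \<Rightarrow> ('a \<Rightarrow> 'a \<Rightarrow> complex) \<Rightarrow> bool" where
  "bilinear_on V Q \<longleftrightarrow>
     (\<forall>a\<in>V. \<forall>b\<in>V. \<forall>d\<in>V. Q (a + b) d = Q a d + Q b d \<and> Q d (a + b) = Q d a + Q d b) \<and>
     (\<forall>a\<in>V. \<forall>b\<in>V. \<forall>c. Q (c \<cdot> a) b = c * Q a b \<and> Q a (c \<cdot> b) = cnj c * Q a b)"

definition inner_product_on :: "'a set \<Rightarrow> ('a \<Rightarrow> 'a \<Rightarrow> complex) \<Rightarrow> bool" where
  "inner_product_on V Q \<longleftrightarrow> bilinear_on V Q \<and>
     (\<forall>a\<in>V. \<forall>b\<in>V. Q b a = cnj (Q a b)) \<and>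
     (\<forall>a\<in>V. Q a a \<in> \<real>\<^sub>\<ge>\<^sub>0) \<and> (\<forall>a\<in>V. Q a a = 0 \<longrightarrow> a = 0)"

definition linear_on :: "'a set \<Rightarrow> ('a \<Rightarrow> complex) \<Rightarrow> bool" where
  "linear_on V \<psi> \<longleftrightarrow> (\<forall>a\<in>V. \<forall>b\<in>V. \<psi> (a + b) = \<psi> a + \<psi> b) \<and> (\<forall>a\<in>V. \<forall>c. \<psi> (c \<cdot> a) = c * \<psi> a)"

lemma linear_on_sum:
  assumes V: "subspace V" and l: "linear_on V \<psi>" and f: "\<And>i. i \<in> I \<Longrightarrow> f i \<in> V"
  shows "\<psi> (\<Sum>i\<in>I. g i \<cdot> f i) = (\<Sum>i\<in>I. g i * \<psi> (f i))"
proof -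
  have z: "\<psi> 0 = 0" using l subspace_0[OF V] unfolding linear_on_def by (metis mult_zero_left scale_zero_left)
  show ?thesis
  proof (cases "finite I")
    case True
    then show ?thesis using f
    proof (induction I)
      case (insert i I)
      have "(\<Sum>i\<in>I. g i \<cdot> f i) \<in> V" using insert.prems V by (intro subspace_sum subspace_scale) auto
      moreover have "g i \<cdot> f i \<in> V" using insert.prems V by (intro subspace_scale) auto
      ultimately show ?case using insert l by (simp add: linear_on_def)
    qed (simp add: z)
  qed (simp add: z)
qed

lemma bilinear_on_linear: "bilinear_on V Q \<Longrightarrow> b \<in> V \<Longrightarrow> linear_on V (\<lambda>a. Q a b)"
  by (simp add: bilinear_on_def linear_on_def)

lemma bilinear_on_linear2: "bilinear_on V Q \<Longrightarrow> b \<in> V \<Longrightarrow> linear_on V (\<lambda>a. cnj (Q b a))"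
  by (simp add: bilinear_on_def linear_on_def)

text \<open>One Gram-Schmidt step. The expansion formula serves as induction invariant in place of
  an equality of spans: it is the form in which the basis is used later, and it does not confine
  \<open>E\<close> to the span of \<open>B\<close>.\<close>

lemma orthonormal_basis_insert:
  assumes Q: "inner_product_on V Q" and V: "subspace V" and B: "B \<subseteq> V" "a \<in> V"
    and E: "finite E" "E \<subseteq> V" "\<forall>x\<in>span B. x = (\<Sum>b\<in>E. Q x b \<cdot> b)" "\<forall>b\<in>E. \<forall>d\<in>E. Q b d = (if b = d then 1 else 0)"
  shows "\<exists>E. finite E \<and> E \<subseteq> V \<and> (\<forall>x\<in>span (insert a B). x = (\<Sum>b\<in>E. Q x b \<cdot> b)) \<and> (\<forall>b\<in>E. \<forall>d\<in>E. Q b d = (if b = d then 1 else 0))"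
proof -
  have bil: "bilinear_on V Q" using Q by (simp add: inner_product_on_def)
  note lin = bilinear_on_linear[OF bil]
  define u where "u = a - (\<Sum>b\<in>E. Q a b \<cdot> b)"
  have sV: "(\<Sum>b\<in>E. g b \<cdot> b) \<in> V" for g using E(2) V by (intro subspace_sum subspace_scale) auto
  have u: "u \<in> V" unfolding u_def using B V sV by (intro subspace_diff) auto
  have au: "a = u + (\<Sum>b\<in>E. Q a b \<cdot> b)" by (simp add: u_def)
  have orth: "Q u d = 0" if d: "d \<in> E" for d
  proof -
    have dV: "d \<in> V" using d E by auto
    have "Q a d = Q u d + Q (\<Sum>b\<in>E. Q a b \<cdot> b) d"
      using au lin[OF dV] u sV unfolding linear_on_def by metis
    also have "Q (\<Sum>b\<in>E. Q a b \<cdot> b) d = (\<Sum>b\<in>E. Q a b * Q b d)"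
      using linear_on_sum[OF V lin[OF dV], of E "\<lambda>b. b" "Q a"] E(2) by auto
    also have "\<dots> = (\<Sum>b\<in>E. if b = d then Q a d else 0)" by (rule sum.cong) (use E(4) d in auto)
    also have "\<dots> = Q a d" using d E(1) by simp
    finally show ?thesis by simp
  qed
  have spB: "span B \<subseteq> V" using B V by (intro span_minimal) auto
  \<comment> \<open>\<open>y\<close> is a combination of \<open>E\<close> but is not known to lie in
    the span of \<open>B\<close>, so its expansion is recomputed from orthonormality instead of
    being taken from \<open>E(3)\<close>.\<close>
  have decomp: "\<exists>c y. x = c \<cdot> u + y \<and> y = (\<Sum>b\<in>E. Q y b \<cdot> b) \<and> y \<in> V" if x: "x \<in> span (insert a B)" for x
  proof -
    obtain c where c: "x - c \<cdot> a \<in> span B" using x by (auto simp: span_insert)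
    define y where "y = (x - c \<cdot> a) + c \<cdot> (\<Sum>b\<in>E. Q a b \<cdot> b)"
    have ysum: "y = (\<Sum>b\<in>E. (Q (x - c \<cdot> a) b + c * Q a b) \<cdot> b)"
    proof -
      have "x - c \<cdot> a = (\<Sum>b\<in>E. Q (x - c \<cdot> a) b \<cdot> b)" using E(3) c by blast
      then have "y = (\<Sum>b\<in>E. Q (x - c \<cdot> a) b \<cdot> b) + c \<cdot> (\<Sum>b\<in>E. Q a b \<cdot> b)" unfolding y_def by (rule arg_cong)
      then show ?thesis by (simp add: scale_sum_right scale_left_distrib sum.distrib)
    qed
    have yV: "y \<in> V" unfolding ysum by (rule sV)
    have "Q y d = Q (x - c \<cdot> a) d + c * Q a d" if d: "d \<in> E" for d
    proof -
      have dV: "d \<in> V" using d E by auto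
      have "Q y d = (\<Sum>b\<in>E. (Q (x - c \<cdot> a) b + c * Q a b) * Q b d)"
        unfolding ysum by (rule linear_on_sum[OF V lin[OF dV]]) (use E(2) in auto)
      also have "\<dots> = (\<Sum>b\<in>E. if b = d then Q (x - c \<cdot> a) d + c * Q a d else 0)" by (rule sum.cong) (use E(4) d in auto)
      finally show ?thesis using d E(1) by simp
    qed
    then have "(\<Sum>b\<in>E. Q y b \<cdot> b) = (\<Sum>b\<in>E. (Q (x - c \<cdot> a) b + c * Q a b) \<cdot> b)" by (intro sum.cong) auto
    then have "y = (\<Sum>b\<in>E. Q y b \<cdot> b)" using ysum by (rule trans[OF _ sym, rotated])
    moreover have "x = c \<cdot> u + y" by (simp add: y_def u_def scale_right_diff_distrib)
    ultimately show ?thesis using yV by blast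
  qed
  show ?thesis
  proof (cases "u = 0")
    case True
    have "x = (\<Sum>b\<in>E. Q x b \<cdot> b)" if x: "x \<in> span (insert a B)" for x
    proof -
      obtain c y where y: "x = c \<cdot> u + y" "y = (\<Sum>b\<in>E. Q y b \<cdot> b)" using decomp[OF x] by blast
      have "x = y" using y(1) True by simp
      then show ?thesis using y(2) by simp
    qed
    then show ?thesis using E by blast
  next
    case False
    define n where "n = sqrt (Re (Q u u))"
    have quu: "Q u u \<in> \<real>\<^sub>\<ge>\<^sub>0" "Q u u \<noteq> 0" using Q u False unfolding inner_product_on_def by blast+
    then have im: "Im (Q u u) = 0" "0 \<le> Re (Q u u)" by (simp_all add: nonneg_Reals_complex)
    then have "Re (Q u u) \<noteq> 0" using quu(2) complex_eqI[of "Q u u" 0] by fastforce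
    then have re: "Re (Q u u) > 0" "Q u u = of_real (Re (Q u u))"
      using im by (simp_all add: complex_eqI)
    then have n: "n > 0" "of_real n * of_real n = Q u u"
      by (simp_all add: n_def flip: of_real_mult)
    define v where "v = (1 / of_real n) \<cdot> u"
    have vV: "v \<in> V" unfolding v_def using V u by (intro subspace_scale) auto
    have uv: "u = of_real n \<cdot> v" using n by (simp add: v_def)
    have vv: "Q v v = 1"
      using bil u vV n quu(2) unfolding v_def bilinear_on_def by (simp add: field_simps)
    have vd: "Q v d = 0" "Q d v = 0" if "d \<in> E" for d
    proof -
      show "Q v d = 0" using orth[OF that] bil u that E(2) unfolding v_def bilinear_on_def by auto
      then show "Q d v = 0" using Q vV that E(2) unfolding inner_product_on_def by (metis complex_cnj_zero subsetD)
    qed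
    have vE: "v \<notin> E" using vd(1)[of v] vv by auto
    have "x = (\<Sum>b\<in>insert v E. Q x b \<cdot> b)" if x: "x \<in> span (insert a B)" for x
    proof -
      obtain c y where y: "x = c \<cdot> u + y" "y = (\<Sum>b\<in>E. Q y b \<cdot> b)" "y \<in> V" using decomp[OF x] by blast
      have x': "x = (c * of_real n) \<cdot> v + y" using y(1) uv by (metis scale_scale)
      have Qx: "Q x d = c * of_real n * Q v d + Q y d" if "d \<in> V" for d
        using lin[OF that] vV y(3) V subspace_scale[OF V vV] unfolding x' linear_on_def by simp
      have "Q y v = (\<Sum>b\<in>E. Q y b * Q b v)"
        by (subst y(2)) (use linear_on_sum[OF V lin[OF vV], of E "\<lambda>b. b"] E(2) in auto)
      then have "Q y v = 0" using vd by simp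
      then have "Q x v = c * of_real n" using Qx[OF vV] vv by simp
      moreover have "(\<Sum>b\<in>E. Q x b \<cdot> b) = (\<Sum>b\<in>E. Q y b \<cdot> b)"
        by (rule sum.cong) (use Qx E(2) vd in auto)
      ultimately show ?thesis using E(1) vE x' y(2) by simp
    qed
    then show ?thesis using E vV vd vv by (intro exI[of _ "insert v E"]) auto
  qed
qed

lemma orthonormal_basis_exists:
  assumes Q: "inner_product_on V Q" and V: "subspace V" and fin: "finite B" "V = span B"
  shows "\<exists>E. finite E \<and> E \<subseteq> V \<and> (\<forall>x\<in>V. x = (\<Sum>b\<in>E. Q x b \<cdot> b)) \<and> (\<forall>b\<in>E. \<forall>d\<in>E. Q b d = (if b = d then 1 else 0))"
proof -
  have "B \<subseteq> V" using fin span_superset by auto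
  with fin(1) have "\<exists>E. finite E \<and> E \<subseteq> V \<and> (\<forall>x\<in>span B. x = (\<Sum>b\<in>E. Q x b \<cdot> b)) \<and> (\<forall>b\<in>E. \<forall>d\<in>E. Q b d = (if b = d then 1 else 0))"
  proof (induction B)
    case empty
    show ?case by (rule exI[of _ "{}"]) auto
  next
    case (insert a B)
    then obtain E where E: "finite E" "E \<subseteq> V" "\<forall>x\<in>span B. x = (\<Sum>b\<in>E. Q x b \<cdot> b)"
        "\<forall>b\<in>E. \<forall>d\<in>E. Q b d = (if b = d then 1 else 0)" by blast
    have "B \<subseteq> V" "a \<in> V" using insert.prems by auto
    then show ?case by (rule orthonormal_basis_insert[OF Q V _ _ E])
  qed
  then show ?thesis using fin by simp
qed

text \<open>In an orthonormal basis \<open>G a a\<close> is a combination of the matrix entries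
  \<open>G b d\<close> with coefficients of modulus at most \<open>Q a a\<close>, by Parseval; so
  \<open>M\<close> can be the sum of the moduli of all entries.\<close>

lemma form_bounded_by_inner_product:
  assumes Q: "inner_product_on V Q" and V: "subspace V" and fin: "finite B" "V = span B" and G: "bilinear_on V G"
  shows "\<exists>M\<ge>0. \<forall>a\<in>V. cmod (G a a) \<le> M * Re (Q a a)"
proof -
  obtain E where E: "finite E" "E \<subseteq> V" "\<And>x. x \<in> V \<Longrightarrow> x = (\<Sum>b\<in>E. Q x b \<cdot> b)" "\<forall>b\<in>E. \<forall>d\<in>E. Q b d = (if b = d then 1 else 0)"
    using orthonormal_basis_exists[OF Q V fin] by blast
  have bil: "bilinear_on V Q" using Q by (simp add: inner_product_on_def)
  have expand: "H a a = (\<Sum>b\<in>E. \<Sum>d\<in>E. Q a b * cnj (Q a d) * H b d)" if a: "a \<in> V" and H: "bilinear_on V H" for H a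
  proof -
    have "H a a = H (\<Sum>b\<in>E. Q a b \<cdot> b) a" using E(3)[OF a] by simp
    also have "\<dots> = (\<Sum>b\<in>E. Q a b * H b a)"
      using linear_on_sum[OF V bilinear_on_linear[OF H a], of E "\<lambda>b. b"] E(2) by auto
    also have "\<dots> = (\<Sum>b\<in>E. \<Sum>d\<in>E. Q a b * cnj (Q a d) * H b d)"
    proof (rule sum.cong[OF refl])
      fix b assume b: "b \<in> E"
      have "cnj (H b a) = cnj (H b (\<Sum>d\<in>E. Q a d \<cdot> d))" using E(3)[OF a] by simp
      also have "\<dots> = (\<Sum>d\<in>E. Q a d * cnj (H b d))"
        using linear_on_sum[OF V bilinear_on_linear2[OF H], of b E "\<lambda>b. b"] E(2) b by auto
      finally have "cnj (cnj (H b a)) = cnj (\<Sum>d\<in>E. Q a d * cnj (H b d))" by (rule arg_cong)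
      then have "H b a = (\<Sum>d\<in>E. cnj (Q a d) * H b d)" by simp
      then show "Q a b * H b a = (\<Sum>d\<in>E. Q a b * cnj (Q a d) * H b d)"
        by (simp add: sum_distrib_left mult.assoc)
    qed
    finally show ?thesis .
  qed
  define M where "M = (\<Sum>b\<in>E. \<Sum>d\<in>E. cmod (G b d))"
  have "cmod (G a a) \<le> M * Re (Q a a)" if a: "a \<in> V" for a
  proof -
    have "Q a a = (\<Sum>b\<in>E. \<Sum>d\<in>E. Q a b * cnj (Q a d) * Q b d)" by (rule expand[OF a bil])
    also have "\<dots> = (\<Sum>b\<in>E. \<Sum>d\<in>E. if d = b then Q a b * cnj (Q a b) else 0)"
      by (intro sum.cong refl) (use E(4) in auto)
    also have "\<dots> = (\<Sum>b\<in>E. of_real ((cmod (Q a b))\<^sup>2))"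
      using E(1) by (simp add: complex_norm_square del: of_real_power)
    finally have qa: "Re (Q a a) = (\<Sum>b\<in>E. (cmod (Q a b))\<^sup>2)" by simp
    have le: "(cmod (Q a b))\<^sup>2 \<le> Re (Q a a)" if "b \<in> E" for b
      unfolding qa using E(1) that by (intro member_le_sum) auto
    have nn: "0 \<le> Re (Q a a)" unfolding qa by (intro sum_nonneg) auto
    have "cmod (G a a) \<le> (\<Sum>b\<in>E. \<Sum>d\<in>E. cmod (Q a b * cnj (Q a d) * G b d))"
      unfolding expand[OF a G] by (intro order_trans[OF norm_sum] sum_mono norm_sum)
    also have "\<dots> \<le> (\<Sum>b\<in>E. \<Sum>d\<in>E. Re (Q a a) * cmod (G b d))"
    proof (intro sum_mono)
      fix b d assume bd: "b \<in> E" "d \<in> E"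
      have "cmod (Q a b) \<le> sqrt (Re (Q a a))" "cmod (Q a d) \<le> sqrt (Re (Q a a))"
        using le bd by (auto intro: real_le_rsqrt)
      then have "cmod (Q a b) * cmod (Q a d) \<le> sqrt (Re (Q a a)) * sqrt (Re (Q a a))"
        by (intro mult_mono) (auto simp: nn)
      then show "cmod (Q a b * cnj (Q a d) * G b d) \<le> Re (Q a a) * cmod (G b d)"
        using nn by (simp add: norm_mult mult_right_mono)
    qed
    also have "\<dots> = M * Re (Q a a)" by (simp add: M_def sum_distrib_left sum_distrib_right mult.commute)
    finally show ?thesis .
  qed
  moreover have "M \<ge> 0" unfolding M_def by (intro sum_nonneg) auto
  ultimately show ?thesis by blast
qed

text \<open>\<open>dependent\<close> speaks of sets, in which repeated values collapse; a
  non-injective sequence is therefore settled separately, by \<open>f i - f j = 0\<close>.\<close>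

lemma linear_dependence_sequence:
  assumes fin: "finite B" and f: "\<And>i. f i \<in> span B"
  shows "\<exists>N c. (\<exists>i\<le>N. c i \<noteq> 0) \<and> (\<Sum>i\<le>(N::nat). c i \<cdot> f i) = 0"
proof (cases "inj f")
  case False
  then obtain i j where ij: "i \<noteq> j" "f i = f j" by (auto simp: inj_on_def)
  define c :: "nat \<Rightarrow> complex" where "c k = (if k = i then 1 else if k = j then - 1 else 0)" for k
  have "(\<Sum>k\<le>max i j. c k \<cdot> f k) = (\<Sum>k\<in>{i, j}. c k \<cdot> f k)"
    by (rule sum.mono_neutral_right) (auto simp: c_def)
  also have "\<dots> = 0" using ij by (simp add: c_def)
  finally show ?thesis by (intro exI[of _ "max i j"] exI[of _ c]) (auto simp: c_def intro!: exI[of _ i])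
next
  case True
  let ?S = "f ` {..card B}"
  have "card ?S = Suc (card B)" using True by (simp add: card_image inj_on_subset)
  then have "dependent ?S" using independent_span_bound[OF fin, of ?S] f by fastforce
  then obtain t u where t: "finite t" "t \<subseteq> ?S" "(\<Sum>v\<in>t. u v \<cdot> v) = 0" "\<exists>v\<in>t. u v \<noteq> 0"
    unfolding dependent_explicit by blast
  define c where "c k = (if f k \<in> t then u (f k) else 0)" for k
  have "(\<Sum>k\<le>card B. c k \<cdot> f k) = (\<Sum>v\<in>?S. (if v \<in> t then u v else 0) \<cdot> v)"
    using True by (simp add: c_def sum.reindex inj_on_subset)
  also have "\<dots> = (\<Sum>v\<in>t. u v \<cdot> v)"
    by (rule sum.mono_neutral_cong_right) (use t in auto)
  finally have "(\<Sum>k\<le>card B. c k \<cdot> f k) = 0" using t by simp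
  moreover have "\<exists>i\<le>card B. c i \<noteq> 0" using t(2,4) by (auto simp: c_def)
  ultimately show ?thesis by blast
qed

end

section \<open>Star algebras with a faithful trace and their positive cone\<close>

locale tracial_star_algebra = complex_space scl
  for scl :: "complex \<Rightarrow> 'a::ab_group_add \<Rightarrow> 'a" (infixr "\<cdot>" 75) +
  fixes A :: "'a set" and mult :: "'a \<Rightarrow> 'a \<Rightarrow> 'a" (infixl "\<odot>" 80)
    and one :: 'a and star :: "'a \<Rightarrow> 'a" and tr :: "'a \<Rightarrow> complex"
  assumes A_subspace: "subspace A"
    and A_finite_dim: "\<exists>B. finite B \<and> A = span B"
    and mult_closed [simp]: "x \<in> A \<Longrightarrow> y \<in> A \<Longrightarrow> x \<odot> y \<in> A"
    and one_closed [simp]: "one \<in> A"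
    and star_closed [simp]: "x \<in> A \<Longrightarrow> star x \<in> A"
    and mult_add_left: "x \<in> A \<Longrightarrow> y \<in> A \<Longrightarrow> z \<in> A \<Longrightarrow> (x + y) \<odot> z = x \<odot> z + y \<odot> z"
    and mult_add_right: "x \<in> A \<Longrightarrow> y \<in> A \<Longrightarrow> z \<in> A \<Longrightarrow> z \<odot> (x + y) = z \<odot> x + z \<odot> y"
    and mult_scl_left [simp]: "x \<in> A \<Longrightarrow> y \<in> A \<Longrightarrow> (c \<cdot> x) \<odot> y = c \<cdot> (x \<odot> y)"
    and mult_scl_right [simp]: "x \<in> A \<Longrightarrow> y \<in> A \<Longrightarrow> x \<odot> (c \<cdot> y) = c \<cdot> (x \<odot> y)"
    and mult_assoc: "x \<in> A \<Longrightarrow> y \<in> A \<Longrightarrow> z \<in> A \<Longrightarrow> (x \<odot> y) \<odot> z = x \<odot> (y \<odot> z)"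
    and one_mult [simp]: "x \<in> A \<Longrightarrow> one \<odot> x = x"
    and mult_one [simp]: "x \<in> A \<Longrightarrow> x \<odot> one = x"
    and star_add: "x \<in> A \<Longrightarrow> y \<in> A \<Longrightarrow> star (x + y) = star x + star y"
    and star_scl [simp]: "x \<in> A \<Longrightarrow> star (c \<cdot> x) = cnj c \<cdot> star x"
    and star_star [simp]: "x \<in> A \<Longrightarrow> star (star x) = x"
    and star_mult: "x \<in> A \<Longrightarrow> y \<in> A \<Longrightarrow> star (x \<odot> y) = star y \<odot> star x"
    and tr_add: "x \<in> A \<Longrightarrow> y \<in> A \<Longrightarrow> tr (x + y) = tr x + tr y"
    and tr_scl [simp]: "x \<in> A \<Longrightarrow> tr (c \<cdot> x) = c * tr x"
    and tr_commute: "x \<in> A \<Longrightarrow> y \<in> A \<Longrightarrow> tr (x \<odot> y) = tr (y \<odot> x)"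
    and tr_pos: "x \<in> A \<Longrightarrow> tr (x \<odot> star x) \<in> \<real>\<^sub>\<ge>\<^sub>0"
    and tr_faithful: "x \<in> A \<Longrightarrow> tr (x \<odot> star x) = 0 \<Longrightarrow> x = 0"
begin

lemma A_add [simp]: "x \<in> A \<Longrightarrow> y \<in> A \<Longrightarrow> x + y \<in> A"
  and A_scl [simp]: "x \<in> A \<Longrightarrow> c \<cdot> x \<in> A"
  and A_diff [simp]: "x \<in> A \<Longrightarrow> y \<in> A \<Longrightarrow> x - y \<in> A"
  and A_uminus [simp]: "x \<in> A \<Longrightarrow> - x \<in> A"
  and A_zero [simp]: "0 \<in> A"
  using A_subspace by (auto intro: subspace_add subspace_scale subspace_diff subspace_neg subspace_0)

lemma A_sum: "(\<And>i. i \<in> I \<Longrightarrow> f i \<in> A) \<Longrightarrow> sum f I \<in> A"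
  by (rule subspace_sum[OF A_subspace])

lemma mult_zero_left [simp]: "x \<in> A \<Longrightarrow> 0 \<odot> x = 0"
  using mult_scl_left[of 0 x 0] by simp

lemma mult_zero_right [simp]: "x \<in> A \<Longrightarrow> x \<odot> 0 = 0"
  using mult_scl_right[of x 0 0] by simp

lemma star_zero [simp]: "star 0 = 0"
  using star_scl[of 0 0] by simp

lemma tr_zero [simp]: "tr 0 = 0"
  using tr_scl[of 0 0] by simp

lemma mult_uminus_left: "x \<in> A \<Longrightarrow> y \<in> A \<Longrightarrow> (- x) \<odot> y = - (x \<odot> y)"
  using mult_scl_left[of x y "- 1"] by (simp add: scale_minus_left)

lemma mult_uminus_right: "x \<in> A \<Longrightarrow> y \<in> A \<Longrightarrow> x \<odot> (- y) = - (x \<odot> y)"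
  using mult_scl_right[of x y "- 1"] by (simp add: scale_minus_left)

lemma mult_diff_left: "x \<in> A \<Longrightarrow> y \<in> A \<Longrightarrow> z \<in> A \<Longrightarrow> (x - y) \<odot> z = x \<odot> z - y \<odot> z"
  using mult_add_left[of x "- y" z] by (simp add: mult_uminus_left)

lemma mult_diff_right: "x \<in> A \<Longrightarrow> y \<in> A \<Longrightarrow> z \<in> A \<Longrightarrow> z \<odot> (x - y) = z \<odot> x - z \<odot> y"
  using mult_add_right[of x "- y" z] by (simp add: mult_uminus_right)

lemma star_uminus: "x \<in> A \<Longrightarrow> star (- x) = - star x"
  using star_scl[of x "- 1"] by (simp add: scale_minus_left)

lemma star_diff: "x \<in> A \<Longrightarrow> y \<in> A \<Longrightarrow> star (x - y) = star x - star y"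
  using star_add[of x "- y"] by (simp add: star_uminus)

lemma tr_diff: "x \<in> A \<Longrightarrow> y \<in> A \<Longrightarrow> tr (x - y) = tr x - tr y"
  using tr_add[of x "- y"] tr_scl[of y "- 1"] by (simp add: scale_minus_left)

lemmas distribs = mult_add_left mult_add_right mult_diff_left mult_diff_right star_add star_diff
  tr_add tr_diff scale_right_distrib scale_right_diff_distrib scale_left_distrib scale_left_diff_distrib

lemma mult_sum_left: "(\<And>i. i \<in> I \<Longrightarrow> f i \<in> A) \<Longrightarrow> y \<in> A \<Longrightarrow> (\<Sum>i\<in>I. f i) \<odot> y = (\<Sum>i\<in>I. f i \<odot> y)"
  by (induction I rule: infinite_finite_induct) (auto simp: mult_add_left A_sum)

lemma mult_sum_right: "(\<And>i. i \<in> I \<Longrightarrow> f i \<in> A) \<Longrightarrow> y \<in> A \<Longrightarrow> y \<odot> (\<Sum>i\<in>I. f i) = (\<Sum>i\<in>I. y \<odot> f i)"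
  by (induction I rule: infinite_finite_induct) (auto simp: mult_add_right A_sum)

lemma star_sum: "(\<And>i. i \<in> I \<Longrightarrow> f i \<in> A) \<Longrightarrow> star (\<Sum>i\<in>I. f i) = (\<Sum>i\<in>I. star (f i))"
  by (induction I rule: infinite_finite_induct) (auto simp: star_add A_sum)

lemma tr_linear: "linear_on A tr"
  by (simp add: linear_on_def tr_add)

lemma star_one [simp]: "star one = one"
proof -
  have "star (star one) = star (star one \<odot> one)" by simp
  also have "\<dots> = star one \<odot> star (star one)" by (rule star_mult) auto
  finally show ?thesis by simp
qed

definition hermitian :: "'a \<Rightarrow> bool" where
  "hermitian x \<longleftrightarrow> x \<in> A \<and> star x = x"

text \<open>
  Testing against the trace makes the cone visibly convex and closed; by \<open>pos_iff_square\<close> below it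
  consists of the elements \<open>c \<odot> star c\<close>.
\<close>

definition pos :: "'a \<Rightarrow> bool" where
  "pos x \<longleftrightarrow> x \<in> A \<and> (\<forall>d\<in>A. tr (x \<odot> (d \<odot> star d)) \<in> \<real>\<^sub>\<ge>\<^sub>0)"

definition spos :: "'a \<Rightarrow> bool" where
  "spos x \<longleftrightarrow> (\<exists>\<epsilon>>0. pos (x - complex_of_real \<epsilon> \<cdot> one))"

lemma hermitian_in [simp]: "hermitian x \<Longrightarrow> x \<in> A" by (simp add: hermitian_def)
lemma pos_in [simp]: "pos x \<Longrightarrow> x \<in> A" by (simp add: pos_def)

lemma hermitian_add [simp]: "hermitian x \<Longrightarrow> hermitian y \<Longrightarrow> hermitian (x + y)"
  and hermitian_diff [simp]: "hermitian x \<Longrightarrow> hermitian y \<Longrightarrow> hermitian (x - y)"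
  and hermitian_scl [simp]: "hermitian x \<Longrightarrow> hermitian (complex_of_real c \<cdot> x)"
  and hermitian_one [simp]: "hermitian one"
  by (auto simp: hermitian_def star_add star_diff simp del: hermitian_in)

lemma hermitian_conj: "hermitian x \<Longrightarrow> c \<in> A \<Longrightarrow> hermitian (c \<odot> x \<odot> star c)"
  by (simp add: hermitian_def star_mult mult_assoc del: hermitian_in)

text \<open>Positivity alone makes the trace compatible with the star: \<open>a + one\<close> and
  \<open>\<i> \<cdot> a + one\<close>, each multiplied by its adjoint, have real traces, and the
  cross terms then fix the imaginary and real parts.\<close>

lemma tr_star: assumes a: "a \<in> A" shows "tr (star a) = cnj (tr a)"
proof -
  have 1: "tr ((a + one) \<odot> star (a + one)) \<in> \<real>\<^sub>\<ge>\<^sub>0" "tr ((\<i> \<cdot> a + one) \<odot> star (\<i> \<cdot> a + one)) \<in> \<real>\<^sub>\<ge>\<^sub>0"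
    "tr (a \<odot> star a) \<in> \<real>\<^sub>\<ge>\<^sub>0" "tr (one \<odot> star one) \<in> \<real>\<^sub>\<ge>\<^sub>0"
    using a tr_pos[of "a + one"] tr_pos[of "\<i> \<cdot> a + one"] tr_pos[of a] tr_pos[of one] by auto
  have 2: "tr ((a + one) \<odot> star (a + one)) = tr (a \<odot> star a) + tr a + tr (star a) + tr (one \<odot> star one)"
    "tr ((\<i> \<cdot> a + one) \<odot> star (\<i> \<cdot> a + one)) = tr (a \<odot> star a) + \<i> * tr a - \<i> * tr (star a) + tr (one \<odot> star one)"
    using a by (simp_all add: distribs)
  have "Im (tr a + tr (star a)) = 0" "Im (\<i> * tr a - \<i> * tr (star a)) = 0"
    using 1 unfolding 2 by (simp_all add: nonneg_Reals_complex)
  then show ?thesis by (simp add: complex_eq_iff)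
qed

text \<open>By cyclicity, hermitian elements act by left multiplication as self-adjoint operators
  for this inner product; the algebra itself takes the place of a Hilbert space on which it
  acts.\<close>

lemma trace_inner_product: "inner_product_on A (\<lambda>a b. tr (a \<odot> star b))"
proof -
  have *: "tr (b \<odot> star a) = cnj (tr (a \<odot> star b))" if "a \<in> A" "b \<in> A" for a b
    using that tr_star[of "a \<odot> star b"] by (simp add: star_mult)
  have "bilinear_on A (\<lambda>a b. tr (a \<odot> star b))"
    unfolding bilinear_on_def by (simp add: distribs)
  then show ?thesis
    unfolding inner_product_on_def using tr_pos tr_faithful * by blast
qed

text \<open>Reduces statements linear in \<open>a\<close> to squares, the elements against which
  \<open>pos\<close> is tested; see \<open>tr_ext\<close> and \<open>tr_bound\<close>.\<close>

lemma polarization: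
  assumes a: "a \<in> A"
  shows "4 \<cdot> a = (a + one) \<odot> star (a + one) - (a - one) \<odot> star (a - one)
     + \<i> \<cdot> ((a + \<i> \<cdot> one) \<odot> star (a + \<i> \<cdot> one)) - \<i> \<cdot> ((a - \<i> \<cdot> one) \<odot> star (a - \<i> \<cdot> one))"
proof -
  have "(a + one) \<odot> star (a + one) - (a - one) \<odot> star (a - one) = 2 \<cdot> a + 2 \<cdot> star a"
    using a scale_left_distrib[of 1 1] by (simp add: distribs algebra_simps)
  moreover have "\<i> \<cdot> ((a + \<i> \<cdot> one) \<odot> star (a + \<i> \<cdot> one)) - \<i> \<cdot> ((a - \<i> \<cdot> one) \<odot> star (a - \<i> \<cdot> one)) = 2 \<cdot> a - 2 \<cdot> star a"
    using a scale_left_distrib[of 1 1] by (simp add: distribs algebra_simps)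
  moreover have "(2 \<cdot> a + 2 \<cdot> star a) + (2 \<cdot> a - 2 \<cdot> star a) = 4 \<cdot> a"
    using scale_left_distrib[of 2 2 a] by simp
  ultimately show ?thesis by (simp add: algebra_simps)
qed

lemma tr_ext:
  assumes x: "x \<in> A" and z: "\<And>d. d \<in> A \<Longrightarrow> tr (x \<odot> (d \<odot> star d)) = 0"
  shows "x = 0"
proof -
  have "tr (x \<odot> a) = 0" if a: "a \<in> A" for a
  proof -
    have "4 * tr (x \<odot> a) = tr (x \<odot> (4 \<cdot> a))" using x a by simp
    also have "\<dots> = 0"
      unfolding polarization[OF a] using x a z[of "a + one"] z[of "a - one"] z[of "a + \<i> \<cdot> one"] z[of "a - \<i> \<cdot> one"]
      by (simp add: mult_add_right mult_diff_right tr_add tr_diff)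
    finally show ?thesis by simp
  qed
  then show ?thesis using x tr_faithful[of x] by simp
qed

text \<open>Real pairings with all squares cannot tell \<open>x\<close> from \<open>star x\<close>,
  and by \<open>tr_ext\<close> these pairings determine an element.\<close>

lemma pos_hermitian: assumes "pos x" shows "hermitian x"
proof -
  have x: "x \<in> A" using assms by simp
  have "tr ((x - star x) \<odot> (d \<odot> star d)) = 0" if d: "d \<in> A" for d
  proof -
    have "tr (star x \<odot> (d \<odot> star d)) = tr (star ((d \<odot> star d) \<odot> x))" using x d by (simp add: star_mult)
    also have "\<dots> = cnj (tr (x \<odot> (d \<odot> star d)))" using x d tr_star tr_commute[of x "d \<odot> star d"] by simp
    also have "\<dots> = tr (x \<odot> (d \<odot> star d))" using assms d by (auto simp: pos_def nonneg_Reals_complex complex_eq_iff simp del: pos_in)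
    finally show ?thesis using x d by (simp add: mult_diff_left tr_diff)
  qed
  then have "x - star x = 0" using x by (intro tr_ext) auto
  then show ?thesis using x by (simp add: hermitian_def del: hermitian_in)
qed

text \<open>By cyclicity the product of two squares has the trace of a single square, that of
  \<open>star d \<odot> c\<close>.\<close>

lemma pos_square: "c \<in> A \<Longrightarrow> pos (c \<odot> star c)"
proof -
  assume c: "c \<in> A"
  have "tr (c \<odot> star c \<odot> (d \<odot> star d)) = tr ((star d \<odot> c) \<odot> star (star d \<odot> c))" if d: "d \<in> A" for d
  proof -
    have "tr (c \<odot> star c \<odot> (d \<odot> star d)) = tr ((c \<odot> star c \<odot> d) \<odot> star d)" using c d by (simp add: mult_assoc)
    also have "\<dots> = tr (star d \<odot> (c \<odot> star c \<odot> d))" using c d by (intro tr_commute) auto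
    also have "\<dots> = tr ((star d \<odot> c) \<odot> star (star d \<odot> c))" using c d by (simp add: mult_assoc star_mult)
    finally show ?thesis .
  qed
  then show ?thesis using c tr_pos by (simp add: pos_def del: pos_in)
qed

lemma pos_add: "pos x \<Longrightarrow> pos y \<Longrightarrow> pos (x + y)"
  by (auto simp: pos_def mult_add_left tr_add nonneg_Reals_complex simp del: pos_in)

lemma pos_scl: "pos x \<Longrightarrow> 0 \<le> c \<Longrightarrow> pos (complex_of_real c \<cdot> x)"
  by (auto simp: pos_def nonneg_Reals_complex simp del: pos_in)

lemma pos_zero [simp]: "pos 0"
  by (auto simp: pos_def simp del: pos_in)

lemma pos_one [simp]: "pos one"
  using pos_square[of one] by simp

lemma pos_tr: "pos x \<Longrightarrow> tr x \<in> \<real>\<^sub>\<ge>\<^sub>0"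
  unfolding pos_def using one_closed by (auto dest!: bspec[of _ _ one])

lemma pos_conj: "pos x \<Longrightarrow> c \<in> A \<Longrightarrow> pos (c \<odot> x \<odot> star c)"
proof -
  assume x: "pos x" and c: "c \<in> A"
  have "tr (c \<odot> x \<odot> star c \<odot> (d \<odot> star d)) = tr (x \<odot> ((star c \<odot> d) \<odot> star (star c \<odot> d)))" if d: "d \<in> A" for d
    using x c d tr_commute[of c "x \<odot> star c \<odot> (d \<odot> star d)"] by (simp add: star_mult mult_assoc)
  then show ?thesis using x c by (simp add: pos_def del: pos_in)
qed

lemma spos_pos: assumes "spos x" shows "pos x"
proof -
  obtain \<epsilon> where e: "\<epsilon> > 0" "pos (x - complex_of_real \<epsilon> \<cdot> one)" using assms by (auto simp: spos_def)
  then have "pos ((x - complex_of_real \<epsilon> \<cdot> one) + complex_of_real \<epsilon> \<cdot> one)" by (intro pos_add pos_scl) auto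
  then show ?thesis by simp
qed

text \<open>The squared length of \<open>h \<odot> w\<close> is the pairing of
  \<open>h \<odot> (h \<odot> w)\<close> with \<open>w\<close>. Applied to a hermitian h - l, this
  rules out Jordan blocks.\<close>

lemma hermitian_square_zero:
  assumes h: "hermitian h" and w: "w \<in> A" and z: "h \<odot> (h \<odot> w) = 0"
  shows "h \<odot> w = 0"
proof -
  have hA: "h \<in> A" "star h = h" using h by (auto simp: hermitian_def simp del: hermitian_in)
  have "tr ((h \<odot> w) \<odot> star (h \<odot> w)) = tr ((h \<odot> (h \<odot> w)) \<odot> star w)"
    using w hA tr_commute[of "h \<odot> w \<odot> star w" h] by (simp add: star_mult mult_assoc)
  then show ?thesis using z w hA by (intro tr_faithful) auto
qed

lemma hermitian_eigenvalue_real: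
  assumes h: "hermitian h" and w: "w \<in> A" "w \<noteq> 0" and ev: "h \<odot> w = l \<cdot> w"
  shows "l \<in> \<real>"
proof -
  have hA: "h \<in> A" "star h = h" using h by (auto simp: hermitian_def simp del: hermitian_in)
  have "cnj (tr (h \<odot> (w \<odot> star w))) = tr (h \<odot> (w \<odot> star w))"
    using w hA tr_star[of "h \<odot> (w \<odot> star w)"] tr_commute[of h "w \<odot> star w"] by (simp add: star_mult mult_assoc)
  then have "cnj (l * tr (w \<odot> star w)) = l * tr (w \<odot> star w)"
    using w hA ev by (simp flip: mult_assoc)
  moreover have "cnj (tr (w \<odot> star w)) = tr (w \<odot> star w)" "tr (w \<odot> star w) \<noteq> 0"
    using tr_pos[OF w(1)] tr_faithful[OF w(1)] w(2) by (auto simp: nonneg_Reals_complex complex_eq_iff)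
  ultimately show ?thesis by (simp add: Reals_cnj_iff)
qed

section \<open>Polynomials in a left multiplication\<close>

definition papp :: "('a \<Rightarrow> 'a) \<Rightarrow> complex poly \<Rightarrow> 'a \<Rightarrow> 'a" where
  "papp L p w = (\<Sum>i\<le>degree p. coeff p i \<cdot> (L ^^ i) w)"

text \<open>\<open>papp L p w\<close> is p(L) applied to w; a summation bound common to several
  polynomials lets their actions be added.\<close>

lemma papp_sum: "degree p \<le> n \<Longrightarrow> papp L p w = (\<Sum>i\<le>n. coeff p i \<cdot> (L ^^ i) w)"
  unfolding papp_def by (rule sum.mono_neutral_left) (auto simp: coeff_eq_0)

lemma funpow_left_mult_closed [simp]: "h \<in> A \<Longrightarrow> w \<in> A \<Longrightarrow> ((\<lambda>w. h \<odot> w) ^^ i) w \<in> A"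
  by (induction i) auto

lemma papp_closed [simp]: "h \<in> A \<Longrightarrow> w \<in> A \<Longrightarrow> papp (\<lambda>w. h \<odot> w) p w \<in> A"
  unfolding papp_def by (intro A_sum A_scl) auto

lemma papp_add: "papp L (p + q) w = papp L p w + papp L q w"
proof -
  let ?n = "max (degree p) (degree q)"
  have "papp L (p + q) w = (\<Sum>i\<le>?n. coeff (p + q) i \<cdot> (L ^^ i) w)"
    by (rule papp_sum) (rule degree_add_le_max)
  also have "\<dots> = (\<Sum>i\<le>?n. coeff p i \<cdot> (L ^^ i) w) + (\<Sum>i\<le>?n. coeff q i \<cdot> (L ^^ i) w)"
    by (simp add: scale_left_distrib sum.distrib)
  finally show ?thesis
    unfolding papp_sum[of p ?n L w, OF max.cobounded1] papp_sum[of q ?n L w, OF max.cobounded2] .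
qed

lemma papp_smult: "papp L (smult c p) w = c \<cdot> papp L p w"
  unfolding papp_sum[of "smult c p" "degree p" L w, OF degree_smult_le] papp_def
  by (simp add: scale_sum_right)

lemma papp_pCons:
  assumes "h \<in> A" "w \<in> A"
  shows "papp (\<lambda>w. h \<odot> w) (pCons a p) w = a \<cdot> w + h \<odot> papp (\<lambda>w. h \<odot> w) p w"
    and "papp (\<lambda>w. h \<odot> w) (pCons a p) w = a \<cdot> w + papp (\<lambda>w. h \<odot> w) p (h \<odot> w)"
proof -
  let ?L = "\<lambda>w. h \<odot> w"
  have "papp ?L (pCons a p) w = (\<Sum>i\<le>Suc (degree p). coeff (pCons a p) i \<cdot> (?L ^^ i) w)"
    by (rule papp_sum) (rule degree_pCons_le)
  also have "\<dots> = a \<cdot> w + (\<Sum>i\<le>degree p. coeff p i \<cdot> (?L ^^ Suc i) w)"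
    by (subst sum.atMost_Suc_shift) simp
  finally have *: "papp ?L (pCons a p) w = a \<cdot> w + (\<Sum>i\<le>degree p. coeff p i \<cdot> (?L ^^ Suc i) w)" .
  show "papp ?L (pCons a p) w = a \<cdot> w + h \<odot> papp ?L p w"
    by (rule trans[OF *]) (use assms in \<open>simp add: papp_def mult_sum_right\<close>)
  show "papp ?L (pCons a p) w = a \<cdot> w + papp ?L p (h \<odot> w)"
    by (rule trans[OF *]) (simp add: papp_def funpow_swap1)
qed

text \<open>The factor acts on the argument first, so a factored polynomial annihilating
  \<open>w\<close> leaves one of smaller degree annihilating (h - l) w;
  \<open>eigen_decomposition\<close> recurses in this way.\<close>

lemma papp_linear_factor:
  assumes "h \<in> A" "w \<in> A"
  shows "papp (\<lambda>w. h \<odot> w) ([:- l, 1:] * q) w = papp (\<lambda>w. h \<odot> w) q (h \<odot> w - l \<cdot> w)"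
proof -
  let ?L = "\<lambda>w. h \<odot> w"
  have pow: "(?L ^^ i) (h \<odot> w - l \<cdot> w) = (?L ^^ i) (h \<odot> w) - l \<cdot> (?L ^^ i) w" for i
    using assms by (induction i) (auto simp: mult_diff_right)
  have lq: "[:- l, 1:] * q = smult (- l) q + pCons 0 q" by simp
  have "papp ?L ([:- l, 1:] * q) w = - l \<cdot> papp ?L q w + papp ?L q (h \<odot> w)"
    unfolding lq papp_add papp_smult papp_pCons(2)[OF assms] by simp
  also have "\<dots> = papp ?L q (h \<odot> w - l \<cdot> w)"
    unfolding papp_def pow
    by (simp add: scale_right_diff_distrib sum_subtractf scale_sum_right scale_minus_left sum_negf mult.commute)
  finally show ?thesis .
qed

lemma annihilating_poly:
  assumes "h \<in> A" "w \<in> A"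
  shows "\<exists>p. p \<noteq> 0 \<and> papp (\<lambda>w. h \<odot> w) p w = 0"
proof -
  obtain B where B: "finite B" "A = span B" using A_finite_dim by blast
  have "\<And>i. ((\<lambda>w. h \<odot> w) ^^ i) w \<in> span B" using assms B(2)[symmetric] by simp
  from linear_dependence_sequence[OF B(1), of "\<lambda>i. ((\<lambda>w. h \<odot> w) ^^ i) w", OF this]
  obtain N c where "(\<exists>i\<le>N. c i \<noteq> 0) \<and> (\<Sum>i\<le>(N::nat). c i \<cdot> ((\<lambda>w. h \<odot> w) ^^ i) w) = 0"
    by (elim exE)
  then have c: "\<exists>i\<le>N. c i \<noteq> 0" "(\<Sum>i\<le>N. c i \<cdot> ((\<lambda>w. h \<odot> w) ^^ i) w) = 0"
    by (fact conjunct1, fact conjunct2)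
  define p where "p = (\<Sum>i\<le>N. monom (c i) i)"
  have cp: "coeff p i = (if i \<le> N then c i else 0)" for i
    by (simp add: p_def coeff_sum coeff_monom if_distrib cong: if_cong)
  have "degree p \<le> N" by (rule degree_le) (simp add: cp)
  then have "papp (\<lambda>w. h \<odot> w) p w = 0" using c(2) by (simp add: papp_sum cp)
  moreover have "p \<noteq> 0" using c(1) cp by (metis coeff_0)
  ultimately show ?thesis by blast
qed

text \<open>
  In a polynomial of minimal degree annihilating \<open>x\<close>, a nonzero constant term yields an inverse of \<open>x\<close>,
  and otherwise the cofactor of \<open>x\<close> annihilates \<open>x\<close>.
\<close>

lemma not_invertible_annihilator:
  assumes x: "x \<in> A" and ninv: "\<not> (\<exists>z\<in>A. x \<odot> z = one \<and> z \<odot> x = one)"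
  shows "\<exists>w\<in>A. w \<noteq> 0 \<and> w \<odot> x = 0"
proof -
  let ?L = "\<lambda>w. x \<odot> w"
  define P where "P n \<longleftrightarrow> (\<exists>p. p \<noteq> 0 \<and> papp ?L p one = 0 \<and> degree p = n)" for n
  have P_ex: "\<exists>n. P n" using annihilating_poly[OF x one_closed] by (auto simp: P_def)
  have PD: "\<exists>p. p \<noteq> 0 \<and> papp ?L p one = 0 \<and> degree p = n" if "P n" for n
    using that by (simp add: P_def)
  obtain p where p: "p \<noteq> 0" "papp ?L p one = 0" "degree p = (LEAST n. P n)"
    using PD[OF LeastI_ex[OF P_ex]] by (elim exE conjE)
  obtain a q where pq: "p = pCons a q" by (rule pCons_cases)
  have comm: "papp ?L q' one \<odot> x = x \<odot> papp ?L q' one" for q'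
  proof (induction q')
    case (pCons b q')
    then show ?case using x by (simp add: papp_pCons(1)[OF x one_closed] mult_add_left mult_add_right mult_assoc)
  qed (simp add: papp_def x)
  define w where "w = papp ?L q one"
  have wA: "w \<in> A" using x by (simp add: w_def)
  have eq: "a \<cdot> one + x \<odot> w = 0" using p(2) x by (simp add: pq papp_pCons(1) w_def)
  have q0: "q \<noteq> 0" if "a = 0" using p(1) that by (auto simp: pq)
  show ?thesis
  proof (cases "a = 0")
    case True
    have "w \<noteq> 0"
    proof
      assume "w = 0"
      then have "P (degree q)" using q0 True by (auto simp: P_def w_def)
      then have "degree p \<le> degree q" unfolding p(3) by (rule Least_le)
      then show False using q0 True by (simp add: pq)
    qed
    then show ?thesis using eq True comm[of q] wA by (auto simp: w_def)
  next
    case False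
    let ?z = "(- 1 / a) \<cdot> w"
    have "x \<odot> w = - (a \<cdot> one)" using eq by (simp add: eq_neg_iff_add_eq_0 add.commute)
    then have xw: "x \<odot> w = (- a) \<cdot> one" by (simp only: scale_minus_left)
    have "x \<odot> ?z = (- 1 / a) \<cdot> (x \<odot> w)" using x wA by (rule mult_scl_right)
    then have 1: "x \<odot> ?z = one" unfolding xw scale_scale using False by simp
    have "?z \<odot> x = (- 1 / a) \<cdot> (w \<odot> x)" using wA x by (rule mult_scl_left)
    then have "?z \<odot> x = one" using 1 comm[of q] mult_scl_right[OF x wA, of "- 1 / a"] by (simp only: w_def)
    with 1 have "x \<odot> ?z = one \<and> ?z \<odot> x = one" ..
    moreover have "?z \<in> A" using wA by simp
    ultimately show ?thesis using ninv by blast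
  qed
qed

text \<open>
  The linear factors of an annihilating polynomial are split off one by one; since \<open>h\<close> is hermitian, its
  generalised eigenvectors are eigenvectors.
\<close>

lemma eigen_decomposition:
  assumes h: "hermitian h" and w: "w \<in> A"
  shows "\<exists>S v. finite S \<and> (\<forall>t::real. v t \<in> A \<and> h \<odot> v t = complex_of_real t \<cdot> v t) \<and> w = (\<Sum>t\<in>S. v t)"
proof -
  let ?L = "\<lambda>w. h \<odot> w"
  have hA: "h \<in> A" using h by simp
  have "\<exists>S v. finite S \<and> (\<forall>t::real. v t \<in> A \<and> h \<odot> v t = complex_of_real t \<cdot> v t) \<and> w = (\<Sum>t\<in>S. v t)"
    if "p \<noteq> 0" "degree p = n" "w \<in> A" "papp ?L p w = 0" for p n w
    using that
  proof (induction n arbitrary: p w)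
    case 0
    then obtain c where "p = [:c:]" by (meson degree_eq_zeroE)
    then have "c \<noteq> 0" "c \<cdot> w = 0" using 0 by (auto simp: papp_def)
    then have "w = 0" by simp
    then show ?case by (intro exI[of _ "{}"] exI[of _ "\<lambda>_. 0"]) (simp add: hA)
  next
    case (Suc n)
    obtain l where "poly p l = 0"
      using fundamental_theorem_of_algebra[of p] Suc.prems(2) by (auto simp: constant_degree)
    then obtain q where q: "p = [:- l, 1:] * q" by (auto simp: poly_eq_0_iff_dvd elim: dvdE)
    have q0: "q \<noteq> 0" using Suc.prems(1) q by auto
    have dq: "degree q = n" using Suc.prems(2) q0 unfolding q by (subst (asm) degree_mult_eq) auto
    have w: "w \<in> A" by fact
    let ?u = "h \<odot> w - l \<cdot> w"
    have "papp ?L q ?u = 0" using Suc.prems(4) papp_linear_factor[OF hA w] q by simp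
    then obtain S v where S: "finite S" "\<And>t::real. v t \<in> A" "\<And>t. h \<odot> v t = complex_of_real t \<cdot> v t" "?u = (\<Sum>t\<in>S. v t)"
      using Suc.IH[OF q0 dq, of ?u] hA w by auto
    \<comment> \<open>Solves (h - l) v' t = v t componentwise. If t = l, division by zero gives 0,
      so \<open>v' t\<close> vanishes and this component is left to \<open>u\<close>.\<close>
    define v' where "v' t = (1 / (complex_of_real t - l)) \<cdot> v t" for t
    have v': "v' t \<in> A" "h \<odot> v' t = complex_of_real t \<cdot> v' t" for t
      using S hA by (simp_all add: v'_def scale_left_commute)
    define u where "u = w - (\<Sum>t\<in>S. v' t)"
    have uA: "u \<in> A" using w v' by (auto simp: u_def intro!: A_diff A_sum)
    have sv: "(\<Sum>t\<in>S. h \<odot> v' t - l \<cdot> v' t) = (\<Sum>t\<in>S. if complex_of_real t = l then 0 else v t)"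
    proof (rule sum.cong[OF refl])
      fix t
      have "h \<odot> v' t - l \<cdot> v' t = (complex_of_real t - l) \<cdot> v' t" using v' by (simp add: scale_left_diff_distrib)
      also have "\<dots> = (if complex_of_real t = l then 0 else v t)" by (simp add: v'_def)
      finally show "h \<odot> v' t - l \<cdot> v' t = (if complex_of_real t = l then 0 else v t)" .
    qed
    have hu: "h \<odot> u - l \<cdot> u = (\<Sum>t\<in>S. if complex_of_real t = l then v t else 0)"
    proof -
      have "h \<odot> u - l \<cdot> u = ?u - (\<Sum>t\<in>S. h \<odot> v' t - l \<cdot> v' t)"
        using hA w v' by (simp add: u_def mult_diff_right mult_sum_right A_sum scale_right_diff_distrib scale_sum_right sum_subtractf)
      also have "\<dots> = (\<Sum>t\<in>S. v t - (if complex_of_real t = l then 0 else v t))" unfolding sv S(4) by (simp add: sum_subtractf)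
      also have "\<dots> = (\<Sum>t\<in>S. if complex_of_real t = l then v t else 0)" by (rule sum.cong) auto
      finally show ?thesis .
    qed
    show ?case
    proof (cases "l \<in> \<real>")
      case True
      then obtain r where r: "l = complex_of_real r" by (auto elim: Reals_cases)
      let ?k = "h - l \<cdot> one"
      have k: "hermitian ?k" using h r by simp
      have ku: "?k \<odot> a = h \<odot> a - l \<cdot> a" if "a \<in> A" for a using that hA by (simp add: mult_diff_left)
      \<comment> \<open>What remains of (h - l) u is the component at \<open>l\<close>, which a
        second factor kills; in the absence of Jordan blocks one factor already does.\<close>
      have "?k \<odot> (?k \<odot> u) = (\<Sum>t\<in>S. ?k \<odot> (if complex_of_real t = l then v t else 0))"
        unfolding ku[OF uA] hu using hA S(2) by (subst mult_sum_right) auto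
      also have "\<dots> = 0" using S ku hA by (intro sum.neutral) auto
      finally have "?k \<odot> u = 0" using hermitian_square_zero[OF k uA] by simp
      then have hu0: "h \<odot> u = complex_of_real r \<cdot> u" using ku[OF uA] r by simp
      \<comment> \<open>\<open>r\<close> may or may not belong to \<open>S\<close>; since
        \<open>v' r = 0\<close>, storing \<open>u\<close> at \<open>r\<close> overwrites
        nothing.\<close>
      define v'' where "v'' t = (if t = r then u else v' t)" for t
      have "v' r = 0" by (simp add: v'_def r)
      then have "(\<Sum>t\<in>S. v' t) = (\<Sum>t\<in>S - {r}. v' t)" using S(1) by (intro sum.mono_neutral_right) auto
      also have "\<dots> = (\<Sum>t\<in>S - {r}. v'' t)" by (rule sum.cong) (auto simp: v''_def)
      finally have "(\<Sum>t\<in>insert r S. v'' t) = u + (\<Sum>t\<in>S. v' t)"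
        using S(1) by (simp add: sum.insert_remove v''_def)
      then have "w = (\<Sum>t\<in>insert r S. v'' t)" by (simp add: u_def)
      moreover have "v'' t \<in> A \<and> h \<odot> v'' t = complex_of_real t \<cdot> v'' t" for t using v' uA hu0 by (simp add: v''_def)
      ultimately show ?thesis using S(1) by (intro exI[of _ "insert r S"] exI[of _ v'']) auto
    next
      case False
      have "(\<Sum>t\<in>S. if complex_of_real t = l then v t else 0) = 0"
        using False by (intro sum.neutral) auto
      then have "h \<odot> u = l \<cdot> u" using hu by simp
      \<comment> \<open>A non-real \<open>l\<close> occurs in no summand, so a nonzero
        \<open>u\<close> would be an eigenvector of a hermitian element for a non-real
        eigenvalue.\<close>
      then have "u = 0" using hermitian_eigenvalue_real[OF h uA] False by blast
      then show ?thesis using S(1) v' by (intro exI[of _ S] exI[of _ v']) (auto simp: u_def)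
    qed
  qed
  then show ?thesis using annihilating_poly[OF hA w] w by blast
qed

end

section \<open>Spectral decomposition and functional calculus\<close>

context tracial_star_algebra
begin

lemma tr_mult_star_positive: "x \<in> A \<Longrightarrow> x \<noteq> 0 \<Longrightarrow> 0 < Re (tr (x \<odot> star x))"
  using tr_pos[of x] tr_faithful[of x] by (fastforce simp: nonneg_Reals_complex complex_eq_iff)

text \<open>Membership and self-adjointness are demanded for every real index, so that single
  projections can be handled without index conditions; being nonzero is demanded on
  \<open>S\<close>, where it makes every index a genuine spectral value.\<close>

definition spectral_family :: "'a \<Rightarrow> real set \<Rightarrow> (real \<Rightarrow> 'a) \<Rightarrow> bool" where
  "spectral_family h S p \<longleftrightarrow> finite S \<and> (\<forall>t. p t \<in> A \<and> star (p t) = p t) \<and> (\<forall>t\<in>S. p t \<noteq> 0) \<and>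
     (\<forall>t\<in>S. \<forall>u\<in>S. p t \<odot> p u = (if t = u then p t else 0)) \<and>
     (\<forall>t\<in>S. h \<odot> p t = complex_of_real t \<cdot> p t) \<and> one = (\<Sum>t\<in>S. p t) \<and> h = (\<Sum>t\<in>S. complex_of_real t \<cdot> p t)"

text \<open>
  The components of the unit in the eigenspaces of left multiplication by \<open>h\<close> are automatically
  orthogonal projections.
\<close>

lemma spectral_family_exists:
  assumes h: "hermitian h"
  shows "\<exists>S p. spectral_family h S p"
proof -
  have hA: "h \<in> A" "star h = h" using h by (auto simp: hermitian_def simp del: hermitian_in)
  obtain S v where S: "finite S" "\<And>t::real. v t \<in> A" "\<And>t. h \<odot> v t = complex_of_real t \<cdot> v t" "one = (\<Sum>t\<in>S. v t)"
    using eigen_decomposition[OF h one_closed] by blast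
  have orth: "star (v t) \<odot> v u = 0" if "t \<noteq> u" for t u
  proof -
    have "star (v t) \<odot> (h \<odot> v u) = star (h \<odot> v t) \<odot> v u"
      using S(2) hA by (simp add: star_mult mult_assoc)
    then have "complex_of_real u \<cdot> (star (v t) \<odot> v u) = complex_of_real t \<cdot> (star (v t) \<odot> v u)"
      using S(2) unfolding S(3) by simp
    then show ?thesis using that by (simp add: scale_cancel_right)
  qed
  \<comment> \<open>Multiplying the decomposition of \<open>one\<close> by \<open>star (v t)\<close>
    leaves a single term by orthogonality. The result exhibits \<open>star (v t)\<close> as a
    square, so \<open>v t\<close> is self-adjoint and then idempotent.\<close>
  have starv: "star (v t) = star (v t) \<odot> v t" if t: "t \<in> S" for t
  proof -
    have "star (v t) = star (v t) \<odot> (\<Sum>u\<in>S. v u)" using S(2) by (simp flip: S(4))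
    also have "\<dots> = (\<Sum>u\<in>S. star (v t) \<odot> v u)" using S(2) by (simp add: mult_sum_right)
    also have "\<dots> = (\<Sum>u\<in>S. if u = t then star (v t) \<odot> v t else 0)" by (rule sum.cong) (auto simp: orth)
    finally show ?thesis using S(1) t by simp
  qed
  have herm: "star (v t) = v t" if t: "t \<in> S" for t
  proof -
    have "star (star (v t)) = star (star (v t) \<odot> v t)" using starv[OF t] by simp
    then have "v t = star (v t) \<odot> v t" using S(2)[of t] by (simp add: star_mult)
    then show ?thesis using starv[OF t] by simp
  qed
  define S' where "S' = {t\<in>S. v t \<noteq> 0}"
  define p where "p t = (if t \<in> S' then v t else 0)" for t
  have sum: "(\<Sum>t\<in>S'. p t) = (\<Sum>t\<in>S. v t)"
    using S(1) by (intro sum.mono_neutral_cong_left) (auto simp: S'_def p_def)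
  have one: "one = (\<Sum>t\<in>S'. p t)" using S(4) sum by simp
  have "h = h \<odot> (\<Sum>t\<in>S'. p t)" unfolding one[symmetric] using hA by simp
  also have "\<dots> = (\<Sum>t\<in>S'. h \<odot> p t)" using S(2) hA by (intro mult_sum_right) (auto simp: p_def)
  also have "\<dots> = (\<Sum>t\<in>S'. complex_of_real t \<cdot> p t)" using S(3) by (intro sum.cong) (auto simp: p_def)
  finally have hsum: "h = (\<Sum>t\<in>S'. complex_of_real t \<cdot> p t)" .
  have mult: "p t \<odot> p u = (if t = u then p t else 0)" if "t \<in> S'" "u \<in> S'" for t u
    using that orth[of t u] herm[of t] starv[of t] by (auto simp: p_def S'_def)
  have "spectral_family h S' p"
    unfolding spectral_family_def
    using S herm mult one hsum by (auto simp: p_def S'_def)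
  then show ?thesis by blast
qed

lemma spectral_familyD:
  assumes "spectral_family h S p"
  shows "finite S" "p t \<in> A" "star (p t) = p t" "t \<in> S \<Longrightarrow> p t \<noteq> 0"
    "t \<in> S \<Longrightarrow> u \<in> S \<Longrightarrow> p t \<odot> p u = (if t = u then p t else 0)"
    "t \<in> S \<Longrightarrow> h \<odot> p t = complex_of_real t \<cdot> p t" "one = (\<Sum>t\<in>S. p t)" "h = (\<Sum>t\<in>S. complex_of_real t \<cdot> p t)"
  using assms unfolding spectral_family_def by blast+

text \<open>The functional calculus f(h), when \<open>p\<close> is the spectral family of
  \<open>h\<close>.\<close>

definition fcalc :: "real set \<Rightarrow> (real \<Rightarrow> 'a) \<Rightarrow> (real \<Rightarrow> real) \<Rightarrow> 'a" where
  "fcalc S p f = (\<Sum>t\<in>S. complex_of_real (f t) \<cdot> p t)"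

lemma fcalc_closed: "spectral_family h S p \<Longrightarrow> fcalc S p f \<in> A"
  unfolding fcalc_def by (intro A_sum A_scl spectral_familyD(2))

lemma fcalc_hermitian: "spectral_family h S p \<Longrightarrow> hermitian (fcalc S p f)"
  using fcalc_closed[of h S p f] spectral_familyD(2,3)[of h S p]
  unfolding hermitian_def fcalc_def by (simp add: star_sum)

lemma fcalc_mult_p:
  assumes s: "spectral_family h S p" and t: "t \<in> S"
  shows "fcalc S p f \<odot> p t = complex_of_real (f t) \<cdot> p t"
proof -
  note D = spectral_familyD[OF s]
  have "fcalc S p f \<odot> p t = (\<Sum>u\<in>S. complex_of_real (f u) \<cdot> (p u \<odot> p t))"
    unfolding fcalc_def using D(2) by (simp add: mult_sum_left)
  also have "\<dots> = (\<Sum>u\<in>S. if u = t then complex_of_real (f t) \<cdot> p t else 0)"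
    by (rule sum.cong) (use D(5) t in auto)
  finally show ?thesis using D(1) t by simp
qed

lemma fcalc_mult:
  assumes s: "spectral_family h S p"
  shows "fcalc S p f \<odot> fcalc S p g = fcalc S p (\<lambda>t. f t * g t)"
proof -
  note D = spectral_familyD[OF s]
  have "fcalc S p f \<odot> fcalc S p g = (\<Sum>t\<in>S. fcalc S p f \<odot> (complex_of_real (g t) \<cdot> p t))"
    unfolding fcalc_def[of S p g] using fcalc_closed[OF s] D(2) by (intro mult_sum_right) auto
  also have "\<dots> = (\<Sum>t\<in>S. complex_of_real (f t * g t) \<cdot> p t)"
    by (rule sum.cong) (use fcalc_closed[OF s] D(2) fcalc_mult_p[OF s] in \<open>auto simp: mult.commute\<close>)
  finally show ?thesis by (simp add: fcalc_def)
qed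

lemma fcalc_one: "spectral_family h S p \<Longrightarrow> fcalc S p (\<lambda>t. 1) = one"
  using spectral_familyD(7)[of h S p] by (simp add: fcalc_def)

lemma fcalc_id: "spectral_family h S p \<Longrightarrow> fcalc S p (\<lambda>t. t) = h"
  using spectral_familyD(8)[of h S p] by (simp add: fcalc_def)

lemma fcalc_diff: "fcalc S p f - fcalc S p g = fcalc S p (\<lambda>t. f t - g t)"
  by (simp add: fcalc_def scale_left_diff_distrib sum_subtractf)

lemma fcalc_scl: "complex_of_real c \<cdot> fcalc S p f = fcalc S p (\<lambda>t. c * f t)"
  by (simp add: fcalc_def scale_sum_right)

lemma fcalc_cong: "(\<And>t. t \<in> S \<Longrightarrow> f t = g t) \<Longrightarrow> fcalc S p f = fcalc S p g"
  unfolding fcalc_def by (rule sum.cong) auto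

lemma fcalc_square:
  assumes s: "spectral_family h S p" and f: "\<And>t. t \<in> S \<Longrightarrow> 0 \<le> f t"
  shows "fcalc S p f = fcalc S p (\<lambda>t. sqrt (f t)) \<odot> star (fcalc S p (\<lambda>t. sqrt (f t)))"
  using fcalc_hermitian[OF s] f unfolding hermitian_def by (auto simp: fcalc_mult[OF s] intro!: fcalc_cong)

lemma fcalc_pos:
  assumes s: "spectral_family h S p" and f: "\<And>t. t \<in> S \<Longrightarrow> 0 \<le> f t"
  shows "pos (fcalc S p f)"
  using fcalc_square[OF s f] pos_square[OF fcalc_closed[OF s, of "\<lambda>t. sqrt (f t)"]] by simp

lemma pos_eigenvalue_nonneg:
  assumes x: "pos x" and w: "w \<in> A" "w \<noteq> 0" and ev: "x \<odot> w = complex_of_real t \<cdot> w"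
  shows "0 \<le> t"
proof -
  have "tr (x \<odot> (w \<odot> star w)) = t * tr (w \<odot> star w)" using x w ev by (simp flip: mult_assoc)
  moreover have "tr (x \<odot> (w \<odot> star w)) \<in> \<real>\<^sub>\<ge>\<^sub>0" using x w unfolding pos_def by blast
  ultimately show ?thesis using tr_mult_star_positive[OF w] by (simp add: nonneg_Reals_complex zero_le_mult_iff)
qed

lemma pos_sqrt:
  assumes "pos x"
  shows "\<exists>c. hermitian c \<and> x = c \<odot> c"
proof -
  obtain S p where s: "spectral_family x S p" using spectral_family_exists[OF pos_hermitian[OF assms]] by blast
  note D = spectral_familyD[OF s]
  have "0 \<le> t" if "t \<in> S" for t using pos_eigenvalue_nonneg[OF assms D(2) D(4) D(6)] that by blast
  then have "x = fcalc S p (\<lambda>t. sqrt t) \<odot> star (fcalc S p (\<lambda>t. sqrt t))"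
    using fcalc_square[OF s, of "\<lambda>t. t"] fcalc_id[OF s] by simp
  then show ?thesis using fcalc_hermitian[OF s] by (metis hermitian_def)
qed

lemma pos_iff_square: "pos x \<longleftrightarrow> (\<exists>c\<in>A. x = c \<odot> star c)"
proof
  assume "pos x"
  then obtain c where "hermitian c" "x = c \<odot> c" using pos_sqrt by blast
  then show "\<exists>c\<in>A. x = c \<odot> star c" by (intro bexI[of _ c]) (auto simp: hermitian_def simp del: hermitian_in)
qed (auto simp: pos_square)

lemma tr_mult_pos: "pos x \<Longrightarrow> pos y \<Longrightarrow> tr (x \<odot> y) \<in> \<real>\<^sub>\<ge>\<^sub>0"
  using pos_iff_square[of y] pos_def[of x] by blast

lemma pos_tr_zero:
  assumes x: "pos x" and z: "tr x = 0"
  shows "x = 0"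
proof -
  obtain c where "c \<in> A" "x = c \<odot> star c" using x pos_iff_square by blast
  moreover have "c = 0" using tr_faithful[OF calculation(1)] calculation(2) z by simp
  ultimately show ?thesis by simp
qed

lemma pos_tr_positive: "pos x \<Longrightarrow> x \<noteq> 0 \<Longrightarrow> 0 < Re (tr x)"
  using pos_tr[of x] pos_tr_zero[of x] by (fastforce simp: nonneg_Reals_complex complex_eq_iff)

lemma hermitian_bounded: assumes h: "hermitian h" shows "\<exists>C>0. pos (complex_of_real C \<cdot> one - h)"
proof -
  obtain S p where s: "spectral_family h S p" using spectral_family_exists[OF h] by blast
  \<comment> \<open>A sum of moduli plus 1 bounds the spectrum and stays positive when
    \<open>S\<close> is empty, as it is in the zero algebra.\<close>
  define C where "C = (\<Sum>t\<in>S. \<bar>t\<bar>) + 1"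
  have "t \<le> C" if "t \<in> S" for t
    using member_le_sum[of t S "\<lambda>t. \<bar>t\<bar>"] spectral_familyD(1)[OF s] that by (simp add: C_def)
  then have "pos (fcalc S p (\<lambda>t. C * 1 - t))" by (intro fcalc_pos[OF s]) auto
  then have "pos (complex_of_real C \<cdot> fcalc S p (\<lambda>t. 1) - fcalc S p (\<lambda>t. t))" unfolding fcalc_scl fcalc_diff .
  then have "pos (complex_of_real C \<cdot> one - h)" unfolding fcalc_one[OF s] fcalc_id[OF s] .
  moreover have "C > 0" unfolding C_def by (intro add_nonneg_pos sum_nonneg) auto
  ultimately show ?thesis by blast
qed

text \<open>\<open>c\<close> and \<open>d\<close> are the square root of \<open>x\<close> and its
  inverse; both occur in the conjugation by which \<open>irreducible_hermitian_eigenvector\<close>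
  compares \<open>h\<close> with \<open>y\<close>.\<close>

lemma spos_invertible:
  assumes x: "spos x"
  shows "\<exists>c d. hermitian c \<and> hermitian d \<and> c \<odot> c = x \<and> c \<odot> d = one \<and> d \<odot> c = one"
proof -
  obtain \<epsilon> where e: "\<epsilon> > 0" "pos (x - complex_of_real \<epsilon> \<cdot> one)" using x by (auto simp: spos_def)
  obtain S p where s: "spectral_family x S p" using spectral_family_exists[OF pos_hermitian[OF spos_pos[OF x]]] by blast
  note D = spectral_familyD[OF s]
  have xA: "x \<in> A" using spos_pos[OF x] by simp
  have t: "0 < t" if "t \<in> S" for t
  proof -
    have "(x - complex_of_real \<epsilon> \<cdot> one) \<odot> p t = complex_of_real (t - \<epsilon>) \<cdot> p t"
      using xA D(2)[of t] D(6)[OF that] by (simp add: mult_diff_left scale_left_diff_distrib)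
    then have "0 \<le> t - \<epsilon>" using pos_eigenvalue_nonneg[OF e(2) D(2) D(4)[OF that]] by blast
    then show ?thesis using e by simp
  qed
  let ?c = "fcalc S p (\<lambda>t. sqrt t)" and ?d = "fcalc S p (\<lambda>t. 1 / sqrt t)"
  have "?c \<odot> ?c = fcalc S p (\<lambda>t. t)" unfolding fcalc_mult[OF s] using t by (intro fcalc_cong) (simp add: less_imp_le)
  moreover have "?c \<odot> ?d = fcalc S p (\<lambda>t. 1)" "?d \<odot> ?c = fcalc S p (\<lambda>t. 1)"
    unfolding fcalc_mult[OF s] by (intro fcalc_cong; use t in force)+
  ultimately show ?thesis using fcalc_hermitian[OF s] unfolding fcalc_id[OF s] fcalc_one[OF s] by blast
qed

text \<open>\<open>q\<close> is the support projection, described by mutual domination with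
  \<open>x\<close> up to constants: inequalities, unlike spectral data, are carried along by a
  positive map.\<close>

lemma pos_support:
  assumes x: "pos x"
  shows "\<exists>q. q \<in> A \<and> star q = q \<and> q \<odot> q = q \<and> (\<exists>C>0. pos (complex_of_real C \<cdot> q - x)) \<and> (\<exists>C>0. pos (complex_of_real C \<cdot> x - q))
     \<and> (q = 0 \<longrightarrow> x = 0) \<and> (q = one \<longrightarrow> spos x)"
proof -
  obtain S p where s: "spectral_family x S p" using spectral_family_exists[OF pos_hermitian[OF x]] by blast
  note D = spectral_familyD[OF s]
  have nn: "0 \<le> t" if "t \<in> S" for t using pos_eigenvalue_nonneg[OF x D(2) D(4) D(6)] that by blast
  define g :: "real \<Rightarrow> real" where "g t = (if 0 < t then 1 else 0)" for t
  define C where "C = (\<Sum>t\<in>S. t) + 1"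
  \<comment> \<open>Bounds the inverses of the nonzero spectral values; for t = 0 the summand is 0
    by convention.\<close>
  define C' where "C' = (\<Sum>t\<in>S. 1 / t) + 1"
  have C: "t \<le> C" if "t \<in> S" for t
    using member_le_sum[of t S "\<lambda>t. t"] D(1) that nn by (simp add: C_def)
  have C': "1 / t \<le> C'" if "t \<in> S" for t
    using member_le_sum[of t S "\<lambda>t. 1 / t"] D(1) that nn by (simp add: C'_def)
  have C0: "C > 0" "C' > 0" unfolding C_def C'_def using nn by (intro add_nonneg_pos sum_nonneg; force)+
  let ?q = "fcalc S p g"
  have q: "?q \<in> A" "star ?q = ?q" using fcalc_hermitian[OF s, of g] unfolding hermitian_def by auto
  have qq: "?q \<odot> ?q = ?q" unfolding fcalc_mult[OF s] by (intro fcalc_cong) (simp add: g_def)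
  have "pos (fcalc S p (\<lambda>t. C * g t - t))" using C nn C0 by (intro fcalc_pos[OF s]) (auto simp: g_def less_le)
  then have 1: "pos (complex_of_real C \<cdot> ?q - x)" unfolding fcalc_diff[symmetric] fcalc_scl[symmetric] fcalc_id[OF s] .
  have "pos (fcalc S p (\<lambda>t. C' * t - g t))"
  proof (intro fcalc_pos[OF s])
    fix t assume t: "t \<in> S"
    show "0 \<le> C' * t - g t"
    proof (cases "0 < t")
      case True
      then have "1 \<le> C' * t" using C'[OF t] by (simp add: field_simps)
      then show ?thesis using True by (simp add: g_def)
    qed (use nn[OF t] in \<open>auto simp: g_def\<close>)
  qed
  moreover have "fcalc S p (\<lambda>t. C' * t - g t) = complex_of_real C' \<cdot> fcalc S p (\<lambda>t. t) - fcalc S p g"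
    by (simp add: fcalc_diff fcalc_scl)
  ultimately have 2: "pos (complex_of_real C' \<cdot> x - ?q)" unfolding fcalc_id[OF s] by simp
  have 3: "x = 0" if "?q = 0"
  proof -
    have "t = 0" if t: "t \<in> S" for t
    proof -
      have "complex_of_real (g t) \<cdot> p t = 0" using fcalc_mult_p[OF s t, of g] \<open>?q = 0\<close> D(2) by simp
      then have "g t = 0" using D(4)[OF t] by simp
      then show "t = 0" using nn[OF t] by (simp add: g_def split: if_splits)
    qed
    then show "x = 0" using D(8) by (simp add: sum.neutral)
  qed
  have 4: "spos x" if "?q = one"
    unfolding spos_def
  proof (intro exI[of _ "1 / C'"] conjI)
    have "pos (complex_of_real (1 / C') \<cdot> (complex_of_real C' \<cdot> x - one))"
      using 2 C0 that by (intro pos_scl) auto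
    then show "pos (x - complex_of_real (1 / C') \<cdot> one)" using C0 by (simp add: scale_right_diff_distrib)
  qed (use C0 in simp)
  show ?thesis using q qq 1 2 3 4 C0 by blast
qed

lemma pos_invertible_spos:
  assumes x: "pos x" and z: "z \<in> A" "x \<odot> z = one" "z \<odot> x = one"
  shows "spos x"
proof -
  obtain S p where s: "spectral_family x S p" using spectral_family_exists[OF pos_hermitian[OF x]] by blast
  note D = spectral_familyD[OF s]
  have xA: "x \<in> A" using x by simp
  have t: "0 < t" if t: "t \<in> S" for t
  proof -
    have "0 \<le> t" using pos_eigenvalue_nonneg[OF x D(2) D(4) D(6)] t by blast
    moreover have "t \<noteq> 0"
    proof
      assume "t = 0"
      then have "x \<odot> p t = 0" using D(6)[OF t] by simp
      then have "z \<odot> x \<odot> p t = 0" using xA z(1) D(2) by (simp add: mult_assoc)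
      then show False using z D(2,4) t by simp
    qed
    ultimately show ?thesis by simp
  qed
  \<comment> \<open>Inserting 1 keeps the minimum defined and positive if \<open>S\<close> is
    empty.\<close>
  define \<epsilon> where "\<epsilon> = Min (insert 1 S)"
  have e: "\<epsilon> > 0" "\<And>t. t \<in> S \<Longrightarrow> \<epsilon> \<le> t" using D(1) t by (auto simp: \<epsilon>_def)
  have "pos (fcalc S p (\<lambda>t. t - \<epsilon> * 1))" using e by (intro fcalc_pos[OF s]) auto
  then have "pos (x - complex_of_real \<epsilon> \<cdot> one)"
    unfolding fcalc_diff[symmetric] fcalc_scl[symmetric] fcalc_id[OF s] fcalc_one[OF s] .
  then show ?thesis using e unfolding spos_def by blast
qed

lemma hermitian_parts:
  assumes x: "x \<in> A"
  shows "hermitian ((1 / 2) \<cdot> (x + star x))" "hermitian ((- \<i> / 2) \<cdot> (x - star x))"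
    "x = (1 / 2) \<cdot> (x + star x) + \<i> \<cdot> ((- \<i> / 2) \<cdot> (x - star x))"
proof -
  have "star ((1 / 2) \<cdot> (x + star x)) = (1 / 2) \<cdot> (x + star x)"
    using x by (simp add: star_add add.commute)
  then show "hermitian ((1 / 2) \<cdot> (x + star x))" using x by (simp add: hermitian_def del: hermitian_in)
  have "star ((- \<i> / 2) \<cdot> (x - star x)) = (\<i> / 2) \<cdot> (star x - x)"
    using x by (simp add: star_diff star_uminus scale_right_diff_distrib)
  also have "\<dots> = (- \<i> / 2) \<cdot> (x - star x)"
    by (metis minus_diff_eq minus_divide_left scale_minus_left scale_minus_right)
  finally show "hermitian ((- \<i> / 2) \<cdot> (x - star x))" using x by (simp add: hermitian_def del: hermitian_in)
  have "(1 / 2) \<cdot> (x + star x) + \<i> \<cdot> ((- \<i> / 2) \<cdot> (x - star x)) = (1 / 2) \<cdot> ((x + star x) + (x - star x))"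
  proof -
    have "\<i> * (- \<i> / 2) = 1 / 2" by simp
    then show ?thesis by (simp only: scale_scale scale_right_distrib)
  qed
  also have "(x + star x) + (x - star x) = x + x" by simp
  also have "(1 / 2) \<cdot> (x + x) = (1 / 2) \<cdot> x + (1 / 2) \<cdot> x" by (rule scale_right_distrib)
  also have "\<dots> = x" using scale_left_distrib[of "1 / 2" "1 / 2" x] by simp
  finally show "x = (1 / 2) \<cdot> (x + star x) + \<i> \<cdot> ((- \<i> / 2) \<cdot> (x - star x))" by simp
qed

end

context tracial_star_algebra
begin

lemma spos_inverse:
  assumes "spos y"
  shows "\<exists>z\<in>A. y \<odot> z = one \<and> z \<odot> y = one"
proof -
  obtain c d where cd: "hermitian c" "hermitian d" "c \<odot> c = y" "c \<odot> d = one" "d \<odot> c = one"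
    using spos_invertible[OF assms] by blast
  have A: "c \<in> A" "d \<in> A" using cd by auto
  have "y \<odot> (d \<odot> d) = c \<odot> ((c \<odot> d) \<odot> d)" unfolding cd(3)[symmetric] using A by (simp add: mult_assoc)
  then have 1: "y \<odot> (d \<odot> d) = one" using A cd by simp
  have "(d \<odot> d) \<odot> y = d \<odot> ((d \<odot> c) \<odot> c)" unfolding cd(3)[symmetric] using A by (simp add: mult_assoc)
  then have "(d \<odot> d) \<odot> y = one" using A cd by simp
  with 1 show ?thesis using A by (intro bexI[of _ "d \<odot> d"]) auto
qed

end

section \<open>Compactness of the set of states\<close>

lemma finite_convergent_subsequence:
  fixes f :: "nat \<Rightarrow> 'b \<Rightarrow> complex"
  assumes "finite E" "\<And>b. b \<in> E \<Longrightarrow> bounded (range (\<lambda>n. f n b))"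
  shows "\<exists>r. strict_mono r \<and> (\<forall>b\<in>E. convergent (\<lambda>n. f (r n) b))"
  using assms
proof (induction E)
  case empty
  show ?case by (rule exI[of _ id]) (simp add: strict_mono_def)
next
  case (insert a E)
  then obtain r where r: "strict_mono r" "\<And>b. b \<in> E \<Longrightarrow> convergent (\<lambda>n. f (r n) b)" by auto
  have "bounded (range (\<lambda>n. f (r n) a))"
    using insert.prems[of a] by (rule bounded_subset) auto
  then obtain l r' where r': "strict_mono r'" "((\<lambda>n. f (r n) a) \<circ> r') \<longlonglongrightarrow> l"
    using bounded_imp_convergent_subsequence by blast
  have "convergent (\<lambda>n. f ((r \<circ> r') n) b)" if "b \<in> insert a E" for b
  proof (cases "b = a")
    case True
    then show ?thesis using r'(2) by (auto simp: convergent_def o_def)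
  next
    case False
    then show ?thesis using convergent_subseq_convergent[OF r(2) r'(1)] that by (simp add: o_def)
  qed
  then show ?case using strict_mono_o[OF r(1) r'(1)] by blast
qed

context tracial_star_algebra
begin

text \<open>A square is dominated by a multiple of \<open>one\<close>, so its pairing with a
  positive \<open>y\<close> lies between 0 and that multiple of \<open>tr y\<close>; polarization
  extends this to general \<open>b\<close>.\<close>

lemma tr_bound:
  assumes b: "b \<in> A"
  shows "\<exists>C\<ge>0. \<forall>y. pos y \<longrightarrow> cmod (tr (y \<odot> b)) \<le> C * Re (tr y)"
proof -
  have sq: "\<exists>C\<ge>0. \<forall>y. pos y \<longrightarrow> cmod (tr (y \<odot> (d \<odot> star d))) \<le> C * Re (tr y)" if d: "d \<in> A" for d
  proof -
    have s: "pos (d \<odot> star d)" using d by (rule pos_square)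
    obtain C where C: "C > 0" "pos (complex_of_real C \<cdot> one - d \<odot> star d)"
      using hermitian_bounded[OF pos_hermitian[OF s]] by blast
    have "cmod (tr (y \<odot> (d \<odot> star d))) \<le> C * Re (tr y)" if y: "pos y" for y
    proof -
      have yA: "y \<in> A" using y by simp
      have "tr (y \<odot> (d \<odot> star d)) \<in> \<real>\<^sub>\<ge>\<^sub>0" by (rule tr_mult_pos[OF y s])
      then have "tr (y \<odot> (d \<odot> star d)) = complex_of_real (Re (tr (y \<odot> (d \<odot> star d))))" "0 \<le> Re (tr (y \<odot> (d \<odot> star d)))"
        by (simp_all add: nonneg_Reals_complex complex_eq_iff)
      then have "cmod (tr (y \<odot> (d \<odot> star d))) = Re (tr (y \<odot> (d \<odot> star d)))" by (metis norm_of_real abs_of_nonneg)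
      moreover have "tr (y \<odot> (complex_of_real C \<cdot> one - d \<odot> star d)) \<in> \<real>\<^sub>\<ge>\<^sub>0" by (rule tr_mult_pos[OF y C(2)])
      ultimately show ?thesis using yA d by (simp add: mult_diff_right tr_diff nonneg_Reals_complex)
    qed
    then show ?thesis using C(1) by (intro exI[of _ C]) auto
  qed
  obtain C1 where C1: "C1 \<ge> 0" "\<And>y. pos y \<Longrightarrow> cmod (tr (y \<odot> ((b + one) \<odot> star (b + one)))) \<le> C1 * Re (tr y)"
    using sq[of "b + one"] b by auto
  obtain C2 where C2: "C2 \<ge> 0" "\<And>y. pos y \<Longrightarrow> cmod (tr (y \<odot> ((b - one) \<odot> star (b - one)))) \<le> C2 * Re (tr y)"
    using sq[of "b - one"] b by auto
  obtain C3 where C3: "C3 \<ge> 0" "\<And>y. pos y \<Longrightarrow> cmod (tr (y \<odot> ((b + \<i> \<cdot> one) \<odot> star (b + \<i> \<cdot> one)))) \<le> C3 * Re (tr y)"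
    using sq[of "b + \<i> \<cdot> one"] b by auto
  obtain C4 where C4: "C4 \<ge> 0" "\<And>y. pos y \<Longrightarrow> cmod (tr (y \<odot> ((b - \<i> \<cdot> one) \<odot> star (b - \<i> \<cdot> one)))) \<le> C4 * Re (tr y)"
    using sq[of "b - \<i> \<cdot> one"] b by auto
  have "cmod (tr (y \<odot> b)) \<le> (C1 + C2 + C3 + C4) * Re (tr y)" if y: "pos y" for y
  proof -
    have yA: "y \<in> A" using y by simp
    let ?s1 = "(b + one) \<odot> star (b + one)" and ?s2 = "(b - one) \<odot> star (b - one)"
      and ?s3 = "(b + \<i> \<cdot> one) \<odot> star (b + \<i> \<cdot> one)" and ?s4 = "(b - \<i> \<cdot> one) \<odot> star (b - \<i> \<cdot> one)"
    have s: "?s1 \<in> A" "?s2 \<in> A" "?s3 \<in> A" "?s4 \<in> A" using b by auto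
    have "4 * tr (y \<odot> b) = tr (y \<odot> (4 \<cdot> b))" using yA b by simp
    also have "y \<odot> (4 \<cdot> b) = y \<odot> ?s1 - y \<odot> ?s2 + \<i> \<cdot> (y \<odot> ?s3) - \<i> \<cdot> (y \<odot> ?s4)"
      unfolding polarization[OF b] using yA s by (simp only: mult_add_right mult_diff_right mult_scl_right A_add A_diff A_scl)
    also have "tr \<dots> = tr (y \<odot> ?s1) - tr (y \<odot> ?s2) + \<i> * tr (y \<odot> ?s3) - \<i> * tr (y \<odot> ?s4)"
      using yA s by (simp only: tr_add tr_diff tr_scl A_add A_diff A_scl mult_closed)
    finally have "4 * cmod (tr (y \<odot> b)) = cmod (tr (y \<odot> ?s1) - tr (y \<odot> ?s2) + \<i> * tr (y \<odot> ?s3) - \<i> * tr (y \<odot> ?s4))"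
      by (metis norm_mult norm_numeral)
    also have "\<dots> \<le> cmod (tr (y \<odot> ?s1)) + cmod (tr (y \<odot> ?s2)) + cmod (\<i> * tr (y \<odot> ?s3)) + cmod (\<i> * tr (y \<odot> ?s4))"
      by (intro order_trans[OF norm_triangle_ineq4] order_trans[OF norm_triangle_ineq] add_mono order_refl)
    also have "\<dots> \<le> C1 * Re (tr y) + C2 * Re (tr y) + C3 * Re (tr y) + C4 * Re (tr y)"
      using C1(2)[OF y] C2(2)[OF y] C3(2)[OF y] C4(2)[OF y] by (simp add: norm_mult)
    finally have "4 * cmod (tr (y \<odot> b)) \<le> (C1 + C2 + C3 + C4) * Re (tr y)" by (simp add: algebra_simps)
    \<comment> \<open>The factor 4 from polarization is simply given away.\<close>
    then show ?thesis using norm_ge_zero[of "tr (y \<odot> b)"] by linarith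
  qed
  then show ?thesis using C1(1) C2(1) C3(1) C4(1) by (intro exI[of _ "C1 + C2 + C3 + C4"]) auto
qed

lemma trace_basis: "\<exists>E. finite E \<and> E \<subseteq> A \<and> (\<forall>x\<in>A. x = (\<Sum>b\<in>E. tr (x \<odot> star b) \<cdot> b))"
proof -
  obtain B where B: "finite B" "A = span B" using A_finite_dim by blast
  show ?thesis using orthonormal_basis_exists[OF trace_inner_product A_subspace B] by blast
qed

text \<open>In trace coordinates \<open>\<psi> y\<close> is a combination of the pairings
  \<open>tr (y \<odot> star b)\<close>, each dominated by the trace.\<close>

lemma functional_bound:
  assumes l: "linear_on A \<psi>"
  shows "\<exists>C\<ge>0. \<forall>y. pos y \<longrightarrow> cmod (\<psi> y) \<le> C * Re (tr y)"
proof -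
  obtain E where E: "finite E" "E \<subseteq> A" "\<And>x. x \<in> A \<Longrightarrow> x = (\<Sum>b\<in>E. tr (x \<odot> star b) \<cdot> b)"
    using trace_basis by blast
  have "\<forall>b\<in>E. \<exists>C\<ge>0. \<forall>y. pos y \<longrightarrow> cmod (tr (y \<odot> star b)) \<le> C * Re (tr y)" using E(2) tr_bound by auto
  then obtain C where C: "\<And>b. b \<in> E \<Longrightarrow> C b \<ge> 0" "\<And>b y. b \<in> E \<Longrightarrow> pos y \<Longrightarrow> cmod (tr (y \<odot> star b)) \<le> C b * Re (tr y)"
    by metis
  have "cmod (\<psi> y) \<le> (\<Sum>b\<in>E. C b * cmod (\<psi> b)) * Re (tr y)" if y: "pos y" for y
  proof -
    have "\<psi> y = \<psi> (\<Sum>b\<in>E. tr (y \<odot> star b) \<cdot> b)" using E(3)[of y] y by simp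
    also have "\<dots> = (\<Sum>b\<in>E. tr (y \<odot> star b) * \<psi> b)" by (rule linear_on_sum[OF A_subspace l]) (use E(2) in auto)
    also have "cmod \<dots> \<le> (\<Sum>b\<in>E. C b * Re (tr y) * cmod (\<psi> b))"
      by (rule order_trans[OF norm_sum sum_mono]) (use C(2) y in \<open>auto simp: norm_mult intro!: mult_right_mono\<close>)
    finally show ?thesis by (simp add: sum_distrib_left sum_distrib_right mult_ac)
  qed
  moreover have "0 \<le> (\<Sum>b\<in>E. C b * cmod (\<psi> b))" using C(1) by (intro sum_nonneg) auto
  ultimately show ?thesis by blast
qed

lemma linear_on_tr_mult: "b \<in> A \<Longrightarrow> linear_on A (\<lambda>y. tr (y \<odot> b))"
  by (simp add: linear_on_def mult_add_left tr_add)

text \<open>The algebra carries no topology, so convergence is stated through all linear functionals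
  and the limit is assembled from limits of coordinates. It is positive because \<open>pos\<close>
  is defined by closed conditions.\<close>

lemma states_compact:
  assumes y: "\<And>n::nat. pos (y n)" "\<And>n. tr (y n) = 1"
  shows "\<exists>r y'. strict_mono r \<and> pos y' \<and> tr y' = 1 \<and> (\<forall>\<psi>. linear_on A \<psi> \<longrightarrow> (\<lambda>n. \<psi> (y (r n))) \<longlonglongrightarrow> \<psi> y')"
proof -
  obtain E where E: "finite E" "E \<subseteq> A" "\<And>x. x \<in> A \<Longrightarrow> x = (\<Sum>b\<in>E. tr (x \<odot> star b) \<cdot> b)"
    using trace_basis by blast
  have "bounded (range (\<lambda>n. tr (y n \<odot> star b)))" if b: "b \<in> E" for b
  proof -
    have "star b \<in> A" using b E(2) by auto
    then obtain C where "\<And>y. pos y \<Longrightarrow> cmod (tr (y \<odot> star b)) \<le> C * Re (tr y)"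
      using tr_bound by blast
    then have "cmod (tr (y n \<odot> star b)) \<le> C" for n using y[of n] by (metis mult.right_neutral one_complex.simps(1))
    then show ?thesis by (auto simp: bounded_iff)
  qed
  then obtain r where r: "strict_mono r" "\<forall>b\<in>E. convergent (\<lambda>n. tr (y (r n) \<odot> star b))"
    using finite_convergent_subsequence[OF E(1), of "\<lambda>n b. tr (y n \<odot> star b)"] by blast
  then obtain l where l: "\<And>b. b \<in> E \<Longrightarrow> (\<lambda>n. tr (y (r n) \<odot> star b)) \<longlonglongrightarrow> l b"
    unfolding convergent_def by metis
  define y' where "y' = (\<Sum>b\<in>E. l b \<cdot> b)"
  have y'A: "y' \<in> A" unfolding y'_def using E(2) by (intro A_sum) auto
  have lim: "(\<lambda>n. \<psi> (y (r n))) \<longlonglongrightarrow> \<psi> y'" if \<psi>: "linear_on A \<psi>" for \<psi>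
  proof -
    have 1: "\<psi> (y (r n)) = (\<Sum>b\<in>E. tr (y (r n) \<odot> star b) * \<psi> b)" for n
    proof -
      have "\<psi> (y (r n)) = \<psi> (\<Sum>b\<in>E. tr (y (r n) \<odot> star b) \<cdot> b)" using E(3)[of "y (r n)"] y(1)[of "r n"] by simp
      also have "\<dots> = (\<Sum>b\<in>E. tr (y (r n) \<odot> star b) * \<psi> b)" by (rule linear_on_sum[OF A_subspace \<psi>]) (use E(2) in auto)
      finally show ?thesis .
    qed
    have 2: "\<psi> y' = (\<Sum>b\<in>E. l b * \<psi> b)"
      unfolding y'_def by (rule linear_on_sum[OF A_subspace \<psi>]) (use E(2) in auto)
    show ?thesis unfolding 1 2 by (intro tendsto_sum tendsto_mult_right l)
  qed
  have "tr (y' \<odot> (d \<odot> star d)) \<in> \<real>\<^sub>\<ge>\<^sub>0" if d: "d \<in> A" for d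
  proof -
    have "(\<lambda>n. tr (y (r n) \<odot> (d \<odot> star d))) \<longlonglongrightarrow> tr (y' \<odot> (d \<odot> star d))"
      using d by (intro lim linear_on_tr_mult) auto
    note lim1 = this
    have mem: "\<forall>n. tr (y (r n) \<odot> (d \<odot> star d)) \<in> \<real>\<^sub>\<ge>\<^sub>0" using y(1) d unfolding pos_def by blast
    show ?thesis by (rule closed_sequentially[OF closed_nonneg_Reals_complex spec[OF mem] lim1])
  qed
  then have "pos y'" using y'A unfolding pos_def by blast
  moreover have "tr y' = 1" using lim[OF tr_linear] unfolding y(2) by (simp add: LIMSEQ_const_iff)
  ultimately show ?thesis using r(1) lim by blast
qed

section \<open>Perron-Frobenius theory of positive maps\<close>

definition positive_map :: "('a \<Rightarrow> 'a) \<Rightarrow> bool" where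
  "positive_map T \<longleftrightarrow> (\<forall>x\<in>A. T x \<in> A) \<and> (\<forall>x\<in>A. \<forall>y\<in>A. T (x + y) = T x + T y) \<and>
     (\<forall>x\<in>A. \<forall>c. T (c \<cdot> x) = c \<cdot> T x) \<and> (\<forall>x. pos x \<longrightarrow> pos (T x))"

lemma positive_mapD:
  assumes "positive_map T"
  shows "x \<in> A \<Longrightarrow> T x \<in> A" "x \<in> A \<Longrightarrow> y \<in> A \<Longrightarrow> T (x + y) = T x + T y"
    "x \<in> A \<Longrightarrow> T (c \<cdot> x) = c \<cdot> T x" "pos x \<Longrightarrow> pos (T x)"
    "x \<in> A \<Longrightarrow> y \<in> A \<Longrightarrow> T (x - y) = T x - T y" "T 0 = 0"
proof -
  have *: "\<And>x. x \<in> A \<Longrightarrow> T x \<in> A" "\<And>x y. x \<in> A \<Longrightarrow> y \<in> A \<Longrightarrow> T (x + y) = T x + T y"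
    "\<And>x c. x \<in> A \<Longrightarrow> T (c \<cdot> x) = c \<cdot> T x" "\<And>x. pos x \<Longrightarrow> pos (T x)"
    using assms unfolding positive_map_def by blast+
  show "x \<in> A \<Longrightarrow> T x \<in> A" "x \<in> A \<Longrightarrow> y \<in> A \<Longrightarrow> T (x + y) = T x + T y"
    "x \<in> A \<Longrightarrow> T (c \<cdot> x) = c \<cdot> T x" "pos x \<Longrightarrow> pos (T x)" by (fact *)+
  show "T (x - y) = T x - T y" if "x \<in> A" "y \<in> A"
  proof -
    have "T x = T ((x - y) + y)" by simp
    also have "\<dots> = T (x - y) + T y" using that by (intro *) auto
    finally show ?thesis by simp
  qed
  show "T 0 = 0" using *(3)[of 0 0] by simp
qed

lemma linear_on_compose: "positive_map T \<Longrightarrow> linear_on A \<psi> \<Longrightarrow> linear_on A (\<lambda>x. \<psi> (T x))"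
  using positive_mapD[of T] by (simp add: linear_on_def)

text \<open>
  Collatz--Wielandt: the eigenvalue is the largest \<open>s\<close> with \<open>T y \<ge> s \<cdot> y\<close> for some state \<open>y\<close>.
  Were the inequality strict for the maximal \<open>s\<close>, then the normalised \<open>T y\<close> would admit a larger value.
\<close>

lemma strictly_positive_map_eigenvector:
  assumes T: "positive_map T" and strict: "\<And>x. pos x \<Longrightarrow> x \<noteq> 0 \<Longrightarrow> spos (T x)" and nontriv: "one \<noteq> 0"
  shows "\<exists>y t. pos y \<and> tr y = 1 \<and> T y = complex_of_real t \<cdot> y"
proof -
  note D = positive_mapD[OF T]
  define R where "R = {t. \<exists>y. pos y \<and> tr y = 1 \<and> pos (T y - complex_of_real t \<cdot> y)}"
  have real_tr_mult: "complex_of_real c * tr y = complex_of_real (c * Re (tr y))" if "pos y" for c y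
    using pos_tr[OF that] by (simp add: nonneg_Reals_complex complex_eq_iff)
  have normalize: "\<exists>c>0. pos (complex_of_real c \<cdot> y) \<and> tr (complex_of_real c \<cdot> y) = 1" if y: "pos y" "y \<noteq> 0" for y
  proof (intro exI[of _ "1 / Re (tr y)"] conjI)
    have p: "Re (tr y) > 0" by (rule pos_tr_positive[OF y])
    then show "1 / Re (tr y) > 0" by simp
    show "pos (complex_of_real (1 / Re (tr y)) \<cdot> y)" using p y by (intro pos_scl) auto
    have "tr (complex_of_real (1 / Re (tr y)) \<cdot> y) = complex_of_real (1 / Re (tr y)) * tr y" using y by (simp del: of_real_divide)
    also have "\<dots> = 1" unfolding real_tr_mult[OF y(1)] using p by simp
    finally show "tr (complex_of_real (1 / Re (tr y)) \<cdot> y) = 1" .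
  qed
  obtain c0 where c0: "c0 > 0" "pos (complex_of_real c0 \<cdot> one)" "tr (complex_of_real c0 \<cdot> one) = 1"
    using normalize[OF pos_one nontriv] by blast
  then have "0 \<in> R" unfolding R_def using D(4) by (auto intro!: exI[of _ "complex_of_real c0 \<cdot> one"])
  obtain C where C: "\<And>y. pos y \<Longrightarrow> cmod (tr (T y)) \<le> C * Re (tr y)"
    using functional_bound[OF linear_on_compose[OF T tr_linear]] by blast
  have R_le: "t \<le> C" if t: "t \<in> R" for t
  proof -
    obtain y where y: "pos y" "tr y = 1" "pos (T y - complex_of_real t \<cdot> y)" using t by (auto simp: R_def)
    have yA: "y \<in> A" using y by simp
    have "0 \<le> Re (tr (T y - complex_of_real t \<cdot> y))" using pos_tr[OF y(3)] by (simp add: nonneg_Reals_complex)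
    also have "\<dots> = Re (tr (T y)) - t" using yA D(1) y(2) by (simp add: tr_diff)
    finally show ?thesis using C[OF y(1)] y(2) complex_Re_le_cmod[of "tr (T y)"] by simp
  qed
  have bdd: "bdd_above R" using R_le by (auto simp: bdd_above_def)
  define s where "s = Sup R"
  have "\<exists>t\<in>R. s - 1 / Suc n < t" for n
    unfolding s_def using less_cSupE[of "s - 1 / Suc n" R] \<open>0 \<in> R\<close> by (auto simp: s_def)
  then obtain t where t: "\<And>n. t n \<in> R" "\<And>n. s - 1 / Suc n < t n" by metis
  have ts: "t n \<le> s" for n unfolding s_def by (rule cSup_upper[OF t(1) bdd])
  have tlim: "t \<longlonglongrightarrow> s"
  proof (rule tendsto_sandwich)
    show "\<forall>\<^sub>F n in sequentially. s - 1 / Suc n \<le> t n"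
      by (intro always_eventually allI less_imp_le t(2))
    show "(\<lambda>n. s - 1 / Suc n) \<longlonglongrightarrow> s" using tendsto_diff[OF tendsto_const LIMSEQ_inverse_real_of_nat, of s]
      by (simp add: inverse_eq_divide)
  qed (use ts in auto)
  obtain y where y: "\<And>n. pos (y n)" "\<And>n. tr (y n) = 1" "\<And>n. pos (T (y n) - complex_of_real (t n) \<cdot> y n)"
    using t(1) unfolding R_def by (simp add: choice_iff) metis
  obtain r y' where r: "strict_mono r" "pos y'" "tr y' = 1"
    "\<And>\<psi>. linear_on A \<psi> \<Longrightarrow> (\<lambda>n. \<psi> (y (r n))) \<longlonglongrightarrow> \<psi> y'" using states_compact[of y, OF y(1,2)] by blast
  have y'A: "y' \<in> A" using r by simp
  let ?w = "T y' - complex_of_real s \<cdot> y'"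
  have wpos: "pos ?w"
    unfolding pos_def
  proof (intro conjI ballI)
    show "?w \<in> A" using y'A D(1) by simp
    fix d assume d: "d \<in> A"
    let ?\<psi> = "\<lambda>x. tr (x \<odot> (d \<odot> star d))"
    have lin: "linear_on A ?\<psi>" using d by (intro linear_on_tr_mult) auto
    have expand: "?\<psi> (T x - complex_of_real u \<cdot> x) = ?\<psi> (T x) - u * ?\<psi> x" if "x \<in> A" for x u
      using that d D(1) by (simp add: mult_diff_left tr_diff)
    have "(\<lambda>n. ?\<psi> (T (y (r n))) - t (r n) * ?\<psi> (y (r n))) \<longlonglongrightarrow> ?\<psi> (T y') - s * ?\<psi> y'"
      using r(4)[OF linear_on_compose[OF T lin]] r(4)[OF lin] LIMSEQ_subseq_LIMSEQ[OF tlim r(1)]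
      by (intro tendsto_diff tendsto_mult tendsto_of_real) (auto simp: o_def)
    note lim1 = this
    have mem: "\<forall>n. ?\<psi> (T (y (r n))) - t (r n) * ?\<psi> (y (r n)) \<in> \<real>\<^sub>\<ge>\<^sub>0"
    proof
      fix n
      have "?\<psi> (T (y (r n)) - complex_of_real (t (r n)) \<cdot> y (r n)) \<in> \<real>\<^sub>\<ge>\<^sub>0"
        using y(3)[of "r n"] d unfolding pos_def by blast
      then show "?\<psi> (T (y (r n))) - t (r n) * ?\<psi> (y (r n)) \<in> \<real>\<^sub>\<ge>\<^sub>0"
        unfolding expand[OF pos_in[OF y(1)]] .
    qed
    have "?\<psi> (T y') - s * ?\<psi> y' \<in> \<real>\<^sub>\<ge>\<^sub>0"
      by (rule closed_sequentially[OF closed_nonneg_Reals_complex spec[OF mem] lim1])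
    then show "?\<psi> ?w \<in> \<real>\<^sub>\<ge>\<^sub>0" unfolding expand[OF y'A] .
  qed
  have "?w = 0"
  proof (rule ccontr)
    assume "?w \<noteq> 0"
    then have "spos (T ?w)" using strict wpos by blast
    then obtain \<epsilon> where e: "\<epsilon> > 0" "pos (T ?w - complex_of_real \<epsilon> \<cdot> one)" by (auto simp: spos_def)
    let ?z = "T y'"
    have z: "?z \<in> A" "pos ?z" using y'A D(1,4) r(2) by auto
    \<comment> \<open>If \<open>T y'\<close> vanished, then \<open>s\<close> would be at most 0,
      hence equal to 0 because 0 lies in \<open>R\<close>, and \<open>?w\<close> would vanish
      too.\<close>
    have z0: "?z \<noteq> 0"
    proof
      assume "?z = 0"
      then have "pos (- complex_of_real s \<cdot> y')" using wpos by (simp add: scale_minus_left)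
      then have "- s \<ge> 0" using pos_tr[of "- complex_of_real s \<cdot> y'"] y'A r(3)
        tr_scl[OF y'A, of "- complex_of_real s"] by (simp add: nonneg_Reals_complex)
      moreover have "s \<ge> 0" unfolding s_def by (rule cSup_upper[OF \<open>0 \<in> R\<close> bdd])
      ultimately have "?w = 0" using \<open>?z = 0\<close> by simp
      then show False using \<open>?w \<noteq> 0\<close> by simp
    qed
    \<comment> \<open>As \<open>?z\<close> is at most \<open>K\<close> times \<open>one\<close>, the
      gap \<open>\<epsilon>\<close> in \<open>T ?w\<close> is worth an additional
      \<open>\<epsilon> / K\<close> in front of \<open>?z\<close>; the state proportional to
      \<open>?z\<close> then beats \<open>s\<close>.\<close>
    obtain K where K: "K > 0" "pos (complex_of_real K \<cdot> one - ?z)" using hermitian_bounded[OF pos_hermitian[OF z(2)]] by blast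
    have Tw: "T ?w = T ?z - complex_of_real s \<cdot> ?z" using y'A z D by simp
    have "pos ((T ?w - complex_of_real \<epsilon> \<cdot> one) + complex_of_real (\<epsilon> / K) \<cdot> (complex_of_real K \<cdot> one - ?z))"
      using e K by (intro pos_add pos_scl) auto
    also have "(T ?w - complex_of_real \<epsilon> \<cdot> one) + complex_of_real (\<epsilon> / K) \<cdot> (complex_of_real K \<cdot> one - ?z)
        = T ?z - complex_of_real (s + \<epsilon> / K) \<cdot> ?z"
      unfolding Tw using K(1) by (simp add: scale_right_diff_distrib scale_left_distrib)
    finally have p: "pos (T ?z - complex_of_real (s + \<epsilon> / K) \<cdot> ?z)" .
    obtain c where c: "c > 0" "pos (complex_of_real c \<cdot> ?z)" "tr (complex_of_real c \<cdot> ?z) = 1"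
      using normalize[OF z(2) z0] by blast
    have "pos (complex_of_real c \<cdot> (T ?z - complex_of_real (s + \<epsilon> / K) \<cdot> ?z))" using p c(1) by (intro pos_scl) auto
    also have "complex_of_real c \<cdot> (T ?z - complex_of_real (s + \<epsilon> / K) \<cdot> ?z)
      = T (complex_of_real c \<cdot> ?z) - complex_of_real (s + \<epsilon> / K) \<cdot> (complex_of_real c \<cdot> ?z)"
      using z D(3) by (simp add: scale_right_diff_distrib scale_left_commute del: of_real_add)
    finally have "s + \<epsilon> / K \<in> R" unfolding R_def using c(2,3) by blast
    then have "s + \<epsilon> / K \<le> s" unfolding s_def by (rule cSup_upper[OF _ bdd])
    then show False using e K by (simp add: field_simps)
  qed
  then have "T y' = complex_of_real s \<cdot> y'" by simp
  then show ?thesis using r(2,3) by blast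
qed

text \<open>
  The maps \<open>T + \<epsilon> tr(-) one\<close> are strictly positive; let \<open>\<epsilon>\<close> tend to 0.
\<close>

lemma positive_map_eigenvector:
  assumes T: "positive_map T" and nontriv: "one \<noteq> 0"
  shows "\<exists>y t. pos y \<and> tr y = 1 \<and> T y = complex_of_real t \<cdot> y"
proof -
  note D = positive_mapD[OF T]
  define e where "e n = 1 / real (Suc n)" for n
  define T' where "T' n x = T x + (complex_of_real (e n) * tr x) \<cdot> one" for n x
  have e: "e n > 0" for n by (simp add: e_def)
  have real_tr: "tr y = complex_of_real (Re (tr y))" "0 \<le> Re (tr y)" if "pos y" for y
    using pos_tr[OF that] by (simp_all add: nonneg_Reals_complex complex_eq_iff)
  have real_tr_mult: "complex_of_real c * tr y = complex_of_real (c * Re (tr y))" if "pos y" for c y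
    using pos_tr[OF that] by (simp add: nonneg_Reals_complex complex_eq_iff)
  have T'pos: "pos (T' n x)" if x: "pos x" for n x
  proof -
    have "T' n x = T x + complex_of_real (e n * Re (tr x)) \<cdot> one" unfolding T'_def real_tr_mult[OF x] ..
    then show ?thesis
      using pos_add[OF D(4)[OF x] pos_scl[OF pos_one, of "e n * Re (tr x)"]] e[of n] real_tr(2)[OF x] by simp
  qed
  have T'map: "positive_map (T' n)" for n
    unfolding positive_map_def using D(1-3) T'pos
    by (auto simp: T'_def tr_add scale_right_distrib scale_left_distrib distrib_left mult.left_commute)
  have T'strict: "spos (T' n x)" if x: "pos x" "x \<noteq> 0" for n x
    unfolding spos_def
  proof (intro exI conjI)
    show "e n * Re (tr x) > 0" using e pos_tr_positive[OF x] by simp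
    have "T' n x = T x + complex_of_real (e n * Re (tr x)) \<cdot> one" unfolding T'_def real_tr_mult[OF x(1)] ..
    then show "pos (T' n x - complex_of_real (e n * Re (tr x)) \<cdot> one)" using D(4)[OF x(1)] by (simp del: of_real_mult)
  qed
  have "\<exists>y t. pos y \<and> tr y = 1 \<and> T' n y = complex_of_real t \<cdot> y" for n
    by (rule strictly_positive_map_eigenvector[OF T'map T'strict nontriv])
  then obtain y t where y: "\<And>n. pos (y n)" "\<And>n. tr (y n) = 1" "\<And>n. T' n (y n) = complex_of_real (t n) \<cdot> y n" by metis
  obtain r y' where r: "strict_mono r" "pos y'" "tr y' = 1"
    "\<And>\<psi>. linear_on A \<psi> \<Longrightarrow> (\<lambda>n. \<psi> (y (r n))) \<longlonglongrightarrow> \<psi> y'" using states_compact[of y, OF y(1,2)] by blast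
  have y'A: "y' \<in> A" and yA: "y n \<in> A" for n using r y by auto
  have Ty: "T (y n) = complex_of_real (t n) \<cdot> y n - complex_of_real (e n) \<cdot> one" for n
    using y(2,3)[of n] by (simp add: T'_def algebra_simps)
  \<comment> \<open>Taking traces expresses the eigenvalues through the states, so they converge
    along the same subsequence.\<close>
  have tn: "complex_of_real (t n) = tr (T (y n)) + complex_of_real (e n) * tr one" for n
    using yA[of n] y(2)[of n] by (simp add: Ty tr_diff)
  have elim: "(\<lambda>n. complex_of_real (e (r n))) \<longlonglongrightarrow> 0"
  proof -
    have "e = (\<lambda>n. inverse (real (Suc n)))" by (simp add: e_def fun_eq_iff inverse_eq_divide)
    then have "e \<longlonglongrightarrow> 0" using LIMSEQ_inverse_real_of_nat by simp
    then show ?thesis using LIMSEQ_subseq_LIMSEQ[OF _ r(1)] tendsto_of_real[of "e \<circ> r" 0 sequentially] by (auto simp: o_def)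
  qed
  have tlim: "(\<lambda>n. complex_of_real (t (r n))) \<longlonglongrightarrow> tr (T y')"
    unfolding tn using tendsto_add[OF r(4)[OF linear_on_compose[OF T tr_linear]] tendsto_mult_right[OF elim, of "tr one"]] by simp
  have "tr ((T y' - tr (T y') \<cdot> y') \<odot> (d \<odot> star d)) = 0" if d: "d \<in> A" for d
  proof -
    let ?\<psi> = "\<lambda>x. tr (x \<odot> (d \<odot> star d))"
    have lin: "linear_on A ?\<psi>" using d by (intro linear_on_tr_mult) auto
    have "?\<psi> (T (y (r n))) = complex_of_real (t (r n)) * ?\<psi> (y (r n)) - complex_of_real (e (r n)) * ?\<psi> one" for n
      using d yA by (simp add: Ty mult_diff_left tr_diff)
    then have "(\<lambda>n. ?\<psi> (T (y (r n)))) \<longlonglongrightarrow> tr (T y') * ?\<psi> y' - 0 * ?\<psi> one"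
      using tendsto_diff[OF tendsto_mult[OF tlim r(4)[OF lin]] tendsto_mult_right[OF elim, of "?\<psi> one"]] by simp
    then have "?\<psi> (T y') = tr (T y') * ?\<psi> y'"
      using r(4)[OF linear_on_compose[OF T lin]] LIMSEQ_unique by fastforce
    then show ?thesis using d y'A D(1) by (simp add: mult_diff_left tr_diff)
  qed
  then have "T y' - tr (T y') \<cdot> y' = 0" using y'A D(1) by (intro tr_ext) auto
  then have "T y' = tr (T y') \<cdot> y'" by simp
  moreover obtain c where "tr (T y') = complex_of_real c" using real_tr(1)[OF D(4)[OF r(2)]] by blast
  ultimately have "T y' = complex_of_real c \<cdot> y'" by metis
  then show ?thesis using r(2,3) by blast
qed

text \<open>That a projection \<open>p\<close> is mapped below a multiple of itself means that
  \<open>T\<close> preserves the face of positive elements dominated by multiples of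
  \<open>p\<close>.\<close>

definition irreducible_map :: "('a \<Rightarrow> 'a) \<Rightarrow> bool" where
  "irreducible_map T \<longleftrightarrow> (\<forall>p\<in>A. p \<odot> p = p \<longrightarrow> star p = p \<longrightarrow> (\<exists>c>0. pos (complex_of_real c \<cdot> p - T p)) \<longrightarrow> p = 0 \<or> p = one)"

lemma eigenvalue_nonneg:
  assumes T: "positive_map T" and y: "pos y" "y \<noteq> 0" "T y = complex_of_real t \<cdot> y"
  shows "0 \<le> t"
proof -
  have "0 \<le> Re (tr (T y))" using pos_tr[OF positive_mapD(4)[OF T y(1)]] by (simp add: nonneg_Reals_complex)
  also have "\<dots> = t * Re (tr y)" unfolding y(3) using y(1) by simp
  finally show ?thesis using pos_tr_positive[OF y(1,2)] by (simp add: zero_le_mult_iff)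
qed

text \<open>The support \<open>q\<close> of \<open>y\<close> lies below a multiple of
  \<open>y\<close>, so \<open>T q\<close> lies below a multiple of \<open>T y\<close>, hence of
  \<open>y\<close>, hence of \<open>q\<close>. Irreducibility then leaves only
  \<open>q = one\<close>, as \<open>q = 0\<close> would give \<open>y = 0\<close>.\<close>

lemma irreducible_eigenvector_spos:
  assumes T: "positive_map T" and irr: "irreducible_map T" and y: "pos y" "y \<noteq> 0" "T y = complex_of_real t \<cdot> y"
  shows "spos y"
proof -
  note D = positive_mapD[OF T]
  have yA: "y \<in> A" using y by simp
  obtain q C K where q: "q \<in> A" "star q = q" "q \<odot> q = q" "C > 0" "pos (complex_of_real C \<cdot> q - y)" "K > 0" "pos (complex_of_real K \<cdot> y - q)"
    "q = 0 \<longrightarrow> y = 0" "q = one \<longrightarrow> spos y" using pos_support[OF y(1)] by blast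
  have t: "0 \<le> t" by (rule eigenvalue_nonneg[OF T y])
  have qpos: "pos q" using pos_square[OF q(1)] q by simp
  have "pos (T (complex_of_real K \<cdot> y - q))" by (rule D(4)[OF q(7)])
  then have 1: "pos (complex_of_real (K * t) \<cdot> y - T q)" using yA q(1) D y(3) by simp
  have 2: "pos (complex_of_real (K * t) \<cdot> (complex_of_real C \<cdot> q - y))" using q t by (intro pos_scl) auto
  \<comment> \<open>Adding \<open>q\<close> turns the constant into \<open>K * t * C + 1\<close>,
    which is positive even when \<open>t = 0\<close>.\<close>
  have 3: "pos ((complex_of_real (K * t) \<cdot> y - T q) + complex_of_real (K * t) \<cdot> (complex_of_real C \<cdot> q - y) + q)"
    by (intro pos_add 1 2 qpos)
  have eq: "(complex_of_real (K * t) \<cdot> y - T q) + complex_of_real (K * t) \<cdot> (complex_of_real C \<cdot> q - y) + q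
     = complex_of_real (K * t * C + 1) \<cdot> q - T q"
    by (simp add: scale_right_diff_distrib scale_left_distrib)
  have "pos (complex_of_real (K * t * C + 1) \<cdot> q - T q)" using 3 unfolding eq .
  moreover have "K * t * C + 1 > 0" using q t by (intro add_nonneg_pos) auto
  ultimately have "q = 0 \<or> q = one" using irr q unfolding irreducible_map_def by blast
  then show ?thesis using q y(2) by blast
qed

text \<open>
  For the largest spectral value \<open>m\<close> of \<open>y\<^sup>-\<^sup>1\<^sup>/\<^sup>2 h y\<^sup>-\<^sup>1\<^sup>/\<^sup>2\<close>, the element \<open>m \<cdot> y - h\<close> is positive
  but not invertible, hence zero.
\<close>

lemma irreducible_hermitian_eigenvector:
  assumes T: "positive_map T" and irr: "irreducible_map T" and nontriv: "one \<noteq> 0"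
    and y: "spos y" "T y = complex_of_real t \<cdot> y"
    and h: "hermitian h" "T h = complex_of_real t \<cdot> h"
  shows "\<exists>c. h = c \<cdot> y"
proof -
  note D = positive_mapD[OF T]
  obtain c d where cd: "hermitian c" "hermitian d" "c \<odot> c = y" "c \<odot> d = one" "d \<odot> c = one"
    using spos_invertible[OF y(1)] by blast
  have A: "c \<in> A" "d \<in> A" "h \<in> A" "y \<in> A" using cd h y spos_pos[OF y(1)] by auto
  have st: "star c = c" "star d = d" using cd by (auto simp: hermitian_def simp del: hermitian_in)
  have "hermitian (d \<odot> h \<odot> star d)" using h A by (intro hermitian_conj)
  then have k: "hermitian (d \<odot> h \<odot> d)" unfolding st .
  obtain S p where s: "spectral_family (d \<odot> h \<odot> d) S p" using spectral_family_exists[OF k] by blast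
  note S = spectral_familyD[OF s]
  have "S \<noteq> {}" using S(7) nontriv by auto
  define m where "m = Max S"
  have m: "m \<in> S" "\<And>u. u \<in> S \<Longrightarrow> u \<le> m" using S(1) \<open>S \<noteq> {}\<close> by (auto simp: m_def)
  let ?k = "complex_of_real m \<cdot> one - d \<odot> h \<odot> d"
  have "pos (fcalc S p (\<lambda>u. m * 1 - u))" using m by (intro fcalc_pos[OF s]) auto
  then have kpos: "pos ?k"
    unfolding fcalc_diff[symmetric] fcalc_scl[symmetric] fcalc_id[OF s] fcalc_one[OF s] .
  let ?z = "complex_of_real m \<cdot> y - h"
  have "c \<odot> (d \<odot> h \<odot> d) \<odot> c = (c \<odot> d) \<odot> h \<odot> (d \<odot> c)" using A by (simp add: mult_assoc)
  then have chc: "c \<odot> (d \<odot> h \<odot> d) \<odot> c = h" using A cd by simp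
  have zk: "?z = c \<odot> ?k \<odot> c" using A chc cd(3) by (simp add: mult_diff_left mult_diff_right)
  have "pos (c \<odot> ?k \<odot> star c)" by (rule pos_conj[OF kpos A(1)])
  then have zpos: "pos ?z" unfolding st zk .
  have Tz: "T ?z = complex_of_real t \<cdot> ?z"
    using A D y(2) h(2) by (simp add: scale_right_diff_distrib scale_left_commute)
  have "?z = 0"
  proof (rule ccontr)
    assume "?z \<noteq> 0"
    then have "spos ?z" using irreducible_eigenvector_spos[OF T irr zpos _ Tz] by blast
    then obtain a b where ab: "hermitian a" "hermitian b" "a \<odot> a = ?z" "b \<odot> a = one" using spos_invertible by blast
    have abA: "a \<in> A" "b \<in> A" using ab by auto
    have pA: "p m \<in> A" by (rule S(2))
    \<comment> \<open>The spectral projection at the maximum is annihilated by \<open>?k\<close>.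
      Hence \<open>?z\<close> annihilates \<open>d \<odot> p m\<close>, which an invertible
      \<open>?z\<close> forbids.\<close>
    have kp: "?k \<odot> p m = 0" using A S(2)[of m] S(6)[OF m(1)] by (simp add: mult_diff_left)
    have "?z \<odot> (d \<odot> p m) = c \<odot> (?k \<odot> ((c \<odot> d) \<odot> p m))" unfolding zk using A pA by (simp add: mult_assoc)
    also have "\<dots> = 0" using kp cd(4) A pA by simp
    finally have "b \<odot> (b \<odot> (?z \<odot> (d \<odot> p m))) = 0" using abA by simp
    moreover have "b \<odot> (b \<odot> (?z \<odot> (d \<odot> p m))) = (b \<odot> ((b \<odot> a) \<odot> a)) \<odot> (d \<odot> p m)"
      unfolding ab(3)[symmetric] using abA A pA by (simp add: mult_assoc)
    ultimately have "d \<odot> p m = 0" using ab(4) abA A pA by simp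
    then have "(c \<odot> d) \<odot> p m = 0" using A pA by (simp add: mult_assoc)
    then show False using cd(4) pA S(4)[OF m(1)] by simp
  qed
  then have "h = complex_of_real m \<cdot> y" by simp
  then show ?thesis by blast
qed

text \<open>\<open>h\<close> is a multiple of \<open>one\<close> minus a positive element, and both
  have positive images.\<close>

lemma positive_map_hermitian:
  assumes T: "positive_map T" and h: "hermitian h"
  shows "hermitian (T h)"
proof -
  note D = positive_mapD[OF T]
  obtain C where C: "C > 0" "pos (complex_of_real C \<cdot> one - h)" using hermitian_bounded[OF h] by blast
  have "T h = T (complex_of_real C \<cdot> one) - T (complex_of_real C \<cdot> one - h)"
    using D(5)[of "complex_of_real C \<cdot> one" "complex_of_real C \<cdot> one - h"] h by simp
  moreover have "pos (T (complex_of_real C \<cdot> one))" "pos (T (complex_of_real C \<cdot> one - h))"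
    using C by (auto intro!: D(4) pos_scl)
  ultimately show ?thesis by (simp add: pos_hermitian)
qed

lemma positive_map_star:
  assumes T: "positive_map T" and x: "x \<in> A"
  shows "T (star x) = star (T x)"
proof -
  note D = positive_mapD[OF T]
  obtain a b where ab: "hermitian a" "hermitian b" "x = a + \<i> \<cdot> b" using hermitian_parts[OF x] by blast
  have A: "a \<in> A" "b \<in> A" "star a = a" "star b = b" using ab by (auto simp: hermitian_def simp del: hermitian_in)
  have TA: "T a \<in> A" "T b \<in> A" "star (T a) = T a" "star (T b) = T b"
    using positive_map_hermitian[OF T] ab unfolding hermitian_def by auto
  have "star x = a + (- \<i>) \<cdot> b" using A by (simp add: ab(3) star_add)
  then show ?thesis using A TA D by (simp add: ab(3) star_add)
qed

text \<open>\<open>T\<close> commutes with the star and the eigenvalue is real, so the real and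
  imaginary parts of \<open>x\<close> satisfy the same eigenvalue equation.\<close>

lemma irreducible_eigenvector_unique:
  assumes T: "positive_map T" and irr: "irreducible_map T"
    and y: "spos y" "T y = complex_of_real t \<cdot> y"
    and x: "x \<in> A" "T x = complex_of_real t \<cdot> x"
  shows "\<exists>c. x = c \<cdot> y"
proof (cases "one = 0")
  case True
  then have "x = 0" using one_mult[OF x(1)] x(1) by simp
  then show ?thesis by (intro exI[of _ 0]) simp
next
  case False
  note D = positive_mapD[OF T]
  let ?a = "(1 / 2) \<cdot> (x + star x)" and ?b = "(- \<i> / 2) \<cdot> (x - star x)"
  have Ts: "T (star x) = complex_of_real t \<cdot> star x" using positive_map_star[OF T x(1)] x by simp
  have "T ?a = complex_of_real t \<cdot> ?a" "T ?b = complex_of_real t \<cdot> ?b"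
    using x Ts D by (simp_all add: scale_right_distrib scale_right_diff_distrib mult.commute)
  then obtain c c' where c: "?a = c \<cdot> y" "?b = c' \<cdot> y"
    using irreducible_hermitian_eigenvector[OF T irr False y] hermitian_parts[OF x(1)] by metis
  have "x = c \<cdot> y + \<i> \<cdot> (c' \<cdot> y)" using hermitian_parts(3)[OF x(1)] unfolding c .
  then have "x = (c + \<i> * c') \<cdot> y" by (simp add: scale_left_distrib)
  then show ?thesis by blast
qed

text \<open>A positive multiple of \<open>one\<close> lies below \<open>y\<close>, so its images
  under the powers of \<open>T\<close> stay below \<open>t ^ n\<close> times
  \<open>y\<close>.\<close>

lemma positive_map_power_growth:
  assumes T: "positive_map T" and y: "spos y" "T y = complex_of_real t \<cdot> y"
  shows "\<exists>C\<ge>0. \<forall>n. Re (tr ((T ^^ n) one)) \<le> C * t ^ n"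
proof -
  note D = positive_mapD[OF T]
  have yA: "y \<in> A" "pos y" using spos_pos[OF y(1)] by auto
  obtain \<epsilon> where e: "\<epsilon> > 0" "pos (y - complex_of_real \<epsilon> \<cdot> one)" using y by (auto simp: spos_def)
  have "(T ^^ n) one \<in> A \<and> pos (complex_of_real (t ^ n) \<cdot> y - complex_of_real \<epsilon> \<cdot> (T ^^ n) one)" for n
  proof (induction n)
    case (Suc n)
    then have A: "(T ^^ n) one \<in> A" by blast
    have "pos (T (complex_of_real (t ^ n) \<cdot> y - complex_of_real \<epsilon> \<cdot> (T ^^ n) one))" using Suc D(4) by blast
    then show ?case using A D yA y(2) by (simp add: mult.commute)
  qed (use e in simp)
  then have *: "(T ^^ n) one \<in> A" "pos (complex_of_real (t ^ n) \<cdot> y - complex_of_real \<epsilon> \<cdot> (T ^^ n) one)" for n by blast+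
  have "Re (tr ((T ^^ n) one)) \<le> (Re (tr y) / \<epsilon>) * t ^ n" for n
  proof -
    have "0 \<le> Re (tr (complex_of_real (t ^ n) \<cdot> y - complex_of_real \<epsilon> \<cdot> (T ^^ n) one))"
      using pos_tr[OF *(2)] by (simp add: nonneg_Reals_complex)
    also have "\<dots> = t ^ n * Re (tr y) - \<epsilon> * Re (tr ((T ^^ n) one))"
      using *(1)[of n] yA by (simp add: tr_diff del: of_real_power)
    finally show ?thesis using e by (simp add: field_simps)
  qed
  moreover have "0 \<le> Re (tr y) / \<epsilon>" using pos_tr[OF yA(2)] e by (simp add: nonneg_Reals_complex)
  ultimately show ?thesis by blast
qed

end

section \<open>Tangles given by tables\<close>

text \<open>
  A presentation lists the discs and, for each disc, the labels of the strings at its points and of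
  the regions at its segments.  This covers the tangles without closed loops in which every region touches a
  disc, and makes planarity and composition computable.
\<close>

type_synonym presentation = "colour list \<times> nat list list \<times> nat list list"

definition p_discs :: "presentation \<Rightarrow> colour list" where
  "p_discs P = fst P"

definition p_string :: "presentation \<Rightarrow> nat \<Rightarrow> nat \<Rightarrow> nat" where
  "p_string P d j = fst (snd P) ! d ! j"

definition p_region :: "presentation \<Rightarrow> nat \<Rightarrow> nat \<Rightarrow> nat" where
  "p_region P d k = snd (snd P) ! d ! k"

definition tangle_of :: "presentation \<Rightarrow> tangle" where
  "tangle_of P = simple_tangle (p_discs P) (p_string P) (p_region P)"

section \<open>Computable counterparts of planarity, gluing and isotopy\<close>

definition point_list :: "colour list \<Rightarrow> (nat \<times> nat) list" where
  "point_list ds = concat (map (\<lambda>d. map (Pair d) [0..<2 * fst (ds ! d)]) [0..<length ds])"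

definition segment_list :: "colour list \<Rightarrow> (nat \<times> nat) list" where
  "segment_list ds = concat (map (\<lambda>d. map (Pair d) [0..<max 1 (2 * fst (ds ! d))]) [0..<length ds])"

text \<open>Flags are incidences of a disc, a point on it and one of the two segments next to that
  point.\<close>

definition flag_list :: "colour list \<Rightarrow> (nat \<times> nat \<times> nat) list" where
  "flag_list ds = concat (map (\<lambda>(d, j). [(d, j, j), (d, j, Suc j mod (2 * fst (ds ! d)))]) (point_list ds))"

definition merge_classes :: "'v list list \<Rightarrow> 'v \<times> 'v \<Rightarrow> 'v list list" where
  "merge_classes cs e =
     concat (filter (\<lambda>c. fst e \<in> set c \<or> snd e \<in> set c) cs) # filter (\<lambda>c. \<not> (fst e \<in> set c \<or> snd e \<in> set c)) cs"

text \<open>Intended as the components of the graph. In general only covering and connectedness of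
  the classes are proved; that different classes are not linked is certified, where it matters, by a
  label that is constant along edges.\<close>

definition link_classes :: "'v list \<Rightarrow> ('v \<times> 'v) list \<Rightarrow> 'v list list" where
  "link_classes vs es = foldl merge_classes (map (\<lambda>v. [v]) vs) es"

fun class_index :: "'v list list \<Rightarrow> 'v \<Rightarrow> nat" where
  "class_index [] v = 0"
| "class_index (c # cs) v = (if v \<in> set c then 0 else Suc (class_index cs v))"

definition string_labels :: "presentation \<Rightarrow> nat list" where
  "string_labels P = remdups (map (\<lambda>(d, j). p_string P d j) (point_list (p_discs P)))"

definition region_labels :: "presentation \<Rightarrow> nat list" where
  "region_labels P = remdups (map (\<lambda>(d, k). p_region P d k) (segment_list (p_discs P)))"

definition well_formed :: "presentation \<Rightarrow> bool" where
  "well_formed P \<longleftrightarrow> map length (fst (snd P)) = map (\<lambda>c. 2 * fst c) (p_discs P) \<and>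
     map length (snd (snd P)) = map (\<lambda>c. max 1 (2 * fst c)) (p_discs P)"

text \<open>Ensures that the \<open>THE\<close> in the \<open>side\<close> component of
  \<open>simple_tangle\<close> denotes: a string and a shading determine the region.\<close>

definition consistency_check :: "presentation \<Rightarrow> bool" where
  "consistency_check P \<longleftrightarrow> (let ds = p_discs P in
     list_all (\<lambda>(d, j, k). list_all (\<lambda>(d', j', k').
        p_string P d j = p_string P d' j' \<and> seg_shaded ds d k = seg_shaded ds d' k' \<longrightarrow>
        p_region P d k = p_region P d' k') (flag_list ds)) (flag_list ds))"

definition shading_check :: "presentation \<Rightarrow> bool" where
  "shading_check P \<longleftrightarrow> (let ds = p_discs P in
     list_all (\<lambda>(d, k). list_all (\<lambda>(d', k').
        p_region P d k = p_region P d' k' \<longrightarrow> seg_shaded ds d k = seg_shaded ds d' k')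
        (segment_list ds)) (segment_list ds))"

definition ends_check :: "presentation \<Rightarrow> bool" where
  "ends_check P \<longleftrightarrow> (let ds = p_discs P in
     list_all (\<lambda>e. case filter (\<lambda>(d, j). p_string P d j = e) (point_list ds) of
          [p, q] \<Rightarrow> outgoing ds (fst p) (snd p) \<noteq> outgoing ds (fst q) (snd q) | _ \<Rightarrow> False) (string_labels P))"

text \<open>The step across a string is taken between the two segments at one of its ends, so
  \<open>side\<close> never has to be evaluated.\<close>

definition connection_classes :: "presentation \<Rightarrow> (nat + nat) list list" where
  "connection_classes P = (let ds = p_discs P in
     link_classes
       (map Inl [0..<length ds] @ map (\<lambda>r. Inr r) (region_labels P))
       (map (\<lambda>(d, k). (Inl d, Inr (p_region P d k))) (segment_list ds) @
        map (\<lambda>(d, j). (Inr (p_region P d j), Inr (p_region P d (Suc j mod (2 * fst (ds ! d)))))) (point_list ds)))"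

text \<open>
  In a tangle that is connected apart from discs without points, each region has one boundary curve, and
  in addition each disc without points is a boundary curve of its own.
\<close>

definition curve_labels :: "presentation \<Rightarrow> (bool \<times> nat) list" where
  "curve_labels P = (let ds = p_discs P in
     remdups (map (\<lambda>(d, k). if fst (ds ! d) = 0 then (True, d) else (False, p_region P d k)) (segment_list ds)))"

definition curve_classes :: "presentation \<Rightarrow> (nat \<times> nat + nat \<times> bool) list list" where
  "curve_classes P = (let ds = p_discs P in
     link_classes
       (map Inl (segment_list ds) @ map (\<lambda>p. Inr p) (List.product (string_labels P) [False, True]))
       (map (\<lambda>(d, j, k). (Inl (d, k), Inr (p_string P d j, seg_shaded ds d k))) (flag_list ds)))"

text \<open>Labels are constant on boundary curves, so they are at most as many as the curves, which
  are at most as many as the computed classes; the inequality between classes and labels thus forces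
  equality throughout.\<close>

definition planar_check :: "presentation \<Rightarrow> bool" where
  "planar_check P \<longleftrightarrow> p_discs P \<noteq> [] \<and> well_formed P \<and> consistency_check P \<and> shading_check P \<and>
     ends_check P \<and> length (connection_classes P) = 1 \<and>
     length (curve_classes P) \<le> length (curve_labels P) \<and>
     int (length (p_discs P)) - int (length (point_list (p_discs P)) div 2)
       + (2 * int (length (region_labels P)) - int (length (curve_labels P))) = 2"

definition tabulate :: "colour list \<Rightarrow> (nat \<Rightarrow> nat \<Rightarrow> nat) \<Rightarrow> (nat \<Rightarrow> nat \<Rightarrow> nat) \<Rightarrow> presentation" where
  "tabulate ds st rg = (ds, map (\<lambda>d. map (st d) [0..<2 * fst (ds ! d)]) [0..<length ds],
       map (\<lambda>d. map (rg d) [0..<max 1 (2 * fst (ds ! d))]) [0..<length ds])"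

definition glued_labels :: "nat list \<Rightarrow> nat list \<Rightarrow> (nat + nat) list" where
  "glued_labels xs ys = map Inl xs @ map Inr ys"

definition string_classes :: "presentation \<Rightarrow> nat \<Rightarrow> presentation \<Rightarrow> (nat + nat) list list" where
  "string_classes T i S =
     link_classes (glued_labels (string_labels T) (string_labels S))
       (map (\<lambda>j. (Inl (p_string T i j), Inr (p_string S 0 j))) [0..<2 * fst (p_discs T ! i)])"

definition region_classes :: "presentation \<Rightarrow> nat \<Rightarrow> presentation \<Rightarrow> (nat + nat) list list" where
  "region_classes T i S =
     link_classes (glued_labels (region_labels T) (region_labels S))
       (map (\<lambda>k. (Inl (p_region T i k), Inr (p_region S 0 k))) [0..<max 1 (2 * fst (p_discs T ! i))])"

definition glue :: "('c \<Rightarrow> 'e) \<Rightarrow> ('d \<Rightarrow> 'e) \<Rightarrow> 'c list \<Rightarrow> nat \<Rightarrow> 'd list \<Rightarrow> 'e list" where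
  "glue f f' xs i ys = map f (take i xs) @ map f' (tl ys) @ map f (drop (Suc i) xs)"

definition plug :: "presentation \<Rightarrow> nat \<Rightarrow> presentation \<Rightarrow> presentation" where
  "plug T i S =
     (let fs = string_classes T i S; gs = region_classes T i S
      in (take i (p_discs T) @ tl (p_discs S) @ drop (Suc i) (p_discs T),
          glue (map (\<lambda>e. class_index fs (Inl e))) (map (\<lambda>e. class_index fs (Inr e))) (fst (snd T)) i (fst (snd S)),
          glue (map (\<lambda>r. class_index gs (Inl r))) (map (\<lambda>r. class_index gs (Inr r))) (snd (snd T)) i (snd (snd S))))"

text \<open>Reflection reverses all points of a disc, but it fixes segment 0 and reverses only the
  other segments.\<close>

definition reflectP :: "presentation \<Rightarrow> presentation" where
  "reflectP P = (p_discs P, map rev (fst (snd P)), map (\<lambda>row. hd row # rev (tl row)) (snd (snd P)))"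

text \<open>Two labellings that induce the same partition differ by a bijection of labels
  (\<open>label_bijD\<close>), which is what an isomorphism of tangles has to supply for strings and
  for regions.\<close>

definition label_bij :: "'v list \<Rightarrow> ('v \<Rightarrow> nat) \<Rightarrow> ('v \<Rightarrow> nat) \<Rightarrow> bool" where
  "label_bij xs a b \<longleftrightarrow> list_all (\<lambda>x. list_all (\<lambda>y. a x = a y \<longleftrightarrow> b x = b y) xs) xs"

definition iso_check :: "nat list \<Rightarrow> presentation \<Rightarrow> presentation \<Rightarrow> bool" where
  "iso_check \<sigma> P Q \<longleftrightarrow> (let ds = p_discs P in
     length (p_discs Q) = length ds \<and> length \<sigma> = length ds \<and> distinct \<sigma> \<and> \<sigma> ! 0 = 0 \<and>
     list_all (\<lambda>d. \<sigma> ! d < length ds \<and> p_discs Q ! (\<sigma> ! d) = ds ! d) [0..<length ds] \<and>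
     label_bij (point_list ds) (\<lambda>(d, j). p_string P d j) (\<lambda>(d, j). p_string Q (\<sigma> ! d) j) \<and>
     label_bij (segment_list ds) (\<lambda>(d, k). p_region P d k) (\<lambda>(d, k). p_region Q (\<sigma> ! d) k))"

text \<open>A string may lose an end on the removed disc, so its sides are looked up at any flag of
  \<open>R\<close> that carries the translated string.\<close>

definition side_check :: "(nat \<Rightarrow> nat) \<Rightarrow> (nat \<Rightarrow> nat) \<Rightarrow> presentation \<Rightarrow> presentation \<Rightarrow> bool" where
  "side_check f g P R \<longleftrightarrow>
     list_all (\<lambda>(d, j, k). list_ex (\<lambda>(d', j', k').
        p_string R d' j' = f (p_string P d j) \<and>
        seg_shaded (p_discs R) d' k' = seg_shaded (p_discs P) d k \<and> p_region R d' k' = g (p_region P d k))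
       (flag_list (p_discs R))) (flag_list (p_discs P))"

text \<open>The equalities of label sets exclude gluings that produce a closed loop or a region
  touching no disc, neither of which a table records.\<close>

definition plug_check :: "presentation \<Rightarrow> nat \<Rightarrow> presentation \<Rightarrow> bool" where
  "plug_check T i S \<longleftrightarrow>
     (let R = plug T i S; fs = string_classes T i S; gs = region_classes T i S
      in planar_check R \<and> 0 < i \<and> i < length (p_discs T) \<and> hd (p_discs S) = p_discs T ! i \<and>
         list_all (\<lambda>j. class_index fs (Inl (p_string T i j)) = class_index fs (Inr (p_string S 0 j))) [0..<2 * fst (p_discs T ! i)] \<and>
         list_all (\<lambda>k. class_index gs (Inl (p_region T i k)) = class_index gs (Inr (p_region S 0 k))) [0..<max 1 (2 * fst (p_discs T ! i))] \<and>
         class_index fs ` set (glued_labels (string_labels T) (string_labels S)) = set (string_labels R) \<and>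
         class_index gs ` set (glued_labels (region_labels T) (region_labels S)) = set (region_labels R) \<and>
         side_check (\<lambda>e. class_index fs (Inl e)) (\<lambda>r. class_index gs (Inl r)) T R \<and>
         side_check (\<lambda>e. class_index fs (Inr e)) (\<lambda>r. class_index gs (Inr r)) S R)"

section \<open>Connected components by merging classes\<close>

lemma gen_equiv_refl [simp]: "(a, a) \<in> gen_equiv r"
  by (simp add: gen_equiv_def)

lemma gen_equiv_sym: "(a, b) \<in> gen_equiv r \<Longrightarrow> (b, a) \<in> gen_equiv r"
  unfolding gen_equiv_def by (metis converse_Un converse_converse rtrancl_converseD rtrancl_converseI sup_commute)

lemma gen_equiv_trans: "(a, b) \<in> gen_equiv r \<Longrightarrow> (b, c) \<in> gen_equiv r \<Longrightarrow> (a, c) \<in> gen_equiv r"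
  unfolding gen_equiv_def by (rule rtrancl_trans)

lemma gen_equiv_base: "(a, b) \<in> r \<Longrightarrow> (a, b) \<in> gen_equiv r"
  by (auto simp: gen_equiv_def)

lemma gen_equiv_invariant:
  assumes "(a, b) \<in> gen_equiv r" "\<And>u v. (u, v) \<in> r \<Longrightarrow> f u = f v"
  shows "f a = f b"
  using assms(1) unfolding gen_equiv_def
  by (induction rule: rtrancl_induct) (use assms(2) in auto)

lemma card_quotient_gen_equiv:
  assumes "\<And>u v. u \<in> V \<Longrightarrow> v \<in> V \<Longrightarrow> lab u = lab v \<longleftrightarrow> (u, v) \<in> gen_equiv r"
  shows "card (V // gen_equiv r) = card (lab ` V)"
proof -
  have eq: "gen_equiv r `` {u} = gen_equiv r `` {v} \<longleftrightarrow> (u, v) \<in> gen_equiv r" for u v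
    by (auto intro: gen_equiv_sym gen_equiv_trans)
  have "bij_betw (\<lambda>c. lab (SOME u. u \<in> V \<and> c = gen_equiv r `` {u})) (V // gen_equiv r) (lab ` V)"
  proof -
    have *: "lab (SOME v. v \<in> V \<and> gen_equiv r `` {u} = gen_equiv r `` {v}) = lab u" if "u \<in> V" for u
    proof -
      have "\<exists>v. v \<in> V \<and> gen_equiv r `` {u} = gen_equiv r `` {v}" using that by blast
      from someI_ex[OF this] have w: "(SOME v. v \<in> V \<and> gen_equiv r `` {u} = gen_equiv r `` {v}) \<in> V"
        "(u, SOME v. v \<in> V \<and> gen_equiv r `` {u} = gen_equiv r `` {v}) \<in> gen_equiv r"
        using eq by blast+
      show ?thesis using assms[OF that w(1)] w(2) by simp
    qed
    show ?thesis
    proof (rule bij_betwI')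
      fix c d assume "c \<in> V // gen_equiv r" "d \<in> V // gen_equiv r"
      then obtain u v where "u \<in> V" "v \<in> V" "c = gen_equiv r `` {u}" "d = gen_equiv r `` {v}"
        by (auto simp: quotient_def)
      then show "(lab (SOME u. u \<in> V \<and> c = gen_equiv r `` {u}) = lab (SOME u. u \<in> V \<and> d = gen_equiv r `` {u})) = (c = d)"
        using * assms eq by simp
    next
      fix c assume "c \<in> V // gen_equiv r"
      then show "lab (SOME u. u \<in> V \<and> c = gen_equiv r `` {u}) \<in> lab ` V"
        using * by (auto simp: quotient_def)
    next
      fix l assume "l \<in> lab ` V"
      then show "\<exists>c\<in>V // gen_equiv r. l = lab (SOME u. u \<in> V \<and> c = gen_equiv r `` {u})"
        using * by (auto simp: quotient_def)
    qed
  qed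
  then show ?thesis by (rule bij_betw_same_card)
qed

lemma link_classes_connected:
  assumes "c \<in> set (link_classes vs es)" "u \<in> set c" "v \<in> set c"
  shows "(u, v) \<in> gen_equiv (set es)"
proof -
  \<comment> \<open>Generalised to arbitrary initial classes and to a fixed edge set
    \<open>E\<close>, since the fold consumes the edges while the classes grow.\<close>
  have "\<forall>c\<in>set (foldl merge_classes cs es). \<forall>u\<in>set c. \<forall>v\<in>set c. (u, v) \<in> gen_equiv E"
    if "\<forall>c\<in>set cs. \<forall>u\<in>set c. \<forall>v\<in>set c. (u, v) \<in> gen_equiv E" "set es \<subseteq> E" for cs E
    using that
  proof (induction es arbitrary: cs)
    case (Cons e es)
    obtain a b where e: "e = (a, b)" by (cases e)
    have ab: "(a, b) \<in> gen_equiv E" "(b, a) \<in> gen_equiv E"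
      using Cons.prems(2) e by (auto intro: gen_equiv_base gen_equiv_sym)
    have to_a: "(u, a) \<in> gen_equiv E"
      if "d \<in> set cs" "a \<in> set d \<or> b \<in> set d" "u \<in> set d" for u d
      using that Cons.prems(1) ab by (blast intro: gen_equiv_trans)
    have "\<forall>c\<in>set (merge_classes cs e). \<forall>u\<in>set c. \<forall>v\<in>set c. (u, v) \<in> gen_equiv E"
      using Cons.prems(1) to_a unfolding merge_classes_def e
      by (auto intro: gen_equiv_trans[OF to_a gen_equiv_sym[OF to_a]])
    then show ?case using Cons.IH Cons.prems(2) by simp
  qed simp
  from this[of "map (\<lambda>v. [v]) vs" "set es"] show ?thesis
    using assms by (auto simp: link_classes_def)
qed

lemma link_classes_cover: "(\<Union>c\<in>set (link_classes vs es). set c) = set vs"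
proof -
  have "(\<Union>c\<in>set (foldl merge_classes cs es). set c) = (\<Union>c\<in>set cs. set c)" for cs
  proof (induction es arbitrary: cs)
    case (Cons e es)
    have "(\<Union>c\<in>set (merge_classes cs e). set c) = (\<Union>c\<in>set cs. set c)"
      by (auto simp: merge_classes_def)
    then show ?case using Cons by simp
  qed simp
  then show ?thesis by (simp add: link_classes_def)
qed

text \<open>Every class is connected and so has a single label; with no more classes than labels,
  distinct classes have distinct labels.\<close>

lemma link_classes_label:
  assumes pres: "\<And>a b. (a, b) \<in> set es \<Longrightarrow> lab a = lab b"
    and le: "length (link_classes vs es) \<le> card (lab ` set vs)"
    and uv: "u \<in> set vs" "v \<in> set vs"
  shows "lab u = lab v \<longleftrightarrow> (u, v) \<in> gen_equiv (set es)"
proof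
  assume "(u, v) \<in> gen_equiv (set es)"
  then show "lab u = lab v" by (rule gen_equiv_invariant) (rule pres)
next
  assume lab: "lab u = lab v"
  let ?cs = "set (link_classes vs es)"
  have const: "lab (hd c) = lab w" if "c \<in> ?cs" "w \<in> set c" for c w
  proof -
    have "c \<noteq> []" using that(2) by auto
    then have "hd c \<in> set c" by simp
    from link_classes_connected[OF that(1) this that(2)] show ?thesis
      by (rule gen_equiv_invariant) (rule pres)
  qed
  have sub: "lab ` set vs \<subseteq> (\<lambda>c. lab (hd c)) ` ?cs"
  proof
    fix l assume "l \<in> lab ` set vs"
    then obtain w where w: "w \<in> set vs" "l = lab w" by blast
    then obtain c where "c \<in> ?cs" "w \<in> set c" using link_classes_cover[of vs es] by blast
    then show "l \<in> (\<lambda>c. lab (hd c)) ` ?cs" using const w by force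
  qed
  have "card ?cs \<le> card ((\<lambda>c. lab (hd c)) ` ?cs)"
    using card_mono[OF _ sub] le card_length[of "link_classes vs es"] by simp
  then have inj: "inj_on (\<lambda>c. lab (hd c)) ?cs"
    by (meson List.finite_set card_image_le eq_card_imp_inj_on le_antisym)
  obtain c d where cd: "c \<in> ?cs" "u \<in> set c" "d \<in> ?cs" "v \<in> set d"
    using link_classes_cover[of vs es] uv by blast
  then have "c = d" using inj const lab by (metis inj_onD)
  then show "(u, v) \<in> gen_equiv (set es)" using link_classes_connected[OF cd(1,2), of v] cd(4) by simp
qed

lemma class_index_correct:
  assumes "v \<in> (\<Union>c\<in>set cs. set c)"
  shows "class_index cs v < length cs" "v \<in> set (cs ! class_index cs v)"
  using assms by (induction cs) auto

text \<open>Here the class index itself is the label, its invariance along edges being verified by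
  evaluation in \<open>plug_check\<close>.\<close>

lemma class_index_link_classes:
  assumes pres: "\<And>a b. (a, b) \<in> set es \<Longrightarrow> class_index (link_classes vs es) a = class_index (link_classes vs es) b"
    and uv: "u \<in> set vs" "v \<in> set vs"
  shows "class_index (link_classes vs es) u = class_index (link_classes vs es) v \<longleftrightarrow> (u, v) \<in> gen_equiv (set es)"
proof
  assume "(u, v) \<in> gen_equiv (set es)"
  then show "class_index (link_classes vs es) u = class_index (link_classes vs es) v"
    by (rule gen_equiv_invariant) (rule pres)
next
  assume "class_index (link_classes vs es) u = class_index (link_classes vs es) v"
  then show "(u, v) \<in> gen_equiv (set es)"
    using class_index_correct[of u "link_classes vs es"] class_index_correct[of v "link_classes vs es"] uv
    by (metis link_classes_connected link_classes_cover nth_mem)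
qed

section \<open>Soundness of the checks\<close>

lemma set_point_list [simp]: "set (point_list ds) = points ds"
  by (auto simp: point_list_def points_def num_points_def)

lemma set_segment_list [simp]: "set (segment_list ds) = segments ds"
  by (auto simp: segment_list_def segments_def num_segments_def num_points_def)

lemma distinct_point_list: "distinct (point_list ds)"
proof -
  have "distinct (concat (map (\<lambda>d. map (Pair d) [0..<h d]) xs))" if "distinct xs" for h :: "nat \<Rightarrow> nat" and xs :: "nat list"
    using that by (induction xs) (auto simp: distinct_map inj_on_def)
  then show ?thesis by (simp add: point_list_def)
qed

lemma set_flag_list: "set (flag_list ds) = {(d, j, k) | d j k. (d, j) \<in> points ds \<and> k \<in> adjacent_segments ds d j}"
  by (auto simp: flag_list_def adjacent_segments_def num_points_def)

lemma adjacent_in_segments: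
  "(d, j) \<in> points ds \<Longrightarrow> k \<in> adjacent_segments ds d j \<Longrightarrow> (d, k) \<in> segments ds"
  by (auto simp: points_def segments_def num_segments_def adjacent_segments_def intro: less_le_trans[OF mod_less_divisor])

text \<open>The wrap-around from the last point to segment 0 keeps the shading alternating because
  the number of points is even.\<close>

lemma seg_shaded_Suc_mod:
  assumes "(d, j) \<in> points ds"
  shows "seg_shaded ds d (Suc j mod num_points ds d) \<longleftrightarrow> \<not> seg_shaded ds d j"
proof -
  have "odd (Suc j mod num_points ds d) = odd (Suc j)"
    unfolding num_points_def odd_iff_mod_2_eq_one by (simp only: mod_mod_cancel dvd_triv_left)
  then show ?thesis by (auto simp: seg_shaded_def)
qed

lemma adjacent_seg_ex:
  assumes "(d, j) \<in> points ds"
  shows "\<exists>k \<in> adjacent_segments ds d j. seg_shaded ds d k = b"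
  using seg_shaded_Suc_mod[OF assms] unfolding adjacent_segments_def by (cases b; auto)

definition consistent :: "colour list \<Rightarrow> (nat \<Rightarrow> nat \<Rightarrow> nat) \<Rightarrow> (nat \<Rightarrow> nat \<Rightarrow> nat) \<Rightarrow> bool" where
  "consistent ds st rg \<longleftrightarrow> (\<forall>d j k d' j' k'. (d, j) \<in> points ds \<longrightarrow> k \<in> adjacent_segments ds d j \<longrightarrow>
     (d', j') \<in> points ds \<longrightarrow> k' \<in> adjacent_segments ds d' j' \<longrightarrow> st d j = st d' j' \<longrightarrow>
     seg_shaded ds d k = seg_shaded ds d' k' \<longrightarrow> rg d k = rg d' k')"

lemma simple_tangle_sel [simp]:
  "discs (simple_tangle ds st rg) = ds"
  "string_at (simple_tangle ds st rg) = st"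
  "region_at (simple_tangle ds st rg) = rg"
  "strings (simple_tangle ds st rg) = (\<lambda>(d, j). st d j) ` points ds"
  "regions (simple_tangle ds st rg) = (\<lambda>(d, k). rg d k) ` segments ds"
proof -
  show "strings (simple_tangle ds st rg) = (\<lambda>(d, j). st d j) ` points ds"
    by (force simp: simple_tangle_def)
  show "regions (simple_tangle ds st rg) = (\<lambda>(d, k). rg d k) ` segments ds"
    by (force simp: simple_tangle_def)
qed (simp_all add: simple_tangle_def)

lemma side_simple_tangle:
  assumes "consistent ds st rg" "(d, j) \<in> points ds" "k \<in> adjacent_segments ds d j"
  shows "side (simple_tangle ds st rg) (st d j) (seg_shaded ds d k) = rg d k"
  unfolding simple_tangle_def tangle.simps
proof (rule the_equality)
  show "\<exists>d' j' k'. (d', j') \<in> points ds \<and> k' \<in> adjacent_segments ds d' j' \<and>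
      st d' j' = st d j \<and> seg_shaded ds d' k' = seg_shaded ds d k \<and> rg d' k' = rg d k"
    using assms(2,3) by blast
next
  fix r assume "\<exists>d' j' k'. (d', j') \<in> points ds \<and> k' \<in> adjacent_segments ds d' j' \<and>
      st d' j' = st d j \<and> seg_shaded ds d' k' = seg_shaded ds d k \<and> rg d' k' = r"
  then obtain d' j' k' where "(d', j') \<in> points ds" "k' \<in> adjacent_segments ds d' j'"
      "st d' j' = st d j" "seg_shaded ds d' k' = seg_shaded ds d k" "rg d' k' = r" by blast
  then show "r = rg d k" using assms(1)[unfolded consistent_def, rule_format, of d' j' k' d j k] assms(2,3) by simp
qed

lemma tangle_of_sel [simp]:
  "discs (tangle_of P) = p_discs P"
  "string_at (tangle_of P) = p_string P"
  "region_at (tangle_of P) = p_region P"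
  "strings (tangle_of P) = set (string_labels P)"
  "regions (tangle_of P) = set (region_labels P)"
  by (simp_all add: tangle_of_def string_labels_def region_labels_def)

lemma planar_check_consistent:
  assumes "planar_check P"
  shows "consistent (p_discs P) (p_string P) (p_region P)"
proof -
  have "\<forall>x\<in>set (flag_list (p_discs P)). \<forall>y\<in>set (flag_list (p_discs P)).
     (case x of (d, j, k) \<Rightarrow> case y of (d', j', k') \<Rightarrow>
       p_string P d j = p_string P d' j' \<and> seg_shaded (p_discs P) d k = seg_shaded (p_discs P) d' k' \<longrightarrow>
       p_region P d k = p_region P d' k')"
    using assms unfolding planar_check_def consistency_check_def Let_def
    by (auto simp only: list_all_iff split_def)
  then show ?thesis
    unfolding consistent_def set_flag_list by blast
qed

lemma side_tangle_of:
  assumes "planar_check P" "(d, j) \<in> points (p_discs P)" "k \<in> adjacent_segments (p_discs P) d j"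
  shows "side (tangle_of P) (p_string P d j) (seg_shaded (p_discs P) d k) = p_region P d k"
  unfolding tangle_of_def by (rule side_simple_tangle[OF planar_check_consistent]) (use assms in auto)

lemma side_tangle_of_ex:
  assumes "planar_check P" "e \<in> set (string_labels P)"
  shows "\<exists>d j k. (d, j) \<in> points (p_discs P) \<and> k \<in> adjacent_segments (p_discs P) d j \<and> e = p_string P d j \<and>
      seg_shaded (p_discs P) d k = b \<and> side (tangle_of P) e b = p_region P d k"
proof -
  obtain d j where dj: "(d, j) \<in> points (p_discs P)" "e = p_string P d j"
    using assms(2) by (auto simp: string_labels_def)
  obtain k where "k \<in> adjacent_segments (p_discs P) d j" "seg_shaded (p_discs P) d k = b"
    using adjacent_seg_ex[OF dj(1)] by blast
  then show ?thesis using dj side_tangle_of[OF assms(1) dj(1), of k] by blast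
qed

lemma card_points: "card (points ds) = length (point_list ds)"
  by (metis distinct_card distinct_point_list set_point_list)

lemma p_string_in_labels [simp]: "(d, j) \<in> points (p_discs P) \<Longrightarrow> p_string P d j \<in> set (string_labels P)"
  by (force simp: string_labels_def)

lemma p_region_in_labels [simp]: "(d, k) \<in> segments (p_discs P) \<Longrightarrow> p_region P d k \<in> set (region_labels P)"
  by (force simp: region_labels_def)

lemma shading_checkD:
  assumes "shading_check P" "(d, k) \<in> segments (p_discs P)" "(d', k') \<in> segments (p_discs P)"
    "p_region P d k = p_region P d' k'"
  shows "seg_shaded (p_discs P) d k = seg_shaded (p_discs P) d' k'"
  using assms unfolding shading_check_def Let_def list_all_iff set_segment_list by blast

lemma ends_checkD:
  assumes "ends_check P" "e \<in> set (string_labels P)"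
  shows "\<exists>d j d' j'. {(d, j) \<in> points (p_discs P). p_string P d j = e} = {(d, j), (d', j')} \<and>
           outgoing (p_discs P) d j \<and> \<not> outgoing (p_discs P) d' j'"
proof -
  let ?ds = "p_discs P"
  have "case filter (\<lambda>(d, j). p_string P d j = e) (point_list ?ds) of
          [p, q] \<Rightarrow> outgoing ?ds (fst p) (snd p) \<noteq> outgoing ?ds (fst q) (snd q) | _ \<Rightarrow> False"
    using assms unfolding ends_check_def Let_def list_all_iff by blast
  then obtain p q where pq: "filter (\<lambda>(d, j). p_string P d j = e) (point_list ?ds) = [p, q]"
      "outgoing ?ds (fst p) (snd p) \<noteq> outgoing ?ds (fst q) (snd q)"
    by (auto split: list.splits)
  have "set (filter (\<lambda>(d, j). p_string P d j = e) (point_list ?ds)) = {p, q}" by (simp add: pq(1))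
  then have "{(d, j) \<in> points ?ds. p_string P d j = e} = {p, q}" by auto
  moreover have "{p, q} = {(fst p, snd p), (fst q, snd q)}" "{p, q} = {(fst q, snd q), (fst p, snd p)}" by auto
  ultimately show ?thesis using pq(2) by metis
qed

lemma connection_classes_connected:
  assumes check: "planar_check P" and v: "v \<in> {..<length (p_discs P)} <+> set (region_labels P)"
  shows "(Inl 0, v) \<in> gen_equiv (connection_links (tangle_of P))"
proof -
  let ?ds = "p_discs P" and ?T = "tangle_of P"
  define vs :: "(nat + nat) list" where "vs = map Inl [0..<length ?ds] @ map (\<lambda>r. Inr r) (region_labels P)"
  define es :: "((nat + nat) \<times> (nat + nat)) list" where
    "es = map (\<lambda>(d, k). (Inl d, Inr (p_region P d k))) (segment_list ?ds) @
        map (\<lambda>(d, j). (Inr (p_region P d j), Inr (p_region P d (Suc j mod (2 * fst (?ds ! d)))))) (point_list ?ds)"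
  have ne: "?ds \<noteq> []" and len: "length (link_classes vs es) = 1"
    using check by (simp_all add: planar_check_def connection_classes_def vs_def es_def Let_def)
  have es: "(a, b) \<in> gen_equiv (connection_links ?T)" if "(a, b) \<in> set es" for a b
  proof -
    from that consider d k where "(d, k) \<in> segments ?ds" "a = Inl d" "b = Inr (p_region P d k)"
      | d j where "(d, j) \<in> points ?ds" "a = Inr (p_region P d j)" "b = Inr (p_region P d (Suc j mod num_points ?ds d))"
      by (auto simp: num_points_def es_def)
    then show ?thesis
    proof cases
      case 1
      then show ?thesis by (intro gen_equiv_base) (auto simp: connection_links_def)
    next
      case 2
      have adj: "j \<in> adjacent_segments ?ds d j" "Suc j mod num_points ?ds d \<in> adjacent_segments ?ds d j"
        by (auto simp: adjacent_segments_def)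
      note s = side_tangle_of[OF check 2(1) adj(1)] side_tangle_of[OF check 2(1) adj(2)] seg_shaded_Suc_mod[OF 2(1)]
      have m: "(Inr (side ?T (p_string P d j) True), Inr (side ?T (p_string P d j) False)) \<in> connection_links ?T"
        using 2(1) by (auto simp: connection_links_def)
      show ?thesis using 2 s m
        by (cases "seg_shaded ?ds d j") (auto intro: gen_equiv_base gen_equiv_sym)
    qed
  qed
  have mono: "(a, b) \<in> gen_equiv (connection_links ?T)" if "(a, b) \<in> gen_equiv (set es)" for a b
    using that unfolding gen_equiv_def[of "set es"]
  proof (induction rule: rtrancl_induct)
    case (step b c)
    from step.hyps(2) have "(b, c) \<in> set es \<or> (c, b) \<in> set es" by blast
    then have "(b, c) \<in> gen_equiv (connection_links ?T)"
      by (rule disjE) (erule es, erule gen_equiv_sym[OF es])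
    then show ?case by (rule gen_equiv_trans[OF step.IH])
  qed simp
  obtain c where c: "link_classes vs es = [c]"
    using len by (metis One_nat_def length_0_conv length_Suc_conv)
  have "set c = set vs" using link_classes_cover[of vs es] c by simp
  moreover have "Inl 0 \<in> set vs" using ne by (simp add: vs_def)
  moreover have "v \<in> set vs" using v by (auto simp: vs_def)
  ultimately show ?thesis by (intro mono link_classes_connected[of c vs]) (simp_all add: c)
qed

lemma card_boundary_curves:
  assumes check: "planar_check P"
  shows "card (boundary_curves (tangle_of P)) = length (curve_labels P)"
proof -
  let ?ds = "p_discs P" and ?T = "tangle_of P"
  note side = side_tangle_of[OF check]
  define vs where "vs = map Inl (segment_list ?ds) @
      map (\<lambda>p. Inr p) (List.product (string_labels P) [False, True])"
  define es :: "((nat \<times> nat + nat \<times> bool) \<times> (nat \<times> nat + nat \<times> bool)) list"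
    where "es = map (\<lambda>(d, j, k). (Inl (d, k), Inr (p_string P d j, seg_shaded ?ds d k))) (flag_list ?ds)"
  have es: "set es = boundary_links ?T"
    unfolding es_def boundary_links_def set_map set_flag_list tangle_of_sel
    by (auto intro!: rev_image_eqI)
  have vs: "set vs = segments ?ds <+> strings ?T \<times> UNIV"
    by (auto simp: vs_def image_iff UNIV_bool)
  define lab where "lab = (\<lambda>v. case v of
      Inl (d, k) \<Rightarrow> if fst (?ds ! d) = 0 then (True, d) else (False, p_region P d k)
    | Inr (e, b) \<Rightarrow> (False, side ?T e b))"
  have flag: "fst (?ds ! d) \<noteq> 0" if "(d, j) \<in> points ?ds" for d j
    using that by (auto simp: points_def num_points_def)
  have lab_edge: "lab a = lab b" if "(a, b) \<in> set es" for a b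
    using that side flag by (auto simp: es boundary_links_def lab_def)
  have lab_img: "lab ` set vs = set (curve_labels P)"
  proof -
    have "lab (Inr (e, b)) \<in> set (curve_labels P)" if e: "e \<in> set (string_labels P)" for e b
    proof -
      obtain d j k where x: "(d, j) \<in> points ?ds" "k \<in> adjacent_segments ?ds d j" "side ?T e b = p_region P d k"
        using side_tangle_of_ex[OF check e, of b] by blast
      have "(d, k) \<in> segments ?ds" using adjacent_in_segments[OF x(1,2)] .
      then have "(if fst (?ds ! d) = 0 then (True, d) else (False, p_region P d k)) \<in> set (curve_labels P)"
        by (force simp: curve_labels_def Let_def)
      then show ?thesis using x flag[OF x(1)] by (simp add: lab_def)
    qed
    moreover have "(\<lambda>s. lab (Inl s)) ` segments ?ds = set (curve_labels P)"
      by (simp add: curve_labels_def lab_def Let_def)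
    ultimately show ?thesis
      unfolding vs Plus_def image_Un image_image by (auto simp del: split_paired_All)
  qed
  have "length (link_classes vs es) \<le> length (curve_labels P)"
    using check unfolding planar_check_def curve_classes_def Let_def vs_def es_def by blast
  moreover have card: "card (lab ` set vs) = length (curve_labels P)"
    unfolding lab_img by (simp add: curve_labels_def length_remdups_card_conv Let_def)
  ultimately have "card (set vs // gen_equiv (set es)) = card (lab ` set vs)"
    using lab_edge by (intro card_quotient_gen_equiv link_classes_label) auto
  then have "card (set vs // gen_equiv (set es)) = length (curve_labels P)" using card by (rule trans)
  then show ?thesis unfolding boundary_curves_def es vs by simp
qed

lemma planar_check_sound:
  assumes check: "planar_check P"
  shows "planar_tangle (tangle_of P)"
proof -
  let ?ds = "p_discs P" and ?T = "tangle_of P"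
  have shading: "shading_check P" and ends: "ends_check P" and ne: "?ds \<noteq> []"
    and euler: "int (length ?ds) - int (length (point_list ?ds) div 2)
       + (2 * int (length (region_labels P)) - int (length (curve_labels P))) = 2"
    using check unfolding planar_check_def by blast+
  \<comment> \<open>A region counts as shaded if some segment on it is; \<open>shading_check\<close>
    makes this independent of the segment.\<close>
  let ?sh = "\<lambda>r. \<exists>d k. (d, k) \<in> segments ?ds \<and> p_region P d k = r \<and> seg_shaded ?ds d k"
  have sh: "?sh (p_region P d k) = seg_shaded ?ds d k" if "(d, k) \<in> segments ?ds" for d k
    using that shading_checkD[OF shading] by blast
  have sides: "side ?T e b \<in> set (region_labels P) \<and> ?sh (side ?T e b) = b"
    if e: "e \<in> set (string_labels P)" for e b
  proof -
    obtain d j k where x: "(d, j) \<in> points ?ds" "k \<in> adjacent_segments ?ds d j"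
        "side ?T e b = p_region P d k" "seg_shaded ?ds d k = b"
      using side_tangle_of_ex[OF check e, of b] by blast
    then show ?thesis using adjacent_in_segments[OF x(1,2)] sh by simp
  qed
  have card_regions: "card (set (region_labels P)) = length (region_labels P)"
    by (simp add: region_labels_def length_remdups_card_conv)
  show ?thesis
    unfolding planar_tangle_def tangle_of_sel
  proof (intro conjI)
    show "\<exists>shaded. (\<forall>(d, k)\<in>segments ?ds. shaded (p_region P d k) = seg_shaded ?ds d k) \<and>
        (\<forall>e\<in>set (string_labels P). \<forall>b. shaded (side ?T e b) = b)"
      using sh sides by (intro exI[of _ ?sh]) auto
    show "\<forall>e\<in>set (string_labels P). \<forall>b. side ?T e b \<in> set (region_labels P)" using sides by blast
    show "\<forall>e\<in>set (string_labels P). {(d, j). (d, j) \<in> points ?ds \<and> p_string P d j = e} = {} \<or>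
        (\<exists>d j d' j'. {(d, j). (d, j) \<in> points ?ds \<and> p_string P d j = e} = {(d, j), (d', j')} \<and>
           outgoing ?ds d j \<and> \<not> outgoing ?ds d' j')"
      using ends_checkD[OF ends] by blast
    show "\<forall>v\<in>{..<length ?ds} <+> set (region_labels P). (Inl 0, v) \<in> gen_equiv (connection_links ?T)"
      using connection_classes_connected[OF check] by blast
    show "int (length ?ds) - int (card (points ?ds) div 2) +
        (2 * int (card (set (region_labels P))) - int (card (boundary_curves ?T))) = 2"
      using euler by (simp only: card_points card_regions card_boundary_curves[OF check])
  qed (use side_tangle_of[OF check] ne in auto)
qed

lemma well_formedD:
  assumes "well_formed P"
  shows "length (fst (snd P)) = length (p_discs P)" "length (snd (snd P)) = length (p_discs P)"
    "d < length (p_discs P) \<Longrightarrow> length (fst (snd P) ! d) = num_points (p_discs P) d"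
    "d < length (p_discs P) \<Longrightarrow> length (snd (snd P) ! d) = num_segments (p_discs P) d"
proof -
  have *: "map length (fst (snd P)) = map (\<lambda>c. 2 * fst c) (p_discs P)"
    "map length (snd (snd P)) = map (\<lambda>c. max 1 (2 * fst c)) (p_discs P)"
    using assms by (auto simp: well_formed_def)
  show len: "length (fst (snd P)) = length (p_discs P)" "length (snd (snd P)) = length (p_discs P)"
    using *[THEN arg_cong[where f = length]] by simp_all
  show "d < length (p_discs P) \<Longrightarrow> length (fst (snd P) ! d) = num_points (p_discs P) d"
    "d < length (p_discs P) \<Longrightarrow> length (snd (snd P) ! d) = num_segments (p_discs P) d"
    using *[THEN arg_cong[where f = "\<lambda>l. l ! d"]] len by (simp_all add: num_points_def num_segments_def)
qed

text \<open>One entry is removed and all but the first of \<open>ys\<close> are inserted, so later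
  entries move by \<open>length ys - 2\<close>. The sum is formed before the subtraction, which
  matters on natural numbers when \<open>ys\<close> has length 1.\<close>

lemma nth_glue_outer:
  assumes "d < length xs" "d \<noteq> i" "i < length xs" "ys \<noteq> []"
  shows "glue f f' xs i ys ! (if d < i then d else d + length ys - 2) = f (xs ! d)"
proof (cases "d < i")
  case True
  then show ?thesis using assms by (simp add: glue_def nth_append)
next
  case False
  obtain e where e: "d = Suc i + e" using False assms(2) by (metis Suc_leI le_add_diff_inverse linorder_neqE_nat)
  obtain y ys' where ys: "ys = y # ys'" using assms(4) by (cases ys) auto
  show ?thesis using assms by (simp add: e ys glue_def nth_append)
qed

lemma nth_glue_inner:
  assumes "d < length ys" "d \<noteq> 0" "i < length xs"
  shows "glue f f' xs i ys ! (i + d - 1) = f' (ys ! d)"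
  using assms by (auto simp: glue_def nth_append nth_tl)

lemma p_discs_plug: "p_discs (plug T i S) = glue id id (p_discs T) i (p_discs S)"
  by (simp add: plug_def glue_def p_discs_def Let_def)

text \<open>The class indices that relabel the table are themselves the maps \<open>f\<close> and
  \<open>g\<close> demanded by \<open>tangle_comp\<close>.\<close>

lemma plug_check_sound:
  assumes pT: "planar_check T" and pS: "planar_check S" and check: "plug_check T i S"
  shows "tangle_comp (tangle_of T) i (tangle_of S) (tangle_of (plug T i S))"
proof -
  define R where "R = plug T i S"
  define fs where "fs = string_classes T i S"
  define gs where "gs = region_classes T i S"
  let ?f = "class_index fs" and ?g = "class_index gs"
  let ?dsT = "p_discs T" and ?dsS = "p_discs S" and ?dsR = "p_discs R"
  have pR: "planar_check R" and i: "0 < i" "i < length ?dsT" and hd: "hd ?dsS = ?dsT ! i"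
    and fe: "\<And>j. j < 2 * fst (?dsT ! i) \<Longrightarrow> ?f (Inl (p_string T i j)) = ?f (Inr (p_string S 0 j))"
    and ge: "\<And>k. k < max 1 (2 * fst (?dsT ! i)) \<Longrightarrow> ?g (Inl (p_region T i k)) = ?g (Inr (p_region S 0 k))"
    and fR: "?f ` set (glued_labels (string_labels T) (string_labels S)) = set (string_labels R)"
    and gR: "?g ` set (glued_labels (region_labels T) (region_labels S)) = set (region_labels R)"
    and sideT: "side_check (\<lambda>e. ?f (Inl e)) (\<lambda>r. ?g (Inl r)) T R"
    and sideS: "side_check (\<lambda>e. ?f (Inr e)) (\<lambda>r. ?g (Inr r)) S R"
    using check unfolding plug_check_def Let_def R_def fs_def gs_def
    by (auto simp: list_all_iff simp del: max_less_iff_conj less_max_iff_disj)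
  have wT: "well_formed T" and wS: "well_formed S" and neS: "?dsS \<noteq> []"
    using pT pS by (auto simp: planar_check_def)
  note lT = well_formedD[OF wT] and lS = well_formedD[OF wS]
  have neS': "fst (snd S) \<noteq> []" "snd (snd S) \<noteq> []" using neS lS(1,2) by auto
  have glued: "set (glued_labels xs ys) = set xs <+> set ys" for xs ys
    by (auto simp: glued_labels_def)
  have dR: "?dsR = take i ?dsT @ tl ?dsS @ drop (Suc i) ?dsT"
    by (simp add: R_def plug_def p_discs_def Let_def)
  have str: "fst (snd R) = glue (map (\<lambda>e. ?f (Inl e))) (map (\<lambda>e. ?f (Inr e))) (fst (snd T)) i (fst (snd S))"
    and reg: "snd (snd R) = glue (map (\<lambda>r. ?g (Inl r))) (map (\<lambda>r. ?g (Inr r))) (snd (snd T)) i (snd (snd S))"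
    by (simp_all add: R_def plug_def fs_def gs_def Let_def)
  have outer_string: "p_string R (if d < i then d else d + length ?dsS - 2) j = ?f (Inl (p_string T d j))"
    if "(d, j) \<in> points ?dsT" "d \<noteq> i" for d j
  proof -
    have "fst (snd R) ! (if d < i then d else d + length ?dsS - 2) = map (\<lambda>e. ?f (Inl e)) (fst (snd T) ! d)"
      unfolding str lS(1)[symmetric] by (rule nth_glue_outer) (use that i neS' lT lS in \<open>auto simp: points_def\<close>)
    then show ?thesis using that lT lS by (simp add: p_string_def points_def)
  qed
  have outer_region: "p_region R (if d < i then d else d + length ?dsS - 2) k = ?g (Inl (p_region T d k))"
    if "(d, k) \<in> segments ?dsT" "d \<noteq> i" for d k
  proof -
    have "snd (snd R) ! (if d < i then d else d + length ?dsS - 2) = map (\<lambda>r. ?g (Inl r)) (snd (snd T) ! d)"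
      unfolding reg lS(2)[symmetric] by (rule nth_glue_outer) (use that i neS' lT lS in \<open>auto simp: segments_def\<close>)
    then show ?thesis using that lT lS by (simp add: p_region_def segments_def)
  qed
  have inner_string: "p_string R (i + d - 1) j = ?f (Inr (p_string S d j))"
    if "(d, j) \<in> points ?dsS" "d \<noteq> 0" for d j
  proof -
    have "fst (snd R) ! (i + d - 1) = map (\<lambda>e. ?f (Inr e)) (fst (snd S) ! d)"
      unfolding str lS(1)[symmetric] by (rule nth_glue_inner) (use that i neS' lT lS in \<open>auto simp: points_def\<close>)
    then show ?thesis using that lT lS by (simp add: p_string_def points_def)
  qed
  have inner_region: "p_region R (i + d - 1) k = ?g (Inr (p_region S d k))"
    if "(d, k) \<in> segments ?dsS" "d \<noteq> 0" for d k
  proof -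
    have "snd (snd R) ! (i + d - 1) = map (\<lambda>r. ?g (Inr r)) (snd (snd S) ! d)"
      unfolding reg lS(2)[symmetric] by (rule nth_glue_inner) (use that i neS' lT lS in \<open>auto simp: segments_def\<close>)
    then show ?thesis using that lT lS by (simp add: p_region_def segments_def)
  qed
  have f_eq: "?f a = ?f b \<longleftrightarrow> (a, b) \<in> gen_equiv {(Inl (p_string T i j), Inr (p_string S 0 j)) | j. j < num_points ?dsT i}"
    if "a \<in> set (string_labels T) <+> set (string_labels S)" "b \<in> set (string_labels T) <+> set (string_labels S)" for a b
  proof -
    let ?es = "map (\<lambda>j. (Inl (p_string T i j), Inr (p_string S 0 j))) [0..<2 * fst (?dsT ! i)]"
    have "set ?es = {(Inl (p_string T i j), Inr (p_string S 0 j)) | j. j < num_points ?dsT i}"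
      by (auto simp: num_points_def)
    note E = this
    have "?f a = ?f b \<longleftrightarrow> (a, b) \<in> gen_equiv (set ?es)"
      unfolding fs_def string_classes_def
      by (rule class_index_link_classes) (use that fe in \<open>auto simp: glued fs_def string_classes_def\<close>)
    then show ?thesis unfolding E .
  qed
  have g_eq: "?g a = ?g b \<longleftrightarrow> (a, b) \<in> gen_equiv {(Inl (p_region T i k), Inr (p_region S 0 k)) | k. k < num_segments ?dsT i}"
    if "a \<in> set (region_labels T) <+> set (region_labels S)" "b \<in> set (region_labels T) <+> set (region_labels S)" for a b
  proof -
    let ?es = "map (\<lambda>k. (Inl (p_region T i k), Inr (p_region S 0 k))) [0..<max 1 (2 * fst (?dsT ! i))]"
    have "set ?es = {(Inl (p_region T i k), Inr (p_region S 0 k)) | k. k < num_segments ?dsT i}"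
      by (auto simp: num_points_def num_segments_def)
    note E = this
    have "?g a = ?g b \<longleftrightarrow> (a, b) \<in> gen_equiv (set ?es)"
      unfolding gs_def region_classes_def
      by (rule class_index_link_classes) (use that ge in \<open>auto simp: glued gs_def region_classes_def\<close>)
    then show ?thesis unfolding E .
  qed
  have side: "side (tangle_of R) (f' e) b = g' (side (tangle_of P) e b)"
    if P: "planar_check P" and sc: "side_check f' g' P R" and e: "e \<in> set (string_labels P)" for P f' g' e b
  proof -
    obtain d j k where x: "(d, j) \<in> points (p_discs P)" "k \<in> adjacent_segments (p_discs P) d j" "e = p_string P d j"
        "seg_shaded (p_discs P) d k = b" "side (tangle_of P) e b = p_region P d k"
      using side_tangle_of_ex[OF P e, of b] by blast
    have "(d, j, k) \<in> set (flag_list (p_discs P))" using x by (simp add: set_flag_list)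
    then obtain d' j' k' where y: "(d', j', k') \<in> set (flag_list ?dsR)" "p_string R d' j' = f' (p_string P d j)"
        "seg_shaded ?dsR d' k' = seg_shaded (p_discs P) d k" "p_region R d' k' = g' (p_region P d k)"
      using sc unfolding side_check_def list_all_iff list_ex_iff by blast
    then show ?thesis using side_tangle_of[OF pR, of d' j' k'] x by (simp add: set_flag_list)
  qed
  show ?thesis
    unfolding tangle_comp_def tangle_of_sel Let_def R_def[symmetric]
    by (intro conjI i hd dR exI[of _ ?f] exI[of _ ?g])
      (use fR gR f_eq g_eq outer_string outer_region inner_string inner_region side[OF pT sideT] side[OF pS sideS]
       in \<open>simp_all add: glued split_beta\<close>)
qed

lemma label_bijD:
  assumes "label_bij xs a b"
  shows "\<exists>f. bij_betw f (a ` set xs) (b ` set xs) \<and> (\<forall>x \<in> set xs. f (a x) = b x)"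
proof -
  have *: "a x = a y \<longleftrightarrow> b x = b y" if "x \<in> set xs" "y \<in> set xs" for x y
    using assms that by (simp add: label_bij_def list_all_iff)
  define f where "f c = b (SOME x. x \<in> set xs \<and> a x = c)" for c
  have f: "f (a x) = b x" if "x \<in> set xs" for x
  proof -
    have "(SOME y. y \<in> set xs \<and> a y = a x) \<in> set xs \<and> a (SOME y. y \<in> set xs \<and> a y = a x) = a x"
      by (rule someI) (use that in auto)
    then show ?thesis unfolding f_def using * that by blast
  qed
  have "bij_betw f (a ` set xs) (b ` set xs)"
    unfolding bij_betw_def inj_on_def image_image using * f by (auto simp: image_iff)
  then show ?thesis using f by blast
qed

lemma iso_check_sound:
  assumes pP: "planar_check P" and pQ: "planar_check Q" and check: "iso_check \<sigma> P Q"
  shows "tangle_iso ((!) \<sigma>) (tangle_of P) (tangle_of Q)"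
proof -
  let ?ds = "p_discs P" and ?s = "(!) \<sigma>"
  have len: "length (p_discs Q) = length ?ds" "length \<sigma> = length ?ds" and dist: "distinct \<sigma>" and s0: "\<sigma> ! 0 = 0"
    and col: "\<And>d. d < length ?ds \<Longrightarrow> \<sigma> ! d < length ?ds \<and> p_discs Q ! (\<sigma> ! d) = ?ds ! d"
    and lst: "label_bij (point_list ?ds) (\<lambda>(d, j). p_string P d j) (\<lambda>(d, j). p_string Q (\<sigma> ! d) j)"
    and lrg: "label_bij (segment_list ?ds) (\<lambda>(d, k). p_region P d k) (\<lambda>(d, k). p_region Q (\<sigma> ! d) k)"
    using check unfolding iso_check_def Let_def by (auto simp: list_all_iff)
  have bij: "bij_betw ?s {..<length ?ds} {..<length ?ds}"
  proof -
    have "inj_on ?s {..<length ?ds}" using dist len by (auto simp: inj_on_def nth_eq_iff_index_eq)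
    moreover have "?s ` {..<length ?ds} \<subseteq> {..<length ?ds}" using col by auto
    ultimately show ?thesis by (simp add: bij_betw_def endo_inj_surj)
  qed
  have pts: "points (p_discs Q) = (\<lambda>(d, j). (?s d, j)) ` points ?ds"
  proof -
    have "x \<in> (\<lambda>(d, j). (?s d, j)) ` points ?ds" if "x \<in> points (p_discs Q)" for x
    proof -
      obtain d j where x: "x = (d, j)" by (cases x)
      have "d \<in> ?s ` {..<length ?ds}"
        using that len bij_betw_imp_surj_on[OF bij] by (simp add: x points_def)
      then obtain d' where "d' < length ?ds" "d = ?s d'" by auto
      then show ?thesis using that col[of d'] by (auto simp: x points_def num_points_def image_iff)
    qed
    then show ?thesis using col len by (auto simp: points_def num_points_def)
  qed
  have sgs: "segments (p_discs Q) = (\<lambda>(d, j). (?s d, j)) ` segments ?ds"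
  proof -
    have "x \<in> (\<lambda>(d, j). (?s d, j)) ` segments ?ds" if "x \<in> segments (p_discs Q)" for x
    proof -
      obtain d j where x: "x = (d, j)" by (cases x)
      have "d \<in> ?s ` {..<length ?ds}"
        using that len bij_betw_imp_surj_on[OF bij] by (simp add: x segments_def)
      then obtain d' where "d' < length ?ds" "d = ?s d'" by auto
      then show ?thesis using that col[of d'] by (auto simp: x segments_def num_segments_def num_points_def image_iff)
    qed
    then show ?thesis using col len by (auto simp: segments_def num_segments_def num_points_def)
  qed
  from label_bijD[OF lst] obtain f where f0:
      "bij_betw f ((\<lambda>(d, j). p_string P d j) ` points ?ds) ((\<lambda>(d, j). p_string Q (\<sigma> ! d) j) ` points ?ds)"
      "\<forall>x \<in> points ?ds. f ((\<lambda>(d, j). p_string P d j) x) = (\<lambda>(d, j). p_string Q (\<sigma> ! d) j) x"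
    unfolding set_point_list by blast
  have f: "bij_betw f (set (string_labels P)) (set (string_labels Q))"
      "\<And>d j. (d, j) \<in> points ?ds \<Longrightarrow> p_string Q (?s d) j = f (p_string P d j)"
    using f0 by (auto simp: string_labels_def pts image_image split_beta)
  from label_bijD[OF lrg] obtain g where g0:
      "bij_betw g ((\<lambda>(d, k). p_region P d k) ` segments ?ds) ((\<lambda>(d, k). p_region Q (\<sigma> ! d) k) ` segments ?ds)"
      "\<forall>x \<in> segments ?ds. g ((\<lambda>(d, k). p_region P d k) x) = (\<lambda>(d, k). p_region Q (\<sigma> ! d) k) x"
    unfolding set_segment_list by blast
  have g: "bij_betw g (set (region_labels P)) (set (region_labels Q))"
      "\<And>d k. (d, k) \<in> segments ?ds \<Longrightarrow> p_region Q (?s d) k = g (p_region P d k)"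
    using g0 by (auto simp: region_labels_def sgs image_image split_beta)
  have side: "side (tangle_of Q) (f e) b = g (side (tangle_of P) e b)" if e: "e \<in> set (string_labels P)" for e b
  proof -
    obtain d j k where x: "(d, j) \<in> points ?ds" "k \<in> adjacent_segments ?ds d j" "e = p_string P d j"
        "seg_shaded ?ds d k = b" "side (tangle_of P) e b = p_region P d k"
      using side_tangle_of_ex[OF pP e, of b] by blast
    have d: "d < length ?ds" using x(1) by (simp add: points_def)
    have "(?s d, j) \<in> points (p_discs Q)" using x(1) pts by force
    moreover have "k \<in> adjacent_segments (p_discs Q) (?s d) j" "seg_shaded (p_discs Q) (?s d) k = b"
      using x col[OF d] by (auto simp: adjacent_segments_def num_points_def seg_shaded_def)
    ultimately show ?thesis
      using side_tangle_of[OF pQ, of "?s d" j k] f(2)[OF x(1)] g(2)[OF adjacent_in_segments[OF x(1,2)]] x by simp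
  qed
  show ?thesis
    unfolding tangle_iso_def tangle_of_sel
    using len(1) bij s0 col f g side by (intro conjI exI[of _ f] exI[of _ g]) (auto simp: split_beta)
qed

section \<open>From tables to tangles and reflected tangles\<close>

definition tangles_agree :: "tangle \<Rightarrow> tangle \<Rightarrow> bool" where
  "tangles_agree T T' \<longleftrightarrow> discs T' = discs T \<and> strings T' = strings T \<and> regions T' = regions T \<and> side T' = side T \<and>
     (\<forall>(d, j) \<in> points (discs T). string_at T' d j = string_at T d j) \<and>
     (\<forall>(d, k) \<in> segments (discs T). region_at T' d k = region_at T d k)"

lemma tangles_agree_planar:
  assumes a: "tangles_agree T T'" and p: "planar_tangle T"
  shows "planar_tangle T'"
proof -
  have eq: "discs T' = discs T" "strings T' = strings T" "regions T' = regions T" "side T' = side T"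
    and st: "\<And>d j. (d, j) \<in> points (discs T) \<Longrightarrow> string_at T' d j = string_at T d j"
    and rg: "\<And>d k. (d, k) \<in> segments (discs T) \<Longrightarrow> region_at T' d k = region_at T d k"
    using a by (auto simp: tangles_agree_def)
  have bl: "boundary_links T' = boundary_links T"
    unfolding boundary_links_def eq using st by (metis (no_types, lifting))
  have cl: "connection_links T' = connection_links T"
    unfolding connection_links_def eq using rg by (metis (no_types, lifting))
  have bc: "boundary_curves T' = boundary_curves T"
    unfolding boundary_curves_def eq bl ..
  have ends: "{(d, j) \<in> points (discs T). string_at T' d j = e} = {(d, j) \<in> points (discs T). string_at T d j = e}" for e
    using st by auto
  have 1: "(\<forall>(d, j) \<in> points (discs T). string_at T' d j \<in> strings T) \<longleftrightarrow> (\<forall>(d, j) \<in> points (discs T). string_at T d j \<in> strings T)"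
    using st by auto
  have 2: "(\<forall>(d, k) \<in> segments (discs T). region_at T' d k \<in> regions T) \<longleftrightarrow> (\<forall>(d, k) \<in> segments (discs T). region_at T d k \<in> regions T)"
    using rg by auto
  have 3: "(\<forall>(d, j) \<in> points (discs T). \<forall>k \<in> adjacent_segments (discs T) d j.
        side T (string_at T' d j) (seg_shaded (discs T) d k) = region_at T' d k) \<longleftrightarrow>
     (\<forall>(d, j) \<in> points (discs T). \<forall>k \<in> adjacent_segments (discs T) d j.
        side T (string_at T d j) (seg_shaded (discs T) d k) = region_at T d k)"
    using st rg adjacent_in_segments by (auto simp: split_beta)
  have 4: "(\<forall>(d, k) \<in> segments (discs T). sh (region_at T' d k) = seg_shaded (discs T) d k) \<longleftrightarrow>
      (\<forall>(d, k) \<in> segments (discs T). sh (region_at T d k) = seg_shaded (discs T) d k)" for sh :: "nat \<Rightarrow> bool"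
    using rg by auto
  show ?thesis using p unfolding planar_tangle_def eq cl bc ends 1 2 3 4 .
qed

lemma tangles_agree_iso: "tangles_agree T T' \<Longrightarrow> tangle_iso id T T'"
  unfolding tangle_iso_def tangles_agree_def
  by (auto intro!: exI[of _ id])

lemma tangles_agree_simple_tangle:
  assumes "\<And>d j. (d, j) \<in> points ds \<Longrightarrow> st' d j = st d j" "\<And>d k. (d, k) \<in> segments ds \<Longrightarrow> rg' d k = rg d k"
  shows "tangles_agree (simple_tangle ds st rg) (simple_tangle ds st' rg')"
proof -
  have "(\<exists>d j k. (d, j) \<in> points ds \<and> k \<in> adjacent_segments ds d j \<and> st' d j = e \<and> seg_shaded ds d k = b \<and> rg' d k = r)
    \<longleftrightarrow> (\<exists>d j k. (d, j) \<in> points ds \<and> k \<in> adjacent_segments ds d j \<and> st d j = e \<and> seg_shaded ds d k = b \<and> rg d k = r)" for e b r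
    by (intro iff_exI conj_cong refl) (simp_all add: assms adjacent_in_segments)
  then have "side (simple_tangle ds st' rg') = side (simple_tangle ds st rg)"
    by (simp add: simple_tangle_def)
  then show ?thesis using assms
    unfolding tangles_agree_def simple_tangle_sel by (auto simp: split_beta intro!: image_cong)
qed

lemma p_discs_tabulate [simp]: "p_discs (tabulate ds st rg) = ds"
  by (simp add: tabulate_def p_discs_def)

text \<open>A table fixes labels only at actual points and segments, while \<open>string_at\<close>
  and \<open>region_at\<close> are total functions. Equality of tangles may therefore fail, and
  agreement takes its place because it is an isotopy.\<close>

lemma tangles_agree_tabulate: "tangles_agree (tangle_of (tabulate ds st rg)) (simple_tangle ds st rg)"
  unfolding tangle_of_def p_discs_tabulate
  by (rule tangles_agree_simple_tangle)
    (auto simp: tabulate_def p_string_def p_region_def points_def segments_def num_points_def num_segments_def)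

lemma reflect_point: "(d, j) \<in> points ds \<Longrightarrow> (d, num_points ds d - 1 - j) \<in> points ds"
  by (auto simp: points_def)

lemma reflect_segment: "(d, k) \<in> segments ds \<Longrightarrow> (d, (num_points ds d - k) mod num_segments ds d) \<in> segments ds"
  by (auto simp: segments_def num_segments_def)

lemma reflect_reflect_segment:
  "(d, k) \<in> segments ds \<Longrightarrow> (num_points ds d - (num_points ds d - k) mod num_segments ds d) mod num_segments ds d = k"
  by (cases "num_points ds d = 0"; cases "k = 0") (auto simp: segments_def num_segments_def max_def)

text \<open>With n points, point j goes to n - 1 - j and segment k to n - k modulo n; the shading
  survives because n is even.\<close>

lemma reflect_adjacent:
  assumes "(d, j) \<in> points ds" "k \<in> adjacent_segments ds d j"
  shows "(num_points ds d - k) mod num_segments ds d \<in> adjacent_segments ds d (num_points ds d - 1 - j)"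
    "seg_shaded ds d ((num_points ds d - k) mod num_segments ds d) = seg_shaded ds d k"
proof -
  define n where "n = num_points ds d"
  have n: "num_segments ds d = n" "j < n" "even n"
    using assms(1) by (auto simp: n_def num_segments_def points_def num_points_def)
  have k: "k < n" using adjacent_in_segments[OF assms] n by (simp add: segments_def)
  have "k = j \<or> (Suc j < n \<and> k = Suc j) \<or> (Suc j = n \<and> k = 0)"
  proof -
    have "k = j \<or> k = Suc j mod n" using assms(2) by (auto simp: adjacent_segments_def n_def)
    moreover have "Suc j < n \<or> Suc j = n" using n(2) by linarith
    ultimately show ?thesis by auto
  qed
  then show "(num_points ds d - k) mod num_segments ds d \<in> adjacent_segments ds d (num_points ds d - 1 - j)"
    using n(2) unfolding adjacent_segments_def n_def[symmetric] n(1) by (auto simp: Suc_diff_Suc)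
  have "odd ((n - k) mod n) = odd k"
    using n(3) k by (cases "k = 0") auto
  then show "seg_shaded ds d ((num_points ds d - k) mod num_segments ds d) = seg_shaded ds d k"
    by (simp add: seg_shaded_def n_def[symmetric] n(1))
qed

text \<open>\<open>reflect_tangle\<close> keeps \<open>side\<close>, whereas
  \<open>simple_tangle\<close> recomputes it from the flags; the two coincide because reflection
  permutes the flags of each disc and preserves their shading.\<close>

lemma reflect_simple_tangle:
  "reflect_tangle (simple_tangle ds st rg) =
     simple_tangle ds (\<lambda>d j. st d (num_points ds d - 1 - j)) (\<lambda>d k. rg d ((num_points ds d - k) mod num_segments ds d))"
proof -
  let ?st = "\<lambda>d j. st d (num_points ds d - 1 - j)" and ?rg = "\<lambda>d k. rg d ((num_points ds d - k) mod num_segments ds d)"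
  have rr: "num_points ds d - 1 - (num_points ds d - 1 - j) = j" if "(d, j) \<in> points ds" for d j
    using that by (auto simp: points_def)
  have 1: "(\<exists>d j k. (d, j) \<in> points ds \<and> k \<in> adjacent_segments ds d j \<and> st d j = e \<and> seg_shaded ds d k = b \<and> rg d k = r)
    \<longleftrightarrow> (\<exists>d j k. (d, j) \<in> points ds \<and> k \<in> adjacent_segments ds d j \<and> ?st d j = e \<and> seg_shaded ds d k = b \<and> ?rg d k = r)"
    (is "?L \<longleftrightarrow> ?R") for e b r
  proof
    assume ?L
    then obtain d j k where x: "(d, j) \<in> points ds" "k \<in> adjacent_segments ds d j" "st d j = e" "seg_shaded ds d k = b" "rg d k = r"
      by blast
    show ?R
      by (rule exI[of _ d], rule exI[of _ "num_points ds d - 1 - j"],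
          rule exI[of _ "(num_points ds d - k) mod num_segments ds d"])
        (use x reflect_point[OF x(1)] reflect_adjacent[OF x(1,2)] rr[OF x(1)]
           reflect_reflect_segment[OF adjacent_in_segments[OF x(1,2)]] in simp)
  next
    assume ?R
    then obtain d j k where x: "(d, j) \<in> points ds" "k \<in> adjacent_segments ds d j" "?st d j = e" "seg_shaded ds d k = b" "?rg d k = r"
      by blast
    then show ?L using reflect_point[OF x(1)] reflect_adjacent[OF x(1,2)] by blast
  qed
  have 2: "{st d j | d j. (d, j) \<in> points ds} = {?st d j | d j. (d, j) \<in> points ds}"
    using rr reflect_point by (metis (no_types, opaque_lifting))
  have 3: "{rg d k | d k. (d, k) \<in> segments ds} = {?rg d k | d k. (d, k) \<in> segments ds}"
    using reflect_reflect_segment reflect_segment by (metis (no_types, opaque_lifting))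
  have side: "side (simple_tangle ds st rg) = side (simple_tangle ds ?st ?rg)"
    unfolding simple_tangle_def tangle.simps 1 ..
  have strings: "strings (simple_tangle ds st rg) = strings (simple_tangle ds ?st ?rg)"
    and regions: "regions (simple_tangle ds st rg) = regions (simple_tangle ds ?st ?rg)"
    unfolding simple_tangle_def tangle.simps by (fact 2, fact 3)
  show ?thesis
    by (rule tangle.equality)
      (simp_all add: reflect_tangle_def strings regions side del: simple_tangle_sel(4,5))
qed

lemma tangles_agree_reflectP:
  assumes "well_formed P"
  shows "tangles_agree (tangle_of (reflectP P)) (reflect_tangle (tangle_of P))"
proof -
  note len = well_formedD[OF assms]
  have d: "p_discs (reflectP P) = p_discs P" by (simp add: reflectP_def p_discs_def)
  have "p_string (reflectP P) d j = p_string P d (num_points (p_discs P) d - 1 - j)" if "(d, j) \<in> points (p_discs P)" for d j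
    using that len by (simp add: p_string_def reflectP_def points_def rev_nth)
  moreover have "p_region (reflectP P) d k = p_region P d ((num_points (p_discs P) d - k) mod num_segments (p_discs P) d)"
    if "(d, k) \<in> segments (p_discs P)" for d k
  proof -
    define row where "row = snd (snd P) ! d"
    define n where "n = num_points (p_discs P) d"
    have lr: "length row = max 1 n" "k < max 1 n" "d < length (snd (snd P))"
      using that len(2,4) by (auto simp: segments_def row_def n_def num_segments_def)
    have "(hd row # rev (tl row)) ! k = row ! ((n - k) mod max 1 n)"
    proof (cases k)
      case 0
      then show ?thesis using lr by (cases row) (auto simp: max_def split: if_splits)
    next
      case (Suc k')
      then show ?thesis using lr by (cases row) (auto simp: max_def rev_nth split: if_splits)
    qed
    then show ?thesis using lr(3) by (simp add: p_region_def reflectP_def row_def n_def num_segments_def)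
  qed
  ultimately show ?thesis
    unfolding tangle_of_def d reflect_simple_tangle by (intro tangles_agree_simple_tangle) auto
qed

lemma plug_check_planar: "plug_check T i S \<Longrightarrow> planar_check (plug T i S)"
  by (simp add: plug_check_def Let_def)

section \<open>The diagrams of the proof and their verification\<close>

definition present :: "tangle \<Rightarrow> presentation" where
  "present T = tabulate (discs T) (string_at T) (region_at T)"

lemma present_simple_tangle: "present (simple_tangle ds st rg) = tabulate ds st rg"
  by (simp add: present_def)

text \<open>The opposite rotation, through which a functional of \<open>v\<close> becomes a
  functional of the Fourier transform of \<open>v\<close>.\<close>

definition inverse_fourier :: "bool \<Rightarrow> presentation" where
  "inverse_fourier s = ([(2, s), (2, \<not> s)], [[1, 2, 3, 0], [0, 1, 2, 3]], [[1, 2, 3, 0], [0, 1, 2, 3]])"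

text \<open>
  \<open>left_half\<close> and \<open>two_box_half\<close> consist of the discs \<open>b\<close>, \<open>a\<close>, \<open>d\<^sup>*\<close> in the closed diagram of
  $tr((bb^* * aa^*)\,dd^*)$ and of the discs \<open>a\<close>, \<open>b\<close>, \<open>d\<^sup>*\<close> in that of $tr((aa^* * bb^*)\,dd^*)$; their output points
  are the strings crossing the axis of symmetry, counted clockwise from the outer region.
\<close>

definition left_half :: "bool \<Rightarrow> presentation" where
  "left_half s = ([(2, s), (1, s), (2, \<not> s), (1, s)],
     [[0, 1, 2, 3], [0, 4], [1, 2, 5, 4], [5, 3]],
     [[0, 1, 2, 3], [0, 1], [1, 2, 3, 0], [0, 3]])"

definition two_box_half :: "bool \<Rightarrow> presentation" where
  "two_box_half s = ([(3, s), (2, s), (2, s), (2, s)],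
     [[0, 1, 2, 3, 4, 5], [0, 1, 6, 7], [2, 3, 8, 6], [7, 8, 4, 5]],
     [[0, 1, 2, 3, 4, 5], [0, 1, 2, 6], [2, 3, 4, 6], [0, 6, 4, 5]])"

text \<open>Two 2-boxes side by side: strings 4 and 5 join the right-hand points of the first to the
  left-hand points of the second.\<close>

definition box_convolution :: "bool \<Rightarrow> presentation" where
  "box_convolution s = ([(2, s), (2, s), (2, s)],
     [[0, 1, 2, 3], [0, 4, 5, 3], [4, 1, 2, 5]],
     [[0, 1, 2, 3], [0, 1, 4, 3], [4, 1, 2, 3]])"

abbreviation "stackP n s \<equiv> present (stack_tangle n s)"
abbreviation "unitP n s \<equiv> present (unit_tangle n s)"
abbreviation "idP n s \<equiv> present (identity_tangle n s)"
abbreviation "closureP n s \<equiv> present (closure_tangle n s)"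
abbreviation "fourierP s \<equiv> present (fourier_tangle s)"
abbreviation "convP s \<equiv> present (convolution_tangle s)"
abbreviation "closed_stack n s \<equiv> plug (closureP n s) 1 (stackP n s)"
abbreviation "conv_trace1 s \<equiv> plug (closed_stack 1 s) 1 (convP s)"
abbreviation "conv_trace2 s \<equiv> plug (conv_trace1 s) 3 (stackP 1 s)"
abbreviation "conv_trace3 s \<equiv> plug (conv_trace2 s) 2 (stackP 2 (\<not> s))"
abbreviation "conv_trace4 s \<equiv> plug (conv_trace3 s) 1 (stackP 1 s)"
abbreviation "halves_trace1 s \<equiv> plug (closed_stack 2 s) 2 (reflectP (left_half s))"
abbreviation "halves_trace2 s \<equiv> plug (halves_trace1 s) 1 (left_half s)"
abbreviation "box_conv_trace1 s \<equiv> plug (closed_stack 2 s) 1 (box_convolution s)"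
abbreviation "box_conv_trace2 s \<equiv> plug (box_conv_trace1 s) 3 (stackP 2 s)"
abbreviation "box_conv_trace3 s \<equiv> plug (box_conv_trace2 s) 2 (stackP 2 s)"
abbreviation "box_conv_trace4 s \<equiv> plug (box_conv_trace3 s) 1 (stackP 2 s)"
abbreviation "two_box_trace1 s \<equiv> plug (closed_stack 3 s) 2 (reflectP (two_box_half s))"
abbreviation "two_box_trace2 s \<equiv> plug (two_box_trace1 s) 1 (two_box_half s)"

lemmas present_tangle = stack_tangle_def unit_tangle_def identity_tangle_def closure_tangle_def
  fourier_tangle_def convolution_tangle_def present_simple_tangle

text \<open>All arities are fixed here, so for each of the two shadings this and the following
  checks are closed computations.\<close>

lemma planar_checks [simp]:
  "planar_check (stackP 1 s)" "planar_check (stackP 2 s)" "planar_check (stackP 3 s)"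
  "planar_check (unitP 1 s)" "planar_check (unitP 2 s)" "planar_check (idP 1 s)" "planar_check (idP 2 s)"
  "planar_check (closureP 1 s)" "planar_check (closureP 2 s)" "planar_check (closureP 3 s)"
  "planar_check (fourierP s)" "planar_check (convP s)" "planar_check (inverse_fourier s)"
  "planar_check (box_convolution s)" "planar_check (left_half s)" "planar_check (two_box_half s)"
  "planar_check (reflectP (left_half s))" "planar_check (reflectP (two_box_half s))"
  unfolding present_tangle by (induct s; code_simp)+

lemma plug_checks_unit:
  "plug_check (stackP 1 s) 1 (unitP 1 s) \<and> plug_check (stackP 1 s) 2 (unitP 1 s)"
  "plug_check (stackP 2 s) 1 (unitP 2 s) \<and> plug_check (stackP 2 s) 2 (unitP 2 s)"
  "iso_check [0, 1] (plug (stackP 1 s) 1 (unitP 1 s)) (idP 1 s)"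
  "iso_check [0, 1] (plug (stackP 1 s) 2 (unitP 1 s)) (idP 1 s)"
  "iso_check [0, 1] (plug (stackP 2 s) 1 (unitP 2 s)) (idP 2 s)"
  "iso_check [0, 1] (plug (stackP 2 s) 2 (unitP 2 s)) (idP 2 s)"
  unfolding present_tangle by (induct s; code_simp)+

lemma plug_checks_assoc:
  "plug_check (stackP 1 s) 1 (stackP 1 s) \<and> plug_check (stackP 1 s) 2 (stackP 1 s)"
  "plug_check (stackP 2 s) 1 (stackP 2 s)"
  "plug_check (stackP 2 s) 2 (stackP 2 s)"
  "iso_check [0, 1, 2, 3] (plug (stackP 1 s) 1 (stackP 1 s)) (plug (stackP 1 s) 2 (stackP 1 s))"
  "iso_check [0, 1, 2, 3] (plug (stackP 2 s) 1 (stackP 2 s)) (plug (stackP 2 s) 2 (stackP 2 s))"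
  unfolding present_tangle by (induct s; code_simp)+

lemma plug_checks_fourier_unit:
  "plug_check (fourierP s) 1 (unitP 2 s)"
  "plug_check (convP s) 2 (plug (fourierP s) 1 (unitP 2 s))"
  "iso_check [0, 1] (plug (convP s) 2 (plug (fourierP s) 1 (unitP 2 s))) (idP 1 s)"
  unfolding present_tangle by (induct s; code_simp)+

lemma plug_checks_fourier_mult:
  "plug_check (box_convolution (\<not> s)) 2 (fourierP s)"
  "plug_check (plug (box_convolution (\<not> s)) 2 (fourierP s)) 1 (fourierP s)"
  "plug_check (fourierP s) 1 (stackP 2 s)"
  "iso_check [0, 1, 2] (plug (plug (box_convolution (\<not> s)) 2 (fourierP s)) 1 (fourierP s)) (plug (fourierP s) 1 (stackP 2 s))"
  unfolding present_tangle by (induct s; code_simp)+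

lemma plug_checks_conv:
  "plug_check (convP s) 1 (convP s)"
  "plug_check (convP s) 2 (box_convolution (\<not> s))"
  "iso_check [0, 1, 2, 3] (plug (convP s) 1 (convP s)) (plug (convP s) 2 (box_convolution (\<not> s)))"
  unfolding present_tangle by (induct s; code_simp)+

lemma plug_checks_inverse_fourier:
  "plug_check (inverse_fourier s) 1 (fourierP s)"
  "iso_check [0, 1] (plug (inverse_fourier s) 1 (fourierP s)) (idP 2 s)"
  unfolding present_tangle by (induct s; code_simp)+

lemma plug_checks_left_half:
  "plug_check (left_half s) 3 (unitP 1 s)"
  "plug_check (plug (left_half s) 3 (unitP 1 s)) 1 (unitP 1 s)"
  "iso_check [0, 1] (plug (plug (left_half s) 3 (unitP 1 s)) 1 (unitP 1 s)) (fourierP (\<not> s))"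
  unfolding present_tangle by (induct s; code_simp)+

lemma plug_checks_closure:
  "plug_check (closureP 1 s) 1 (stackP 1 s)"
  "plug_check (closureP 2 s) 1 (stackP 2 s)"
  "plug_check (closureP 3 s) 1 (stackP 3 s)"
  unfolding present_tangle by (induct s; code_simp)+

lemma plug_check_conv_trace1: "plug_check (closed_stack 1 s) 1 (convP s)" unfolding present_tangle by (induct s; code_simp)
lemma plug_check_conv_trace2: "plug_check (conv_trace1 s) 3 (stackP 1 s)" unfolding present_tangle by (induct s; code_simp)
lemma plug_check_conv_trace3: "plug_check (conv_trace2 s) 2 (stackP 2 (\<not> s))" unfolding present_tangle by (induct s; code_simp)
lemma plug_check_conv_trace4: "plug_check (conv_trace3 s) 1 (stackP 1 s)" unfolding present_tangle by (induct s; code_simp)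
lemma plug_check_halves_trace1: "plug_check (closed_stack 2 s) 2 (reflectP (left_half s))" unfolding present_tangle by (induct s; code_simp)
lemma plug_check_halves_trace2: "plug_check (halves_trace1 s) 1 (left_half s)" unfolding present_tangle by (induct s; code_simp)
text \<open>The permutation takes the factors from the order b, b', a, a', d, d' to the order b, a,
  d', b', a', d of the two halves.\<close>

lemma iso_check_conv_halves: "iso_check [0, 1, 4, 2, 5, 6, 3] (conv_trace4 s) (halves_trace2 s)" unfolding present_tangle by (induct s; code_simp)
lemma plug_check_box_conv_trace1: "plug_check (closed_stack 2 s) 1 (box_convolution s)" unfolding present_tangle by (induct s; code_simp)
lemma plug_check_box_conv_trace2: "plug_check (box_conv_trace1 s) 3 (stackP 2 s)" unfolding present_tangle by (induct s; code_simp)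
lemma plug_check_box_conv_trace3: "plug_check (box_conv_trace2 s) 2 (stackP 2 s)" unfolding present_tangle by (induct s; code_simp)
lemma plug_check_box_conv_trace4: "plug_check (box_conv_trace3 s) 1 (stackP 2 s)" unfolding present_tangle by (induct s; code_simp)
lemma plug_check_two_box_trace1: "plug_check (closed_stack 3 s) 2 (reflectP (two_box_half s))" unfolding present_tangle by (induct s; code_simp)
lemma plug_check_two_box_trace2: "plug_check (two_box_trace1 s) 1 (two_box_half s)" unfolding present_tangle by (induct s; code_simp)
text \<open>Here the order a, a', b, b', d, d' becomes a, b, d', a', b', d.\<close>

lemma iso_check_box_conv_two_box: "iso_check [0, 1, 4, 2, 5, 6, 3] (box_conv_trace4 s) (two_box_trace2 s)" unfolding present_tangle by (induct s; code_simp)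

lemma present_discs [simp]: "p_discs (present T) = discs T"
  by (simp add: present_def)

lemma stack_discs [simp]: "discs (stack_tangle n s) = [(n, s), (n, s), (n, s)]"
  and unit_discs [simp]: "discs (unit_tangle n s) = [(n, s)]"
  and identity_discs [simp]: "discs (identity_tangle n s) = [(n, s), (n, s)]"
  and closure_discs [simp]: "discs (closure_tangle n s) = [(0, s), (n, s)]"
  and fourier_discs [simp]: "discs (fourier_tangle s) = [(2, \<not> s), (2, s)]"
  and convolution_discs [simp]: "discs (convolution_tangle s) = [(1, s), (1, s), (2, \<not> s)]"
  and inverse_fourier_discs [simp]: "p_discs (inverse_fourier s) = [(2, s), (2, \<not> s)]"
  and left_half_discs [simp]: "p_discs (left_half s) = [(2, s), (1, s), (2, \<not> s), (1, s)]"
  and two_box_half_discs [simp]: "p_discs (two_box_half s) = [(3, s), (2, s), (2, s), (2, s)]"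
  and box_convolution_discs [simp]: "p_discs (box_convolution s) = [(2, s), (2, s), (2, s)]"
  and reflect_discs [simp]: "p_discs (reflectP P) = p_discs P"
  by (simp_all add: stack_tangle_def unit_tangle_def identity_tangle_def closure_tangle_def
     fourier_tangle_def convolution_tangle_def inverse_fourier_def left_half_def two_box_half_def
     box_convolution_def p_discs_def reflectP_def)

lemma plug_discs: "p_discs (plug T i S) = take i (p_discs T) @ tl (p_discs S) @ drop (Suc i) (p_discs T)"
  by (simp add: p_discs_plug glue_def)

lemmas [simp] = planar_checks[unfolded One_nat_def]

section \<open>Identities in a planar algebra obtained by isotopy\<close>

context planar_algebra
begin

definition actp :: "presentation \<Rightarrow> 'a list \<Rightarrow> 'a" where
  "actp P xs = act PA (tangle_of P) xs"

definition args :: "presentation \<Rightarrow> 'a list \<Rightarrow> bool" where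
  "args P xs \<longleftrightarrow> list_all2 (\<lambda>x c. x \<in> pspace PA (fst c) (snd c)) xs (tl (p_discs P))"

lemma tangle_args_tangle_of: "tangle_args PA (tangle_of P) xs \<longleftrightarrow> args P xs"
  by (simp add: tangle_args_def args_def split_beta')

lemma actp_closed:
  "planar_check P \<Longrightarrow> args P xs \<Longrightarrow> hd (p_discs P) = (n, s) \<Longrightarrow> actp P xs \<in> pspace PA n s"
  unfolding actp_def by (intro act_closed planar_check_sound) (simp_all add: tangle_args_tangle_of)

lemma actp_multilinear:
  assumes "planar_check P" "i < length xs" "args P (xs[i := x])" "args P (xs[i := y])"
  shows "actp P (xs[i := scl PA c x + y]) = scl PA c (actp P (xs[i := x])) + actp P (xs[i := y])"
  unfolding actp_def by (intro act_multilinear planar_check_sound) (use assms in \<open>simp_all add: tangle_args_tangle_of\<close>)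

lemma actp_plug:
  assumes "planar_check T" "planar_check S" "plug_check T i S" "args T (xs[i - 1 := actp S ys])" "args S ys"
  shows "actp (plug T i S) (take (i - 1) xs @ ys @ drop i xs) = actp T (xs[i - 1 := actp S ys])"
  using assms unfolding actp_def
  by (intro act_comp planar_check_sound plug_check_sound plug_check_planar) (simp_all add: tangle_args_tangle_of actp_def)

lemma actp_iso:
  assumes "planar_check P" "planar_check Q" "iso_check \<sigma> P Q" "args P xs" "args Q ys"
    and perm: "list_all (\<lambda>i. ys ! (\<sigma> ! Suc i - 1) = xs ! i) [0..<length xs]"
  shows "actp Q ys = actp P xs"
proof -
  have "ys ! (\<sigma> ! Suc i - 1) = xs ! i" if "i < length xs" for i
    using perm that by (simp add: list_all_iff)
  then show ?thesis
    unfolding actp_def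
    by (intro act_isotopy[OF _ _ iso_check_sound[OF assms(1-3)]])
      (use assms in \<open>simp_all add: planar_check_sound tangle_args_tangle_of\<close>)
qed

lemma act_agree:
  assumes "tangles_agree T T'" "planar_tangle T" "tangle_args PA T xs"
  shows "act PA T' xs = act PA T xs"
proof (rule act_isotopy[OF assms(2) tangles_agree_planar[OF assms(1,2)] tangles_agree_iso[OF assms(1)] assms(3)])
  show "tangle_args PA T' xs" using assms by (simp add: tangles_agree_def tangle_args_def)
qed simp

lemma act_present:
  assumes "planar_check (present T)" "args (present T) xs" "T = simple_tangle ds st rg"
  shows "act PA T xs = actp (present T) xs"
  using act_agree[OF tangles_agree_tabulate[of ds st rg] planar_check_sound] assms
  unfolding actp_def by (simp add: present_simple_tangle tangle_args_tangle_of)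

lemmas args_simps = args_def plug_discs

lemma pmult_actp:
  "planar_check (stackP n s) \<Longrightarrow> x \<in> pspace PA n s \<Longrightarrow> y \<in> pspace PA n s \<Longrightarrow> pmult PA n s x y = actp (stackP n s) [x, y]"
  unfolding pmult_def by (rule act_present[OF _ _ stack_tangle_def]) (simp_all add: args_simps)

lemma punit_actp: "planar_check (unitP n s) \<Longrightarrow> punit PA n s = actp (unitP n s) []"
  unfolding punit_def by (rule act_present[OF _ _ unit_tangle_def]) (simp_all add: args_simps)

lemma pclosure_actp:
  "planar_check (closureP n s) \<Longrightarrow> x \<in> pspace PA n s \<Longrightarrow> pclosure PA n s x = actp (closureP n s) [x]"
  unfolding pclosure_def by (rule act_present[OF _ _ closure_tangle_def]) (simp_all add: args_simps)

lemma pfourier_actp: "x \<in> pspace PA 2 s \<Longrightarrow> pfourier PA s x = actp (fourierP s) [x]"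
  unfolding pfourier_def by (rule act_present[OF _ _ fourier_tangle_def]) (simp_all add: args_simps)

lemma pconv_actp:
  "y \<in> pspace PA 1 s \<Longrightarrow> u \<in> pspace PA 2 (\<not> s) \<Longrightarrow> pconv PA s y u = actp (convP s) [y, u]"
  unfolding pconv_def by (rule act_present[OF _ _ convolution_tangle_def]) (simp_all add: args_simps)

lemma identity_actp: "planar_check (idP n s) \<Longrightarrow> x \<in> pspace PA n s \<Longrightarrow> actp (idP n s) [x] = x"
  using act_present[OF _ _ identity_tangle_def, of n s "[x]"] act_identity by (simp add: args_simps)

lemma pmult_closed: "planar_check (stackP n s) \<Longrightarrow> x \<in> pspace PA n s \<Longrightarrow> y \<in> pspace PA n s \<Longrightarrow> pmult PA n s x y \<in> pspace PA n s"
  by (simp add: pmult_actp actp_closed args_simps)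

lemma punit_closed: "planar_check (unitP n s) \<Longrightarrow> punit PA n s \<in> pspace PA n s"
  by (simp add: punit_actp actp_closed args_simps)

lemma pfourier_closed: "x \<in> pspace PA 2 s \<Longrightarrow> pfourier PA s x \<in> pspace PA 2 (\<not> s)"
  by (simp add: pfourier_actp actp_closed args_simps)

lemma pconv_closed: "y \<in> pspace PA 1 s \<Longrightarrow> u \<in> pspace PA 2 (\<not> s) \<Longrightarrow> pconv PA s y u \<in> pspace PA 1 s"
  by (simp add: pconv_actp actp_closed args_simps)

lemma lin_closed: "x \<in> pspace PA n s \<Longrightarrow> y \<in> pspace PA n s \<Longrightarrow> scl PA c x + y \<in> pspace PA n s"
proof -
  interpret vector_space "scl PA" by (rule ambient)
  show "x \<in> pspace PA n s \<Longrightarrow> y \<in> pspace PA n s \<Longrightarrow> scl PA c x + y \<in> pspace PA n s"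
    using subspace[of n s] by (simp add: subspace_add subspace_scale)
qed

lemma pmult_linear_left:
  "planar_check (stackP n s) \<Longrightarrow> x \<in> pspace PA n s \<Longrightarrow> y \<in> pspace PA n s \<Longrightarrow> z \<in> pspace PA n s \<Longrightarrow>
   pmult PA n s (scl PA c x + y) z = scl PA c (pmult PA n s x z) + pmult PA n s y z"
  using actp_multilinear[of "stackP n s" 0 "[x, z]" x y c] by (simp add: pmult_actp lin_closed args_simps)

lemma pmult_linear_right:
  "planar_check (stackP n s) \<Longrightarrow> x \<in> pspace PA n s \<Longrightarrow> y \<in> pspace PA n s \<Longrightarrow> z \<in> pspace PA n s \<Longrightarrow>
   pmult PA n s z (scl PA c x + y) = scl PA c (pmult PA n s z x) + pmult PA n s z y"
  using actp_multilinear[of "stackP n s" 1 "[z, x]" x y c] by (simp add: pmult_actp lin_closed args_simps)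

lemma pfourier_linear:
  "x \<in> pspace PA 2 s \<Longrightarrow> y \<in> pspace PA 2 s \<Longrightarrow> pfourier PA s (scl PA c x + y) = scl PA c (pfourier PA s x) + pfourier PA s y"
  using actp_multilinear[of "fourierP s" 0 "[x]" x y c] by (simp add: pfourier_actp lin_closed args_simps)

lemma pconv_linear_left:
  "x \<in> pspace PA 1 s \<Longrightarrow> y \<in> pspace PA 1 s \<Longrightarrow> u \<in> pspace PA 2 (\<not> s) \<Longrightarrow>
   pconv PA s (scl PA c x + y) u = scl PA c (pconv PA s x u) + pconv PA s y u"
  using actp_multilinear[of "convP s" 0 "[x, u]" x y c] by (simp add: pconv_actp lin_closed args_simps)

lemma pconv_linear_right:
  "u \<in> pspace PA 2 (\<not> s) \<Longrightarrow> v \<in> pspace PA 2 (\<not> s) \<Longrightarrow> y \<in> pspace PA 1 s \<Longrightarrow>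
   pconv PA s y (scl PA c u + v) = scl PA c (pconv PA s y u) + pconv PA s y v"
  using actp_multilinear[of "convP s" 1 "[y, u]" u v c] by (simp add: pconv_actp lin_closed args_simps)

text \<open>Filling one disc of the stack with vertical strings leaves the identity tangle. The
  checks are hypotheses because they are evaluated only for concrete \<open>n\<close>.\<close>

lemma plug_stack_unit:
  assumes "planar_check (stackP n s)" "planar_check (unitP n s)" "planar_check (idP n s)"
    and "plug_check (stackP n s) 1 (unitP n s)" "plug_check (stackP n s) 2 (unitP n s)"
    and "iso_check [0, 1] (plug (stackP n s) 1 (unitP n s)) (idP n s)"
    and "iso_check [0, 1] (plug (stackP n s) 2 (unitP n s)) (idP n s)"
    and x: "x \<in> pspace PA n s"
  shows "pmult PA n s (punit PA n s) x = x" "pmult PA n s x (punit PA n s) = x"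
proof -
  have u: "punit PA n s \<in> pspace PA n s" using assms by (simp add: punit_closed)
  have "pmult PA n s (punit PA n s) x = actp (plug (stackP n s) 1 (unitP n s)) [x]"
    using actp_plug[of "stackP n s" "unitP n s" 1 "[x, x]" "[]"] assms u
    by (simp add: pmult_actp args_simps punit_actp)
  also have "\<dots> = x"
    using actp_iso[OF plug_check_planar[OF assms(4)] assms(3) assms(6), of "[x]" "[x]"] identity_actp[OF assms(3) x] x
    by (simp add: args_simps)
  finally show "pmult PA n s (punit PA n s) x = x" .
  have "pmult PA n s x (punit PA n s) = actp (plug (stackP n s) 2 (unitP n s)) [x]"
    using actp_plug[of "stackP n s" "unitP n s" 2 "[x, x]" "[]"] assms u
    by (simp add: pmult_actp args_simps punit_actp)
  also have "\<dots> = x"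
    using actp_iso[OF plug_check_planar[OF assms(5)] assms(3) assms(7), of "[x]" "[x]"] identity_actp[OF assms(3) x] x
    by (simp add: args_simps)
  finally show "pmult PA n s x (punit PA n s) = x" .
qed

lemma punit_mult:
  assumes "n = 1 \<or> n = 2" "x \<in> pspace PA n s"
  shows "pmult PA n s (punit PA n s) x = x" "pmult PA n s x (punit PA n s) = x"
proof -
  have "pmult PA n s (punit PA n s) x = x \<and> pmult PA n s x (punit PA n s) = x"
    using assms(1)
  proof
    assume "n = 1"
    then show ?thesis using plug_stack_unit[of 1 s x] plug_checks_unit[of s] assms by simp
  next
    assume "n = 2"
    then show ?thesis using plug_stack_unit[of 2 s x] plug_checks_unit[of s] assms by simp
  qed
  then show "pmult PA n s (punit PA n s) x = x" "pmult PA n s x (punit PA n s) = x" by simp_all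
qed

lemma pmult_assoc_aux:
  assumes "planar_check (stackP n s)" "plug_check (stackP n s) 1 (stackP n s)" "plug_check (stackP n s) 2 (stackP n s)"
    and "iso_check [0, 1, 2, 3] (plug (stackP n s) 1 (stackP n s)) (plug (stackP n s) 2 (stackP n s))"
    and x: "x \<in> pspace PA n s" "y \<in> pspace PA n s" "z \<in> pspace PA n s"
  shows "pmult PA n s (pmult PA n s x y) z = pmult PA n s x (pmult PA n s y z)"
proof -
  note c = pmult_closed[OF assms(1)]
  have "pmult PA n s (pmult PA n s x y) z = actp (plug (stackP n s) 1 (stackP n s)) [x, y, z]"
    using actp_plug[of "stackP n s" "stackP n s" 1 "[x, z]" "[x, y]"] assms c
    by (simp add: pmult_actp args_simps)
  also have "\<dots> = actp (plug (stackP n s) 2 (stackP n s)) [x, y, z]"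
    by (rule actp_iso[symmetric, OF plug_check_planar[OF assms(2)] plug_check_planar[OF assms(3)] assms(4)])
      (use x in \<open>simp_all add: args_simps upt_rec\<close>)
  also have "\<dots> = pmult PA n s x (pmult PA n s y z)"
    using actp_plug[of "stackP n s" "stackP n s" 2 "[x, z]" "[y, z]"] assms c
    by (simp add: pmult_actp args_simps)
  finally show ?thesis .
qed

lemma pmult_assoc:
  assumes "n = 1 \<or> n = 2" "x \<in> pspace PA n s" "y \<in> pspace PA n s" "z \<in> pspace PA n s"
  shows "pmult PA n s (pmult PA n s x y) z = pmult PA n s x (pmult PA n s y z)"
  using assms(1)
proof
  assume "n = 1"
  then show ?thesis using pmult_assoc_aux[of 1 s x y z] plug_checks_assoc[of s] assms by simp
next
  assume "n = 2"
  then show ?thesis using pmult_assoc_aux[of 2 s x y z] plug_checks_assoc[of s] assms by simp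
qed

definition conv2 :: "bool \<Rightarrow> 'a \<Rightarrow> 'a \<Rightarrow> 'a" where
  "conv2 s u v = actp (box_convolution s) [u, v]"

definition fourier_inv :: "bool \<Rightarrow> 'a \<Rightarrow> 'a" where
  "fourier_inv s w = actp (inverse_fourier s) [w]"

definition half1 :: "bool \<Rightarrow> 'a \<Rightarrow> 'a \<Rightarrow> 'a \<Rightarrow> 'a" where
  "half1 s b a d = actp (left_half s) [b, a, d]"

definition half2 :: "bool \<Rightarrow> 'a \<Rightarrow> 'a \<Rightarrow> 'a \<Rightarrow> 'a" where
  "half2 s a b d = actp (two_box_half s) [a, b, d]"

lemma conv2_closed: "u \<in> pspace PA 2 s \<Longrightarrow> v \<in> pspace PA 2 s \<Longrightarrow> conv2 s u v \<in> pspace PA 2 s"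
  unfolding conv2_def by (rule actp_closed) (simp_all add: args_simps)

lemma fourier_inv_closed: "w \<in> pspace PA 2 (\<not> s) \<Longrightarrow> fourier_inv s w \<in> pspace PA 2 s"
  unfolding fourier_inv_def by (rule actp_closed) (simp_all add: args_simps)

lemma fourier_inv_linear:
  "x \<in> pspace PA 2 (\<not> s) \<Longrightarrow> y \<in> pspace PA 2 (\<not> s) \<Longrightarrow>
   fourier_inv s (scl PA c x + y) = scl PA c (fourier_inv s x) + fourier_inv s y"
  using actp_multilinear[of "inverse_fourier s" 0 "[x]" x y c] by (simp add: fourier_inv_def lin_closed args_simps)

lemma half1_closed:
  "b \<in> pspace PA 1 s \<Longrightarrow> a \<in> pspace PA 2 (\<not> s) \<Longrightarrow> d \<in> pspace PA 1 s \<Longrightarrow> half1 s b a d \<in> pspace PA 2 s"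
  unfolding half1_def by (rule actp_closed) (simp_all add: args_simps)

lemma half2_closed:
  "a \<in> pspace PA 2 s \<Longrightarrow> b \<in> pspace PA 2 s \<Longrightarrow> d \<in> pspace PA 2 s \<Longrightarrow> half2 s a b d \<in> pspace PA 3 s"
  unfolding half2_def by (rule actp_closed) (simp_all add: args_simps)

lemma fourier_inv_fourier:
  assumes x: "x \<in> pspace PA 2 s"
  shows "fourier_inv s (pfourier PA s x) = x"
proof -
  note c = plug_checks_inverse_fourier[of s]
  have "fourier_inv s (pfourier PA s x) = actp (plug (inverse_fourier s) 1 (fourierP s)) [x]"
    using actp_plug[of "inverse_fourier s" "fourierP s" 1 "[x]" "[x]"] c x pfourier_closed[OF x]
    by (simp add: fourier_inv_def pfourier_actp args_simps)
  also have "\<dots> = x"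
    using actp_iso[OF plug_check_planar[OF c(1)] _ c(2), of "[x]" "[x]"] identity_actp[of 2 s x] x
    by (simp add: args_simps)
  finally show ?thesis .
qed

text \<open>Rotated, the two strings of the unit join top to top and bottom to bottom, so convolving
  with them only lengthens the strings of \<open>y\<close>.\<close>

lemma pconv_fourier_unit:
  assumes y: "y \<in> pspace PA 1 s"
  shows "pconv PA s y (pfourier PA s (punit PA 2 s)) = y"
proof -
  note c = plug_checks_fourier_unit[of s]
  have u: "punit PA 2 s \<in> pspace PA 2 s" by (simp add: punit_closed)
  have 1: "pfourier PA s (punit PA 2 s) = actp (plug (fourierP s) 1 (unitP 2 s)) []"
    using actp_plug[of "fourierP s" "unitP 2 s" 1 "[u]" "[]"] c u
    by (simp add: punit_actp pfourier_actp args_simps)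
  have "pconv PA s y (pfourier PA s (punit PA 2 s)) = actp (plug (convP s) 2 (plug (fourierP s) 1 (unitP 2 s))) [y]"
    using actp_plug[of "convP s" "plug (fourierP s) 1 (unitP 2 s)" 2 "[y, y]" "[]"] c y pfourier_closed[OF u] plug_check_planar[OF c(1)]
    by (simp add: 1 pconv_actp args_simps)
  also have "\<dots> = y"
    using actp_iso[OF plug_check_planar[OF c(2)] _ c(3), of "[y]" "[y]"] identity_actp[of 1 s y] y
    by (simp add: args_simps)
  finally show ?thesis .
qed

text \<open>Both sides are three boxes in a row. Together with \<open>pfourier_pmult\<close> this
  makes the passage from \<open>x\<close> to convolution with its Fourier transform reverse
  products.\<close>

lemma pconv_pconv:
  assumes y: "y \<in> pspace PA 1 s" and u: "u \<in> pspace PA 2 (\<not> s)" and v: "v \<in> pspace PA 2 (\<not> s)"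
  shows "pconv PA s (pconv PA s y u) v = pconv PA s y (conv2 (\<not> s) u v)"
proof -
  note c = plug_checks_conv[of s]
  have "pconv PA s (pconv PA s y u) v = actp (plug (convP s) 1 (convP s)) [y, u, v]"
    using actp_plug[of "convP s" "convP s" 1 "[y, v]" "[y, u]"] c y u v pconv_closed[OF y u]
    by (simp add: pconv_actp args_simps)
  also have "\<dots> = actp (plug (convP s) 2 (box_convolution (\<not> s))) [y, u, v]"
    by (rule actp_iso[symmetric, OF plug_check_planar[OF c(1)] plug_check_planar[OF c(2)] c(3)])
      (use y u v in \<open>simp_all add: args_simps upt_rec\<close>)
  also have "\<dots> = pconv PA s y (conv2 (\<not> s) u v)"
    using actp_plug[of "convP s" "box_convolution (\<not> s)" 2 "[y, v]" "[u, v]"] c y u v conv2_closed[OF u v]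
    by (simp add: pconv_actp conv2_def args_simps)
  finally show ?thesis .
qed

text \<open>A quarter turn carries vertically stacked boxes to boxes side by side.\<close>

lemma pfourier_pmult:
  assumes x: "x \<in> pspace PA 2 s" and y: "y \<in> pspace PA 2 s"
  shows "pfourier PA s (pmult PA 2 s x y) = conv2 (\<not> s) (pfourier PA s x) (pfourier PA s y)"
proof -
  note c = plug_checks_fourier_mult[of s]
  note F = pfourier_closed[OF x] pfourier_closed[OF y]
  have "pfourier PA s (pmult PA 2 s x y) = actp (plug (fourierP s) 1 (stackP 2 s)) [x, y]"
    using actp_plug[of "fourierP s" "stackP 2 s" 1 "[x]" "[x, y]"] c x y pmult_closed[of 2 s x y]
    by (simp add: pfourier_actp pmult_actp args_simps)
  also have "\<dots> = actp (plug (plug (box_convolution (\<not> s)) 2 (fourierP s)) 1 (fourierP s)) [x, y]"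
    by (rule actp_iso[OF plug_check_planar[OF c(2)] plug_check_planar[OF c(3)] c(4)])
      (use x y in \<open>simp_all add: args_simps upt_rec\<close>)
  also have "\<dots> = actp (plug (box_convolution (\<not> s)) 2 (fourierP s)) [pfourier PA s x, y]"
    using actp_plug[of "plug (box_convolution (\<not> s)) 2 (fourierP s)" "fourierP s" 1 "[x, y]" "[x]"] c x y F
      plug_check_planar[OF c(1)]
    by (simp add: pfourier_actp args_simps)
  also have "\<dots> = conv2 (\<not> s) (pfourier PA s x) (pfourier PA s y)"
    using actp_plug[of "box_convolution (\<not> s)" "fourierP s" 2 "[pfourier PA s x, y]" "[y]"] c x y F
    by (simp add: pfourier_actp conv2_def args_simps)
  finally show ?thesis .
qed

text \<open>With both 1-boxes reduced to strings, the half diagram only permutes the ends of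
  \<open>a\<close> cyclically; this identifies the quadratic form in
  \<open>trc_conv_unit\<close>.\<close>

lemma half1_unit:
  assumes a: "a \<in> pspace PA 2 (\<not> s)"
  shows "half1 s (punit PA 1 s) a (punit PA 1 s) = pfourier PA (\<not> s) a"
proof -
  note c = plug_checks_left_half[of s]
  have u: "punit PA 1 s \<in> pspace PA 1 s" by (simp add: punit_closed)
  have "half1 s (punit PA 1 s) a (punit PA 1 s) = actp (plug (left_half s) 3 (unitP 1 s)) [punit PA 1 s, a]"
    using actp_plug[of "left_half s" "unitP 1 s" 3 "[punit PA 1 s, a, a]" "[]"] c a u
    by (simp add: half1_def punit_actp args_simps)
  also have "\<dots> = actp (plug (plug (left_half s) 3 (unitP 1 s)) 1 (unitP 1 s)) [a]"
    using actp_plug[of "plug (left_half s) 3 (unitP 1 s)" "unitP 1 s" 1 "[a, a]" "[]"] c a u plug_check_planar[OF c(1)]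
    by (simp add: punit_actp args_simps)
  also have "\<dots> = actp (fourierP (\<not> s)) [a]"
    by (rule actp_iso[symmetric, OF plug_check_planar[OF c(2)] _ c(3)]) (use a in \<open>simp_all add: args_simps upt_rec\<close>)
  finally show ?thesis using a by (simp add: pfourier_actp)
qed

lemma closure_pmult:
  assumes n: "n = 1 \<or> n = 2 \<or> n = 3" and x: "x \<in> pspace PA n s" "y \<in> pspace PA n s"
  shows "pclosure PA n s (pmult PA n s x y) = actp (closed_stack n s) [x, y]"
proof -
  have p: "planar_check (closureP n s)" "planar_check (stackP n s)" "plug_check (closureP n s) 1 (stackP n s)"
    using n plug_checks_closure[of s] by auto
  show ?thesis
    using actp_plug[of "closureP n s" "stackP n s" 1 "[x]" "[x, y]"] p x pmult_closed[OF p(2) x]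
    by (simp add: pclosure_actp pmult_actp args_simps)
qed

lemma planar_check_closed_stack [simp]: "planar_check (closed_stack 1 s)" "planar_check (closed_stack 2 s)" "planar_check (closed_stack 3 s)"
  using plug_checks_closure[of s] plug_check_planar by blast+

lemmas [simp] = planar_check_closed_stack[unfolded One_nat_def]

text \<open>An identity of tangles with six unrelated arguments; adjoints enter only in
  \<open>trc_conv\<close>. All factors are inserted into one closed diagram, which is deformed and
  then read as the closure of two stacked half diagrams.\<close>

lemma closure_conv:
  assumes b: "b \<in> pspace PA 1 s" "b' \<in> pspace PA 1 s" and a: "a \<in> pspace PA 2 (\<not> s)" "a' \<in> pspace PA 2 (\<not> s)"
    and d: "d \<in> pspace PA 1 s" "d' \<in> pspace PA 1 s"
  shows "pclosure PA 1 s (pmult PA 1 s (pconv PA s (pmult PA 1 s b b') (pmult PA 2 (\<not> s) a a')) (pmult PA 1 s d d'))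
    = pclosure PA 2 s (pmult PA 2 s (half1 s b a d') (actp (reflectP (left_half s)) [b', a', d]))"
proof -
  let ?y = "pmult PA 1 s b b'" and ?u = "pmult PA 2 (\<not> s) a a'" and ?e = "pmult PA 1 s d d'"
  have m: "?y \<in> pspace PA 1 s" "?u \<in> pspace PA 2 (\<not> s)" "?e \<in> pspace PA 1 s" using b a d by (simp_all add: pmult_closed)
  have K: "planar_check (conv_trace1 s)" "planar_check (conv_trace2 s)" "planar_check (conv_trace3 s)" "planar_check (conv_trace4 s)" "planar_check (halves_trace1 s)" "planar_check (halves_trace2 s)"
    using plug_check_planar plug_check_conv_trace1 plug_check_conv_trace2 plug_check_conv_trace3 plug_check_conv_trace4 plug_check_halves_trace1 plug_check_halves_trace2 by blast+
  let ?g = "half1 s b a d'" and ?h = "actp (reflectP (left_half s)) [b', a', d]"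
  have g: "?g \<in> pspace PA 2 s" "?h \<in> pspace PA 2 s"
    using b a d half1_closed[of b s a d'] actp_closed[of "reflectP (left_half s)" "[b', a', d]" 2 s] by (simp_all add: args_simps)
  have "pclosure PA 1 s (pmult PA 1 s (pconv PA s ?y ?u) ?e) = actp (closed_stack 1 s) [pconv PA s ?y ?u, ?e]"
    using m pconv_closed by (intro closure_pmult) auto
  also have "\<dots> = actp (conv_trace1 s) [?y, ?u, ?e]"
    using actp_plug[of "closed_stack 1 s" "convP s" 1 "[?e, ?e]" "[?y, ?u]"] plug_check_conv_trace1[of s] m pconv_closed[OF m(1,2)]
    by (simp add: pconv_actp args_simps)
  \<comment> \<open>The inputs are expanded from the last to the first, so that the numbers of those
    still to be expanded do not change.\<close>
  also have "\<dots> = actp (conv_trace2 s) [?y, ?u, d, d']"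
    using actp_plug[of "conv_trace1 s" "stackP 1 s" 3 "[?y, ?u, ?e]" "[d, d']"] plug_check_conv_trace2[of s] m d K
    by (simp add: pmult_actp args_simps)
  also have "\<dots> = actp (conv_trace3 s) [?y, a, a', d, d']"
    using actp_plug[of "conv_trace2 s" "stackP 2 (\<not> s)" 2 "[?y, ?u, d, d']" "[a, a']"] plug_check_conv_trace3[of s] m d a K
    by (simp add: pmult_actp args_simps)
  also have "\<dots> = actp (conv_trace4 s) [b, b', a, a', d, d']"
    using actp_plug[of "conv_trace3 s" "stackP 1 s" 1 "[?y, a, a', d, d']" "[b, b']"] plug_check_conv_trace4[of s] m d a b K
    by (simp add: pmult_actp args_simps)
  also have "\<dots> = actp (halves_trace2 s) [b, a, d', b', a', d]"
    by (rule actp_iso[symmetric, OF K(4,6) iso_check_conv_halves]) (use a b d in \<open>simp_all add: args_simps upt_rec\<close>)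
  also have "\<dots> = actp (halves_trace1 s) [?g, b', a', d]"
    using actp_plug[of "halves_trace1 s" "left_half s" 1 "[?g, b', a', d]" "[b, a, d']"] plug_check_halves_trace2[of s] g d a b K
    by (simp add: half1_def args_simps)
  also have "\<dots> = actp (closed_stack 2 s) [?g, ?h]"
    using actp_plug[of "closed_stack 2 s" "reflectP (left_half s)" 2 "[?g, ?h]" "[b', a', d]"] plug_check_halves_trace1[of s] g d a b K
    by (simp add: args_simps)
  also have "\<dots> = pclosure PA 2 s (pmult PA 2 s ?g ?h)"
    by (rule closure_pmult[symmetric]) (use g in auto)
  finally show ?thesis .
qed

lemma closure_conv2:
  assumes a: "a \<in> pspace PA 2 s" "a' \<in> pspace PA 2 s" and b: "b \<in> pspace PA 2 s" "b' \<in> pspace PA 2 s"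
    and d: "d \<in> pspace PA 2 s" "d' \<in> pspace PA 2 s"
  shows "pclosure PA 2 s (pmult PA 2 s (conv2 s (pmult PA 2 s a a') (pmult PA 2 s b b')) (pmult PA 2 s d d'))
    = pclosure PA 3 s (pmult PA 3 s (half2 s a b d') (actp (reflectP (two_box_half s)) [a', b', d]))"
proof -
  let ?u = "pmult PA 2 s a a'" and ?v = "pmult PA 2 s b b'" and ?e = "pmult PA 2 s d d'"
  have m: "?u \<in> pspace PA 2 s" "?v \<in> pspace PA 2 s" "?e \<in> pspace PA 2 s" using b a d by (simp_all add: pmult_closed)
  have K: "planar_check (box_conv_trace1 s)" "planar_check (box_conv_trace2 s)" "planar_check (box_conv_trace3 s)" "planar_check (box_conv_trace4 s)" "planar_check (two_box_trace1 s)" "planar_check (two_box_trace2 s)"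
    using plug_check_planar plug_check_box_conv_trace1 plug_check_box_conv_trace2 plug_check_box_conv_trace3 plug_check_box_conv_trace4 plug_check_two_box_trace1 plug_check_two_box_trace2 by blast+
  let ?g = "half2 s a b d'" and ?h = "actp (reflectP (two_box_half s)) [a', b', d]"
  have g: "?g \<in> pspace PA 3 s" "?h \<in> pspace PA 3 s"
    using b a d half2_closed[of a s b d'] actp_closed[of "reflectP (two_box_half s)" "[a', b', d]" 3 s] by (simp_all add: args_simps)
  have "pclosure PA 2 s (pmult PA 2 s (conv2 s ?u ?v) ?e) = actp (closed_stack 2 s) [conv2 s ?u ?v, ?e]"
    using m conv2_closed by (intro closure_pmult) auto
  also have "\<dots> = actp (box_conv_trace1 s) [?u, ?v, ?e]"
    using actp_plug[of "closed_stack 2 s" "box_convolution s" 1 "[?e, ?e]" "[?u, ?v]"] plug_check_box_conv_trace1[of s] m conv2_closed[OF m(1,2)]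
    by (simp add: conv2_def args_simps)
  also have "\<dots> = actp (box_conv_trace2 s) [?u, ?v, d, d']"
    using actp_plug[of "box_conv_trace1 s" "stackP 2 s" 3 "[?u, ?v, ?e]" "[d, d']"] plug_check_box_conv_trace2[of s] m d K
    by (simp add: pmult_actp args_simps)
  also have "\<dots> = actp (box_conv_trace3 s) [?u, b, b', d, d']"
    using actp_plug[of "box_conv_trace2 s" "stackP 2 s" 2 "[?u, ?v, d, d']" "[b, b']"] plug_check_box_conv_trace3[of s] m d b K
    by (simp add: pmult_actp args_simps)
  also have "\<dots> = actp (box_conv_trace4 s) [a, a', b, b', d, d']"
    using actp_plug[of "box_conv_trace3 s" "stackP 2 s" 1 "[?u, b, b', d, d']" "[a, a']"] plug_check_box_conv_trace4[of s] m d a b K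
    by (simp add: pmult_actp args_simps)
  also have "\<dots> = actp (two_box_trace2 s) [a, b, d', a', b', d]"
    by (rule actp_iso[symmetric, OF K(4,6) iso_check_box_conv_two_box]) (use a b d in \<open>simp_all add: args_simps upt_rec\<close>)
  also have "\<dots> = actp (two_box_trace1 s) [?g, a', b', d]"
    using actp_plug[of "two_box_trace1 s" "two_box_half s" 1 "[?g, a', b', d]" "[a, b, d']"] plug_check_two_box_trace2[of s] g d a b K
    by (simp add: half2_def args_simps)
  also have "\<dots> = actp (closed_stack 3 s) [?g, ?h]"
    using actp_plug[of "closed_stack 3 s" "reflectP (two_box_half s)" 2 "[?g, ?h]" "[a', b', d]"] plug_check_two_box_trace1[of s] g d a b K
    by (simp add: args_simps)
  also have "\<dots> = pclosure PA 3 s (pmult PA 3 s ?g ?h)"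
    by (rule closure_pmult[symmetric]) (use g in auto)
  finally show ?thesis .
qed

end

section \<open>Traces of the symmetric closed diagrams\<close>

context cstar_planar_algebra
begin

lemma invol_actp:
  assumes p: "planar_check P" "planar_check (reflectP P)" and xs: "args P xs" and hd: "hd (p_discs P) = (n, s)"
    and xs': "args (reflectP P) (map2 (\<lambda>(m, t) x. invol PA m t x) (tl (p_discs P)) xs)"
  shows "invol PA n s (actp P xs) = actp (reflectP P) (map2 (\<lambda>(m, t) x. invol PA m t x) (tl (p_discs P)) xs)"
proof -
  have w: "well_formed P" using p by (simp add: planar_check_def)
  have "act PA (reflect_tangle (tangle_of P)) (map2 (\<lambda>(m, t) x. invol PA m t x) (tl (p_discs P)) xs)
      = actp (reflectP P) (map2 (\<lambda>(m, t) x. invol PA m t x) (tl (p_discs P)) xs)"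
    unfolding actp_def
    by (rule act_agree[OF tangles_agree_reflectP[OF w] planar_check_sound[OF p(2)]]) (use xs' in \<open>simp add: tangle_args_tangle_of\<close>)
  then show ?thesis
    using invol_reflect[of "tangle_of P" xs n s] planar_check_sound[OF p(1)] xs hd by (simp add: tangle_args_tangle_of actp_def)
qed

lemma trc_conv:
  assumes b: "b \<in> pspace PA 1 s" and a: "a \<in> pspace PA 2 (\<not> s)" and d: "d \<in> pspace PA 1 s"
  defines "g \<equiv> half1 s b a (invol PA 1 s d)"
  shows "trc PA 1 s (pmult PA 1 s (pconv PA s (pmult PA 1 s b (invol PA 1 s b)) (pmult PA 2 (\<not> s) a (invol PA 2 (\<not> s) a)))
      (pmult PA 1 s d (invol PA 1 s d))) = trc PA 2 s (pmult PA 2 s g (invol PA 2 s g))"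
proof -
  have st: "invol PA 1 s b \<in> pspace PA 1 s" "invol PA 2 (\<not> s) a \<in> pspace PA 2 (\<not> s)" "invol PA 1 s d \<in> pspace PA 1 s"
    using a b d by (simp_all add: invol_closed)
  have g: "g \<in> pspace PA 2 s" unfolding g_def using a b st by (simp add: half1_closed)
  \<comment> \<open>The adjoint of the first half is its mirror image filled with adjoints, so the
    third box \<open>invol PA 1 s d\<close> turns back into \<open>d\<close>; this is exactly the
    second half.\<close>
  have ig: "invol PA 2 s g = actp (reflectP (left_half s)) [invol PA 1 s b, invol PA 2 (\<not> s) a, d]"
    using invol_actp[of "left_half s" "[b, a, invol PA 1 s d]" 2 s] a b d st
    by (simp add: g_def half1_def args_simps invol_invol)
  let ?X = "pmult PA 1 s (pconv PA s (pmult PA 1 s b (invol PA 1 s b)) (pmult PA 2 (\<not> s) a (invol PA 2 (\<not> s) a)))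
      (pmult PA 1 s d (invol PA 1 s d))"
  have "trc PA 1 s ?X = trc PA 0 s (pclosure PA 1 s ?X)"
    by (intro trc_closure pmult_closed pconv_closed planar_checks a b d st)
  also have "pclosure PA 1 s ?X = pclosure PA 2 s (pmult PA 2 s g (invol PA 2 s g))"
    unfolding ig unfolding g_def by (rule closure_conv[OF b st(1) a st(2) d st(3)])
  also have "trc PA 0 s \<dots> = trc PA 2 s (pmult PA 2 s g (invol PA 2 s g))"
    by (intro trc_closure[symmetric] pmult_closed planar_checks g invol_closed)
  finally show ?thesis .
qed

lemma trc_conv2:
  assumes a: "a \<in> pspace PA 2 s" and b: "b \<in> pspace PA 2 s" and d: "d \<in> pspace PA 2 s"
  defines "g \<equiv> half2 s a b (invol PA 2 s d)"
  shows "trc PA 2 s (pmult PA 2 s (conv2 s (pmult PA 2 s a (invol PA 2 s a)) (pmult PA 2 s b (invol PA 2 s b)))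
      (pmult PA 2 s d (invol PA 2 s d))) = trc PA 3 s (pmult PA 3 s g (invol PA 3 s g))"
proof -
  have st: "invol PA 2 s a \<in> pspace PA 2 s" "invol PA 2 s b \<in> pspace PA 2 s" "invol PA 2 s d \<in> pspace PA 2 s"
    using a b d by (simp_all add: invol_closed)
  have g: "g \<in> pspace PA 3 s" unfolding g_def using a b st by (simp add: half2_closed)
  have ig: "invol PA 3 s g = actp (reflectP (two_box_half s)) [invol PA 2 s a, invol PA 2 s b, d]"
    using invol_actp[of "two_box_half s" "[a, b, invol PA 2 s d]" 3 s] a b d st
    by (simp add: g_def half2_def args_simps invol_invol)
  let ?X = "pmult PA 2 s (conv2 s (pmult PA 2 s a (invol PA 2 s a)) (pmult PA 2 s b (invol PA 2 s b)))
      (pmult PA 2 s d (invol PA 2 s d))"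
  have "trc PA 2 s ?X = trc PA 0 s (pclosure PA 2 s ?X)"
    by (intro trc_closure pmult_closed conv2_closed planar_checks a b d st)
  also have "pclosure PA 2 s ?X = pclosure PA 3 s (pmult PA 3 s g (invol PA 3 s g))"
    unfolding ig unfolding g_def by (rule closure_conv2[OF a st(1) b st(2) d st(3)])
  also have "trc PA 0 s \<dots> = trc PA 3 s (pmult PA 3 s g (invol PA 3 s g))"
    by (intro trc_closure[symmetric] pmult_closed planar_checks g invol_closed)
  finally show ?thesis .
qed

end

section \<open>The action of the Fourier transform on the first box space\<close>

text \<open>If \<open>a\<close> exceeded \<open>t\<close>, dividing by the powers of
  \<open>a\<close> would squeeze the positive \<open>K\<close> below a null sequence. The exponents
  start at 1, as do the powers of \<open>x\<close> in \<open>spectrum_bound\<close>.\<close>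

lemma power_growth_comparison:
  fixes a t :: real
  assumes "0 \<le> a" "0 \<le> t" "0 < K" and le: "\<And>n. a ^ Suc n * K \<le> D * t ^ Suc n"
  shows "a \<le> t"
proof (rule ccontr)
  assume "\<not> a \<le> t"
  then have at: "0 \<le> t / a" "t / a < 1" "a > 0" using assms(2) by auto
  have "K \<le> D * (t / a) ^ Suc n" for n
    using le[of n] at(3) by (simp add: power_divide field_simps)
  moreover have "(\<lambda>n. D * (t / a) ^ Suc n) \<longlonglongrightarrow> D * 0"
    by (intro tendsto_mult tendsto_const LIMSEQ_Suc LIMSEQ_realpow_zero at)
  ultimately have "K \<le> D * 0" by (intro LIMSEQ_le_const[of _ "D * 0"]) auto
  then show False using assms(3) by simp
qed

section \<open>Positivity of convolutions and the spectrum of x\<close>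

context cstar_planar_algebra
begin

text \<open>Actions of tangles are known to be linear only in the combined form c x + y; the value 0
  at 0 comes first, and homogeneity follows from it.\<close>

lemma linear_split:
  assumes lin: "\<And>c x y. x \<in> pspace PA n s \<Longrightarrow> y \<in> pspace PA n s \<Longrightarrow> f (scl PA c x + y) = scl PA c (f x) + f y"
    and x: "x \<in> pspace PA n s" and y: "y \<in> pspace PA n s"
  shows "f (x + y) = f x + f y" "f (scl PA c x) = scl PA c (f x)"
proof -
  interpret vector_space "scl PA" by (rule ambient)
  have 0: "0 \<in> pspace PA n s" using subspace[of n s] by (rule subspace_0)
  show "f (x + y) = f x + f y" using lin[OF x y, of 1] by simp
  have "f 0 = f 0 + f 0" using lin[OF 0 0, of 1] by simp
  then have "f 0 = 0" by simp
  then show "f (scl PA c x) = scl PA c (f x)" using lin[OF x 0, of c] by simp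
qed

lemma tracial:
  assumes n: "n = 1 \<or> n = 2"
  shows "tracial_star_algebra (scl PA) (pspace PA n s) (pmult PA n s) (punit PA n s) (invol PA n s) (trc PA n s)"
proof -
  have p: "planar_check (stackP n s)" "planar_check (unitP n s)" using n by auto
  interpret complex_space "scl PA" by (rule complex_space.intro[OF ambient])
  have 0: "0 \<in> pspace PA n s" using subspace[of n s] by (rule subspace_0)
  have tr0: "trc PA n s 0 = 0" using trc_linear[OF 0 0, of 1] by simp
  show ?thesis
  proof
    show "subspace (pspace PA n s)" by (rule subspace)
    show "\<exists>B. finite B \<and> pspace PA n s = span B" by (rule finite_dim)
    fix x y z :: 'a and c assume x: "x \<in> pspace PA n s"
    show "invol PA n s x \<in> pspace PA n s" "invol PA n s (invol PA n s x) = x"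
      "invol PA n s (scl PA c x) = scl PA (cnj c) (invol PA n s x)"
      "trc PA n s (pmult PA n s x (invol PA n s x)) \<in> \<real>\<^sub>\<ge>\<^sub>0"
      using x by (rule invol_closed invol_invol invol_scl trc_positive)+
    show "pmult PA n s (punit PA n s) x = x" "pmult PA n s x (punit PA n s) = x" using punit_mult[OF n x] .
    show "trc PA n s (scl PA c x) = c * trc PA n s x" using trc_linear[OF x 0, of c] tr0 by simp
    show "x = 0" if "trc PA n s (pmult PA n s x (invol PA n s x)) = 0" using trc_faithful[OF x that] .
    assume y: "y \<in> pspace PA n s"
    show "pmult PA n s x y \<in> pspace PA n s" using pmult_closed[OF p(1) x y] .
    show "pmult PA n s (scl PA c x) y = scl PA c (pmult PA n s x y)"
      by (rule linear_split(2)[of n s "\<lambda>x. pmult PA n s x y"]) (use pmult_linear_left[OF p(1)] x y in auto)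
    show "pmult PA n s x (scl PA c y) = scl PA c (pmult PA n s x y)"
      by (rule linear_split(2)[of n s "\<lambda>y. pmult PA n s x y"]) (use pmult_linear_right[OF p(1)] x y in auto)
    show "invol PA n s (x + y) = invol PA n s x + invol PA n s y"
      "invol PA n s (pmult PA n s x y) = pmult PA n s (invol PA n s y) (invol PA n s x)"
      "trc PA n s (pmult PA n s x y) = trc PA n s (pmult PA n s y x)"
      using x y by (rule invol_add invol_mult trc_commute)+
    show "trc PA n s (x + y) = trc PA n s x + trc PA n s y" using trc_linear[OF x y, of 1] by simp
    assume z: "z \<in> pspace PA n s"
    show "pmult PA n s (x + y) z = pmult PA n s x z + pmult PA n s y z"
      by (rule linear_split(1)[of n s "\<lambda>x. pmult PA n s x z"]) (use pmult_linear_left[OF p(1)] x y z in auto)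
    show "pmult PA n s z (x + y) = pmult PA n s z x + pmult PA n s z y"
      by (rule linear_split(1)[of n s "\<lambda>x. pmult PA n s z x"]) (use pmult_linear_right[OF p(1)] x y z in auto)
    show "pmult PA n s (pmult PA n s x y) z = pmult PA n s x (pmult PA n s y z)" using pmult_assoc[OF n x y z] .
  qed (rule punit_closed[OF p(2)])
qed

sublocale P1: tracial_star_algebra "scl PA" "pspace PA 1 s" "pmult PA 1 s" "punit PA 1 s" "invol PA 1 s" "trc PA 1 s" for s
  by (rule tracial) simp

sublocale P2: tracial_star_algebra "scl PA" "pspace PA 2 s" "pmult PA 2 s" "punit PA 2 s" "invol PA 2 s" "trc PA 2 s" for s
  by (rule tracial) simp

lemma positive_elem_1: "positive_elem PA 1 s x \<longleftrightarrow> P1.pos s x"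
  unfolding positive_elem_def P1.pos_iff_square ..

lemma positive_elem_2: "positive_elem PA 2 s x \<longleftrightarrow> P2.pos s x"
  unfolding positive_elem_def P2.pos_iff_square ..

lemma pconv_pos:
  assumes y: "P1.pos s y" and u: "P2.pos (\<not> s) u"
  shows "P1.pos s (pconv PA s y u)"
proof -
  obtain b where b: "b \<in> pspace PA 1 s" "y = pmult PA 1 s b (invol PA 1 s b)"
    using y unfolding P1.pos_iff_square by blast
  obtain a where a: "a \<in> pspace PA 2 (\<not> s)" "u = pmult PA 2 (\<not> s) a (invol PA 2 (\<not> s) a)"
    using u unfolding P2.pos_iff_square by blast
  have "trc PA 1 s (pmult PA 1 s (pconv PA s y u) (pmult PA 1 s d (invol PA 1 s d))) \<in> \<real>\<^sub>\<ge>\<^sub>0"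
    if d: "d \<in> pspace PA 1 s" for d
    unfolding b(2) a(2) trc_conv[OF b(1) a(1) d]
    by (intro trc_positive half1_closed a b invol_closed d)
  then show ?thesis
    unfolding P1.pos_def using pconv_closed[OF P1.pos_in[OF y] P2.pos_in[OF u]] by blast
qed

lemma conv2_pos:
  assumes u: "P2.pos s u" and v: "P2.pos s v"
  shows "P2.pos s (conv2 s u v)"
proof -
  obtain a where a: "a \<in> pspace PA 2 s" "u = pmult PA 2 s a (invol PA 2 s a)"
    using u unfolding P2.pos_iff_square by blast
  obtain b where b: "b \<in> pspace PA 2 s" "v = pmult PA 2 s b (invol PA 2 s b)"
    using v unfolding P2.pos_iff_square by blast
  have "trc PA 2 s (pmult PA 2 s (conv2 s u v) (pmult PA 2 s d (invol PA 2 s d))) \<in> \<real>\<^sub>\<ge>\<^sub>0"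
    if d: "d \<in> pspace PA 2 s" for d
    unfolding b(2) a(2) trc_conv2[OF a(1) b(1) d]
    by (intro trc_positive half2_closed a b invol_closed d)
  then show ?thesis
    unfolding P2.pos_def using conv2_closed[OF P2.pos_in[OF u] P2.pos_in[OF v]] by blast
qed

text \<open>The case of \<open>trc_conv\<close> in which \<open>b\<close> and \<open>d\<close> are
  the unit. The right-hand side is the squared length of the rotated \<open>a\<close>, whence the
  definiteness used in \<open>fourier_pairing_bound\<close>.\<close>

lemma trc_conv_unit:
  assumes a: "a \<in> pspace PA 2 (\<not> s)"
  shows "trc PA 1 s (pconv PA s (punit PA 1 s) (pmult PA 2 (\<not> s) a (invol PA 2 (\<not> s) a)))
    = trc PA 2 s (pmult PA 2 s (pfourier PA (\<not> s) a) (invol PA 2 s (pfourier PA (\<not> s) a)))"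
proof -
  have u: "punit PA 1 s \<in> pspace PA 1 s" by (rule P1.one_closed)
  have "pmult PA 2 (\<not> s) a (invol PA 2 (\<not> s) a) \<in> pspace PA 2 (\<not> s)" using a by (intro P2.mult_closed P2.star_closed)
  then have "pconv PA s (punit PA 1 s) (pmult PA 2 (\<not> s) a (invol PA 2 (\<not> s) a)) \<in> pspace PA 1 s"
    by (rule pconv_closed[OF u])
  then show ?thesis
    using trc_conv[OF u a u] unfolding P1.star_one half1_unit[OF a] P1.one_mult[OF u] by (simp only: P1.mult_one)
qed

lemma pconv_linear:
  assumes u: "u \<in> pspace PA 2 (\<not> s)"
  shows "y \<in> pspace PA 1 s \<Longrightarrow> z \<in> pspace PA 1 s \<Longrightarrow> pconv PA s (y + z) u = pconv PA s y u + pconv PA s z u"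
    "y \<in> pspace PA 1 s \<Longrightarrow> pconv PA s (scl PA c y) u = scl PA c (pconv PA s y u)"
  using linear_split[of 1 s "\<lambda>y. pconv PA s y u", OF pconv_linear_left[OF _ _ u]] by blast+

lemma positive_map_pconv:
  assumes u: "P2.pos (\<not> s) u"
  shows "P1.positive_map s (\<lambda>y. pconv PA s y u)"
  unfolding P1.positive_map_def using pconv_closed pconv_linear pconv_pos u P2.pos_in[OF u] by blast

text \<open>
  With $a$ a square root of \<open>pfourier PA s v\<close>, that is \<open>pfourier PA s v\<close> $= aa^*$, both sides are quadratic
  forms in $a$, and the one on the right is definite.
\<close>

lemma fourier_pairing_bound:
  assumes w: "w \<in> pspace PA 2 s"
  shows "\<exists>M\<ge>0. \<forall>v. v \<in> pspace PA 2 s \<longrightarrow> P2.pos (\<not> s) (pfourier PA s v) \<longrightarrow>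
    cmod (trc PA 2 s (pmult PA 2 s (pmult PA 2 s w v) (invol PA 2 s w)))
      \<le> M * Re (trc PA 1 s (pconv PA s (punit PA 1 s) (pfourier PA s v)))"
proof -
  let ?V = "pspace PA 2 (\<not> s)" and ?F = "pfourier PA (\<not> s)"
  let ?psi = "\<lambda>v. trc PA 2 s (pmult PA 2 s (pmult PA 2 s w v) (invol PA 2 s w))"
  \<comment> \<open>\<open>Q\<close> is the trace inner product pulled back along the rotation,
    definite because the rotation is injective; \<open>G\<close> is the functional to be bounded,
    written as a form in the root \<open>a\<close>.\<close>
  define Q where "Q a b = trc PA 2 s (pmult PA 2 s (?F a) (invol PA 2 s (?F b)))" for a b
  define G where "G a b = ?psi (fourier_inv s (pmult PA 2 (\<not> s) a (invol PA 2 (\<not> s) b)))" for a b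
  have F_in: "?F a \<in> pspace PA 2 s" if "a \<in> ?V" for a using pfourier_closed[OF that] by simp
  have F_add: "?F (a + b) = ?F a + ?F b" and F_scl: "?F (scl PA c a) = scl PA c (?F a)"
    if "a \<in> ?V" "b \<in> ?V" for a b c
    using linear_split[of 2 "\<not> s" ?F, OF pfourier_linear that] by blast+
  have inv_add: "fourier_inv s (a + b) = fourier_inv s a + fourier_inv s b"
    and inv_scl: "fourier_inv s (scl PA c a) = scl PA c (fourier_inv s a)" if "a \<in> ?V" "b \<in> ?V" for a b c
    using linear_split[of 2 "\<not> s" "fourier_inv s", OF fourier_inv_linear that] by blast+
  have inner: "trc PA 2 s (pmult PA 2 s b (invol PA 2 s a)) = cnj (trc PA 2 s (pmult PA 2 s a (invol PA 2 s b)))"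
    if "a \<in> pspace PA 2 s" "b \<in> pspace PA 2 s" for a b
    using P2.tr_star[of "pmult PA 2 s a (invol PA 2 s b)" s] that by (simp add: P2.star_mult)
  have F_zero: "a = 0" if "a \<in> ?V" "?F a = 0" for a
  proof -
    have "a = fourier_inv (\<not> s) (?F a)" using fourier_inv_fourier[OF that(1)] by simp
    also have "\<dots> = fourier_inv (\<not> s) (?F 0)" using that(2) F_scl[OF P2.A_zero P2.A_zero, of 0] by simp
    also have "\<dots> = 0" using fourier_inv_fourier[OF P2.A_zero[of "\<not> s"]] by simp
    finally show ?thesis .
  qed
  have "P1.bilinear_on ?V Q"
    unfolding P1.bilinear_on_def Q_def
    using F_in by (simp add: F_add F_scl P2.star_add P2.mult_add_left P2.mult_add_right P2.tr_add)
  moreover have "Q b a = cnj (Q a b)" if "a \<in> ?V" "b \<in> ?V" for a b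
    unfolding Q_def by (rule inner[OF F_in F_in]) (fact that)+
  moreover have "Q a a \<in> \<real>\<^sub>\<ge>\<^sub>0" if "a \<in> ?V" for a
    unfolding Q_def by (rule trc_positive[OF F_in[OF that]])
  moreover have "a = 0" if "a \<in> ?V" "Q a a = 0" for a
    using that F_zero trc_faithful[OF F_in[OF that(1)]] unfolding Q_def by blast
  ultimately have Q: "P1.inner_product_on ?V Q" unfolding P1.inner_product_on_def by blast
  have G: "P1.bilinear_on ?V G"
    unfolding P1.bilinear_on_def G_def
    using w by (simp add: inv_add inv_scl P2.star_add P2.mult_add_left P2.mult_add_right P2.tr_add fourier_inv_closed)
  obtain B where B: "finite B" "?V = P1.span B" using finite_dim[of 2 "\<not> s"] by blast
  obtain M where M: "M \<ge> 0" "\<And>a. a \<in> ?V \<Longrightarrow> cmod (G a a) \<le> M * Re (Q a a)"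
    using P1.form_bounded_by_inner_product[OF Q subspace B G] by blast
  have "cmod (?psi v) \<le> M * Re (trc PA 1 s (pconv PA s (punit PA 1 s) (pfourier PA s v)))"
    if v: "v \<in> pspace PA 2 s" and pv: "P2.pos (\<not> s) (pfourier PA s v)" for v
  proof -
    obtain a where a: "a \<in> ?V" "pfourier PA s v = pmult PA 2 (\<not> s) a (invol PA 2 (\<not> s) a)"
      using pv unfolding P2.pos_iff_square by blast
    have "G a a = ?psi v" unfolding G_def a(2)[symmetric] fourier_inv_fourier[OF v] ..
    moreover have "Q a a = trc PA 1 s (pconv PA s (punit PA 1 s) (pfourier PA s v))"
      unfolding Q_def a(2) trc_conv_unit[OF a(1)] ..
    ultimately show ?thesis using M(2)[OF a(1)] by simp
  qed
  then show ?thesis using M(1) by blast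
qed

text \<open>A spectral value \<open>l\<close> gives a nonzero \<open>w\<close> with w x = l w. The
  functional taking v to the trace of w v \<open>star\<close> w then multiplies by \<open>l\<close>
  from each power of \<open>x\<close> to the next, while \<open>fourier_pairing_bound\<close> and
  \<open>positive_map_power_growth\<close> bound it by a multiple of the same power of
  \<open>t\<close>.\<close>

lemma spectrum_bound:
  assumes x: "x \<in> pspace PA 2 s" and pos: "P2.pos (\<not> s) (pfourier PA s x)"
    and y: "P1.spos s y" "pconv PA s y (pfourier PA s x) = scl PA (complex_of_real t) y" and t: "0 \<le> t"
    and l: "l \<in> alg_spectrum PA 2 s x"
  shows "cmod l \<le> t"
proof -
  let ?u = "pfourier PA s x" and ?e = "punit PA 2 s" and ?T = "\<lambda>y. pconv PA s y (pfourier PA s x)"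
  note T = positive_map_pconv[OF pos]
  have e: "?e \<in> pspace PA 2 s" by (rule P2.one_closed)
  have lx: "scl PA l ?e - x \<in> pspace PA 2 s" using x by simp
  have "\<not> (\<exists>z\<in>pspace PA 2 s. pmult PA 2 s (scl PA l ?e - x) z = ?e \<and> pmult PA 2 s z (scl PA l ?e - x) = ?e)"
    using l lx unfolding alg_spectrum_def invertible_elem_def by blast
  then obtain w where w: "w \<in> pspace PA 2 s" "w \<noteq> 0" "pmult PA 2 s w (scl PA l ?e - x) = 0"
    using P2.not_invertible_annihilator[OF lx] by blast
  have wx: "pmult PA 2 s w x = scl PA l w"
    using w x by (simp add: P2.mult_diff_right)
  \<comment> \<open>\<open>xs n\<close> is the power of \<open>x\<close> with exponent n + 1, so
    that the induction for positivity starts at the hypothesis on \<open>x\<close> itself.\<close>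
  define xs where "xs n = ((\<lambda>v. pmult PA 2 s v x) ^^ n) x" for n
  have xs_Suc: "xs (Suc n) = pmult PA 2 s (xs n) x" for n by (simp add: xs_def)
  have xs_in: "xs n \<in> pspace PA 2 s" for n by (induction n) (simp_all add: xs_Suc x, simp add: xs_def x)
  have wxs: "pmult PA 2 s w (xs n) = scl PA (l ^ Suc n) w" for n
  proof (induction n)
    case (Suc n)
    have "pmult PA 2 s w (xs (Suc n)) = pmult PA 2 s (pmult PA 2 s w (xs n)) x"
      unfolding xs_Suc using w x xs_in by (simp add: P2.mult_assoc)
    then show ?case using Suc w x by (simp add: wx mult.commute)
  qed (simp add: xs_def wx)
  have fourier_Suc: "pfourier PA s (xs (Suc n)) = conv2 (\<not> s) (pfourier PA s (xs n)) ?u" for n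
    unfolding xs_Suc by (rule pfourier_pmult[OF xs_in x])
  have xs_pos: "P2.pos (\<not> s) (pfourier PA s (xs n))" for n
  proof (induction n)
    case (Suc n)
    then show ?case unfolding fourier_Suc by (rule conv2_pos[OF _ pos])
  qed (simp add: xs_def pos)
  have conv_xs: "pconv PA s z (pfourier PA s (xs n)) = (?T ^^ Suc n) z" if z: "z \<in> pspace PA 1 s" for z n
  proof (induction n)
    case (Suc n)
    have "pconv PA s z (pfourier PA s (xs (Suc n))) = ?T (pconv PA s z (pfourier PA s (xs n)))"
      unfolding fourier_Suc by (rule pconv_pconv[symmetric, OF z pfourier_closed[OF xs_in] pfourier_closed[OF x]])
    then show ?case using Suc by simp
  qed (simp add: xs_def)
  obtain M where M: "M \<ge> 0" "\<And>v. v \<in> pspace PA 2 s \<Longrightarrow> P2.pos (\<not> s) (pfourier PA s v) \<Longrightarrow>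
    cmod (trc PA 2 s (pmult PA 2 s (pmult PA 2 s w v) (invol PA 2 s w)))
      \<le> M * Re (trc PA 1 s (pconv PA s (punit PA 1 s) (pfourier PA s v)))"
    using fourier_pairing_bound[OF w(1)] by blast
  obtain C where C: "\<And>n. Re (trc PA 1 s ((?T ^^ n) (punit PA 1 s))) \<le> C * t ^ n"
    using P1.positive_map_power_growth[OF T y] by blast
  let ?K = "trc PA 2 s (pmult PA 2 s w (invol PA 2 s w))"
  have K: "0 < Re ?K" by (rule P2.tr_mult_star_positive[OF w(1,2)])
  have "cmod l ^ Suc n * Re ?K \<le> (M * C) * t ^ Suc n" for n
  proof -
    have "cmod l ^ Suc n * Re ?K \<le> cmod l ^ Suc n * cmod ?K" by (intro mult_left_mono complex_Re_le_cmod) simp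
    also have "\<dots> = cmod (trc PA 2 s (pmult PA 2 s (pmult PA 2 s w (xs n)) (invol PA 2 s w)))"
      unfolding wxs using w by (simp add: norm_mult norm_power)
    also have "\<dots> \<le> M * Re (trc PA 1 s (pconv PA s (punit PA 1 s) (pfourier PA s (xs n))))"
      by (rule M(2)[OF xs_in xs_pos])
    also have "\<dots> \<le> M * (C * t ^ Suc n)"
      unfolding conv_xs[OF P1.one_closed] by (rule mult_left_mono[OF C M(1)])
    finally show ?thesis by simp
  qed
  then show ?thesis by (intro power_growth_comparison[OF _ t K]) auto
qed

text \<open>A right inverse \<open>z\<close> of l - x would recover \<open>y\<close> by convolving
  it first with the Fourier transform of l - x and then with that of \<open>z\<close>; the first
  convolution already gives 0.\<close>

lemma eigenvalue_in_spectrum: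
  assumes x: "x \<in> pspace PA 2 s" and y: "y \<in> pspace PA 1 s" "y \<noteq> 0"
    and ev: "pconv PA s y (pfourier PA s x) = scl PA l y"
  shows "l \<in> alg_spectrum PA 2 s x"
proof (rule ccontr)
  let ?e = "punit PA 2 s"
  assume "l \<notin> alg_spectrum PA 2 s x"
  then obtain z where z: "z \<in> pspace PA 2 s" "pmult PA 2 s (scl PA l ?e - x) z = ?e"
    unfolding alg_spectrum_def invertible_elem_def by blast
  have e: "?e \<in> pspace PA 2 s" by (rule P2.one_closed)
  have lx: "scl PA l ?e - x \<in> pspace PA 2 s" using x by simp
  have F: "pfourier PA s ?e \<in> pspace PA 2 (\<not> s)" "pfourier PA s x \<in> pspace PA 2 (\<not> s)" "pfourier PA s z \<in> pspace PA 2 (\<not> s)"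
    "pfourier PA s (scl PA l ?e - x) \<in> pspace PA 2 (\<not> s)"
    using e x z lx by (simp_all add: pfourier_closed)
  have "scl PA l ?e - x = scl PA (- 1) x + scl PA l ?e" by (simp add: P1.scale_minus_left)
  then have Fl: "pfourier PA s (scl PA l ?e - x) = scl PA (- 1) (pfourier PA s x) + scl PA l (pfourier PA s ?e)"
    using pfourier_linear[OF x, of "scl PA l ?e" "- 1"] linear_split(2)[of 2 s "pfourier PA s", OF pfourier_linear e e] e by simp
  have "pconv PA s y (pfourier PA s (scl PA l ?e - x)) = scl PA (- 1) (scl PA l y) + scl PA l y"
    unfolding Fl using pconv_linear_right[OF F(2) _ y(1), of "scl PA l (pfourier PA s ?e)" "- 1"] F(1)
      linear_split(2)[of 2 "\<not> s" "\<lambda>u. pconv PA s y u", OF pconv_linear_right[OF _ _ y(1)] F(1) F(1)]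
    by (simp add: ev pconv_fourier_unit[OF y(1)])
  then have 0: "pconv PA s y (pfourier PA s (scl PA l ?e - x)) = 0" by (simp add: P1.scale_minus_left)
  have "y = pconv PA s y (pfourier PA s (pmult PA 2 s (scl PA l ?e - x) z))" unfolding z(2) by (simp add: pconv_fourier_unit[OF y(1)])
  also have "\<dots> = pconv PA s (pconv PA s y (pfourier PA s (scl PA l ?e - x))) (pfourier PA s z)"
    unfolding pfourier_pmult[OF lx z(1)] by (rule pconv_pconv[symmetric, OF y(1) F(4,3)])
  also have "\<dots> = 0"
    unfolding 0 using pconv_linear(2)[OF F(3) P1.A_zero, of 0] by simp
  finally show False using y(2) by simp
qed

end

theorem theorem3p10:
  fixes PA :: "'a::ab_group_add cstar_planar_data" and s :: bool and x :: 'a and r :: real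
  assumes "cstar_planar_algebra PA"
    and "x \<in> pspace PA 2 s"
    and "F_positive PA s x"
    and "irreducible_elem PA s x"
    and "r = alg_spectral_radius PA 2 s x"
  shows "(\<exists>y \<in> pspace PA 1 s.
            strictly_positive PA 1 s y \<and>
            pconv PA s y (pfourier PA s x) = scl PA (complex_of_real r) y)
       \<and> (\<forall>y \<in> pspace PA 1 s.
            strictly_positive PA 1 s y \<and>
            pconv PA s y (pfourier PA s x) = scl PA (complex_of_real r) y \<longrightarrow>
            (\<forall>y' \<in> pspace PA 1 s.
               strictly_positive PA 1 s y' \<and>
               pconv PA s y' (pfourier PA s x) = scl PA (complex_of_real r) y' \<longrightarrow>
               (\<exists>c. y' = scl PA c y)) \<and>
            (\<forall>y' \<in> pspace PA 1 s.
               pconv PA s y' (pfourier PA s x) = scl PA (complex_of_real r) y' \<longrightarrow>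
               (\<exists>c. y' = scl PA c y)))"
proof -
  interpret cstar_planar_algebra PA by fact
  let ?u = "pfourier PA s x" and ?e = "punit PA 1 s" and ?T = "\<lambda>y. pconv PA s y (pfourier PA s x)"
  have pos: "P2.pos (\<not> s) ?u" using assms(3) unfolding F_positive_def positive_elem_2 .
  note T = positive_map_pconv[OF pos]
  have irr: "P1.irreducible_map s ?T"
    using assms(4) unfolding P1.irreducible_map_def irreducible_elem_def projection_def le_elem_def positive_elem_1 by blast
  have strict: "strictly_positive PA 1 s y \<longleftrightarrow> P1.spos s y" for y
  proof
    assume "strictly_positive PA 1 s y"
    then show "P1.spos s y"
      unfolding strictly_positive_def positive_elem_1 invertible_elem_def using P1.pos_invertible_spos by blast
  next
    assume "P1.spos s y"
    then show "strictly_positive PA 1 s y"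
      unfolding strictly_positive_def positive_elem_1 invertible_elem_def
      using P1.spos_pos P1.spos_inverse P1.pos_in by blast
  qed
  have unique: "\<exists>c. y' = scl PA c y"
    if "strictly_positive PA 1 s y" "?T y = scl PA (complex_of_real r) y"
      "y' \<in> pspace PA 1 s" "?T y' = scl PA (complex_of_real r) y'" for y y'
    using P1.irreducible_eigenvector_unique[OF T irr _ that(2,3,4)] that(1) unfolding strict .
  have "\<exists>y. P1.spos s y \<and> ?T y = scl PA (complex_of_real r) y"
  proof (cases "?e = 0")
    \<comment> \<open>The zero algebra has no element of trace 1 to serve as a state; there 0 is its
      own inverse and is the required eigenvector.\<close>
    case True
    have zero: "y = 0" if "y \<in> pspace PA 1 s" for y
      using P1.one_mult[OF that] P1.mult_zero_left[OF that] unfolding True by simp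
    have 00: "pmult PA 1 s 0 0 = ?e" unfolding True by (rule P1.mult_zero_left[OF P1.A_zero])
    have "P1.spos s 0" by (rule P1.pos_invertible_spos[OF P1.pos_zero P1.A_zero 00 00])
    moreover have "?T 0 = scl PA (complex_of_real r) 0"
      using zero[OF pconv_closed[OF P1.A_zero P2.pos_in[OF pos]]] by simp
    ultimately show ?thesis by blast
  next
    case False
    obtain y t where y: "P1.pos s y" "trc PA 1 s y = 1" "?T y = scl PA (complex_of_real t) y"
      using P1.positive_map_eigenvector[OF T False] by blast
    have y0: "y \<noteq> 0" using y(2) P1.tr_zero[of s] by auto
    have sp: "P1.spos s y" by (rule P1.irreducible_eigenvector_spos[OF T irr y(1) y0 y(3)])
    have t: "0 \<le> t" by (rule P1.eigenvalue_nonneg[OF T y(1) y0 y(3)])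
    have "complex_of_real t \<in> alg_spectrum PA 2 s x"
      by (rule eigenvalue_in_spectrum[OF assms(2) P1.pos_in[OF y(1)] y0 y(3)])
    then have "t \<in> cmod ` alg_spectrum PA 2 s x" using t by force
    \<comment> \<open>\<open>t\<close> belongs to the spectrum and bounds the moduli of its
      elements, so the supremum is attained at \<open>t\<close>.\<close>
    then have "r = t"
      unfolding assms(5) alg_spectral_radius_def
      by (rule cSup_eq_maximum) (use spectrum_bound[OF assms(2) pos sp y(3) t] in auto)
    then show ?thesis using sp y(3) by blast
  qed
  then obtain y where y: "P1.spos s y" "?T y = scl PA (complex_of_real r) y" by blast
  moreover have "y \<in> pspace PA 1 s" using P1.spos_pos[OF y(1)] by (rule P1.pos_in)
  ultimately show ?thesis using unique unfolding strict[symmetric] by blast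
qed

end
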